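(* On any two charge microstate geometry $(\mathcal M,g)$ there exist "mode solutions": regular solutions to the wave equation $\Box_g u=0$, where Dirichlet boundary conditions are imposed at $r=R\,R_z\,\mu_\ell$ (in particular, these solutions are regular at $r=0$), where $R$ is some suitably large constant. These mode solutions are of the form $$u=e^{-i\omega t+i\lambda z+im_\psi\psi+im_\phi\phi}\,u_r(r)\,u_\theta(\theta)$$ for some $\omega\in\mathbb R$ and integers $\lambda R_z$, $m_\psi$ and $m_\phi$. Here $(\mu_\ell)^2$ is the $\ell$-th eigenvalue associated with the eigenvalue equation for $u_\theta$ (given in the context), and $$\ell=\mu_\ell-1+\mathcal O\big((\mu_\ell)^{-1}\big).$$ Finally, these mode solutions can be chosen such that the frequency $\omega$ does not scale with $\ell$: if some constant $\omega_{\max}$ is chosen sufficiently large, then for all sufficiently large $\ell$ there exists a mode solution with $$\omega\le\omega_{\max}.$$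
   Context: Two charge microstate geometry: fix $Q_1,Q_2,R_z>0$ and put $a=\sqrt{Q_1Q_2}/R_z$, $f=r^2+a^2\cos^2\theta$, $h=\sqrt{(1+Q_1/f)(1+Q_2/f)}$. The manifold $\mathcal M$ is $\mathbb R\times\mathbb S^3\times\mathbb R^2$, with coordinates $t\in\mathbb R$ on $\mathbb R$, Hopf coordinates $\theta\in[0,\pi/2]$ and $\phi,\psi$ (period $2\pi$) on $\mathbb S^3$, and polar-type coordinates $r\ge0$ and $z$ on $\mathbb R^2$, where $z$ parametrises a circle of radius $R_z$ (period $2\pi R_z$). The metric is $$g=-\tfrac1h(dt^2-dz^2)+hf\Big(d\theta^2+\tfrac{dr^2}{r^2+a^2}\Big)-\tfrac{2a\sqrt{Q_1Q_2}}{hf}(\cos^2\theta\,dz\,d\psi+\sin^2\theta\,dt\,d\phi)+h\Big(\big(r^2+\tfrac{a^2Q_1Q_2\cos^2\theta}{h^2f^2}\big)\cos^2\theta\,d\psi^2+\big(r^2+a^2-\tfrac{a^2Q_1Q_2\sin^2\theta}{h^2f^2}\big)\sin^2\theta\,d\phi^2\Big),$$ and it is smooth everywhere on $\mathcal M$ (including at $r=0$). Angular eigenvalue equation: put $\tilde\omega=\omega R_z$, $\tilde\lambda=\lambda R_z$. The equation for $u_\theta$, written for modes with $m_\psi=0$ (the modes that are constructed), is $$-\frac1{\sin2\theta}\frac{d}{d\theta}\Big(\sin2\theta\frac{du_\theta}{d\theta}\Big)+\Big(\frac{(m_\phi)^2}{\sin^2\theta}+(\tilde\lambda^2-\tilde\omega^2)\frac{a^2}{R_z^2}\cos^2\theta\Big)u_\theta=(\mu_\ell)^2u_\theta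 .$$ The labelling by $\ell$ is such that, in the construction, $m_\phi=-\ell$, and when the $\cos^2\theta$ term is absent $(\mu_\ell)^2=\ell(\ell+2)$ with eigenfunction proportional to $\sin^\ell\theta$. *)

theory Defs
  imports "HOL-Analysis.Analysis" "HOL-Library.Landau_Symbols"
begin

section \<open>Coordinates\<close>

datatype coord = Tc | Rc | Thc | Phc | Psc | Zc

instance coord :: finite
proof
  have "(UNIV :: coord set) \<subseteq> {Tc, Rc, Thc, Phc, Psc, Zc}"
    using coord.exhaust by blast
  then show "finite (UNIV :: coord set)"
    by (rule finite_subset) simp
qed

text \<open>A point is given by \<open>(t, r, \<theta>, \<phi>, \<psi>, z)\<close>, stored as \<open>x :: real ^ coord\<close>.\<close>


section \<open>Smooth functions\<close>

text \<open>On an open set \<open>S\<close> this is the usual class \<open>C\<^sup>k\<close>: all iterated directional derivatives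
  up to order \<open>k\<close> exist (as Frechet derivatives) and are continuous.\<close>

primrec Ck_on :: "nat \<Rightarrow> 'a::real_normed_vector set \<Rightarrow> ('a \<Rightarrow> 'b::real_normed_vector) \<Rightarrow> bool" where
  "Ck_on 0 S F \<longleftrightarrow> continuous_on S F"
| "Ck_on (Suc k) S F \<longleftrightarrow>
     F differentiable_on S \<and> (\<forall>v. Ck_on k S (\<lambda>x. frechet_derivative F (at x) v))"

definition smooth_on :: "'a::real_normed_vector set \<Rightarrow> ('a \<Rightarrow> 'b::real_normed_vector) \<Rightarrow> bool" where
  "smooth_on S F \<longleftrightarrow> (\<forall>k. Ck_on k S F)"


section \<open>The wave operator of a metric given in coordinates\<close>

definition pd :: "'n::finite \<Rightarrow> (real ^ 'n \<Rightarrow> 'b::real_normed_vector) \<Rightarrow> real ^ 'n \<Rightarrow> 'b" where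
  "pd i F x = vector_derivative (\<lambda>s. F (x + s *\<^sub>R axis i 1)) (at 0)"

definition box :: "(real ^ 'n \<Rightarrow> real ^ 'n ^ 'n::finite) \<Rightarrow> (real ^ 'n \<Rightarrow> complex) \<Rightarrow> real ^ 'n \<Rightarrow> complex" where
  "box g u x =
     (\<Sum>i\<in>UNIV. pd i (\<lambda>y. \<Sum>j\<in>UNIV.
        (sqrt \<bar>det (g y)\<bar> * matrix_inv (g y) $ i $ j) *\<^sub>R pd j u y) x) /\<^sub>R sqrt \<bar>det (g x)\<bar>"


section \<open>Two charge microstate geometries\<close>

definition ms_a :: "real \<Rightarrow> real \<Rightarrow> real \<Rightarrow> real" where
  "ms_a Q1 Q2 Rz = sqrt (Q1 * Q2) / Rz"

definition ms_f :: "real \<Rightarrow> real \<Rightarrow> real \<Rightarrow> real ^ coord \<Rightarrow> real" where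
  "ms_f Q1 Q2 Rz x = (x $ Rc)\<^sup>2 + (ms_a Q1 Q2 Rz)\<^sup>2 * (cos (x $ Thc))\<^sup>2"

definition ms_h :: "real \<Rightarrow> real \<Rightarrow> real \<Rightarrow> real ^ coord \<Rightarrow> real" where
  "ms_h Q1 Q2 Rz x = sqrt ((1 + Q1 / ms_f Q1 Q2 Rz x) * (1 + Q2 / ms_f Q1 Q2 Rz x))"

text \<open>The metric is written with products of differentials, so a term \<open>2 c dx dy\<close> contributes \<open>c\<close>
  to each of the two symmetric off-diagonal entries.\<close>

definition ms_metric :: "real \<Rightarrow> real \<Rightarrow> real \<Rightarrow> real ^ coord \<Rightarrow> real ^ coord ^ coord" where
  "ms_metric Q1 Q2 Rz x =
     (let a = ms_a Q1 Q2 Rz; f = ms_f Q1 Q2 Rz x; h = ms_h Q1 Q2 Rz x; r = x $ Rc;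
          C = (cos (x $ Thc))\<^sup>2; S = (sin (x $ Thc))\<^sup>2
      in \<chi> i j. case (i, j) of
           (Tc, Tc) \<Rightarrow> - (1 / h)
         | (Zc, Zc) \<Rightarrow> 1 / h
         | (Thc, Thc) \<Rightarrow> h * f
         | (Rc, Rc) \<Rightarrow> h * f / (r\<^sup>2 + a\<^sup>2)
         | (Zc, Psc) \<Rightarrow> - (a * sqrt (Q1 * Q2) / (h * f)) * C
         | (Psc, Zc) \<Rightarrow> - (a * sqrt (Q1 * Q2) / (h * f)) * C
         | (Tc, Phc) \<Rightarrow> - (a * sqrt (Q1 * Q2) / (h * f)) * S
         | (Phc, Tc) \<Rightarrow> - (a * sqrt (Q1 * Q2) / (h * f)) * S
         | (Psc, Psc) \<Rightarrow> h * (r\<^sup>2 + a\<^sup>2 * Q1 * Q2 * C / (h\<^sup>2 * f\<^sup>2)) * C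
         | (Phc, Phc) \<Rightarrow> h * (r\<^sup>2 + a\<^sup>2 - a\<^sup>2 * Q1 * Q2 * S / (h\<^sup>2 * f\<^sup>2)) * S
         | _ \<Rightarrow> 0)"

text \<open>The manifold \<open>\<real> \<times> S\<^sup>3 \<times> \<real>\<^sup>2\<close> is realised inside \<open>\<real> \<times> \<complex>\<^sup>2 \<times> \<complex>\<close>, and \<open>ms_point\<close> sends
  coordinates to points. The circle that shrinks at \<open>r = 0\<close> is the orbit of
  \<open>R\<^sub>z \<partial>\<^sub>z + \<partial>\<^sub>\<psi>\<close> (the kernel of the metric there), so the Hopf angle that goes with the polar
  coordinates \<open>(r, z / R\<^sub>z)\<close> on \<open>\<real>\<^sup>2\<close> is \<open>\<psi> - z / R\<^sub>z\<close>: this is the differentiable structure for which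
  the metric is smooth at \<open>r = 0\<close>. For functions that do not depend on \<open>\<psi>\<close> the shift is immaterial.\<close>

definition ms_point :: "real \<Rightarrow> real ^ coord \<Rightarrow> real \<times> complex \<times> complex \<times> complex" where
  "ms_point Rz x =
     (x $ Tc,
      complex_of_real (sin (x $ Thc)) * cis (x $ Phc),
      complex_of_real (cos (x $ Thc)) * cis (x $ Psc - x $ Zc / Rz),
      complex_of_real (x $ Rc) * cis (x $ Zc / Rz))"

definition ms_region :: "real \<Rightarrow> (real ^ coord) set" where
  "ms_region \<rho> = {x. 0 \<le> x $ Rc \<and> x $ Rc \<le> \<rho> \<and> 0 \<le> x $ Thc \<and> x $ Thc \<le> pi / 2}"

text \<open>The coordinates are a local chart away from \<open>r = 0\<close>, \<open>\<theta> = 0\<close> and \<open>\<theta> = \<pi>/2\<close>.\<close>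

definition ms_interior :: "real \<Rightarrow> (real ^ coord) set" where
  "ms_interior \<rho> = {x. 0 < x $ Rc \<and> x $ Rc < \<rho> \<and> 0 < x $ Thc \<and> x $ Thc < pi / 2}"

text \<open>Regular: \<open>u\<close> is the coordinate expression of a smooth function on the part \<open>r \<le> \<rho>\<close> of the manifold
  (in particular across \<open>r = 0\<close> and the axes of \<open>S\<^sup>3\<close>), i.e. of the restriction of a function that is smooth on
  an open neighbourhood in the ambient space.\<close>

definition ms_regular :: "real \<Rightarrow> real \<Rightarrow> (real ^ coord \<Rightarrow> complex) \<Rightarrow> bool" where
  "ms_regular Rz \<rho> u \<longleftrightarrow>
     (\<exists>S U. open S \<and> smooth_on S U \<and>
        (\<forall>x\<in>ms_region \<rho>. ms_point Rz x \<in> S \<and> u x = U (ms_point Rz x)))"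

definition mode_fun ::
  "real \<Rightarrow> real \<Rightarrow> int \<Rightarrow> int \<Rightarrow> (real \<Rightarrow> real) \<Rightarrow> (real \<Rightarrow> real) \<Rightarrow> real ^ coord \<Rightarrow> complex" where
  "mode_fun \<omega> lam m\<psi> m\<phi> ur u\<theta> x =
     cis (- \<omega> * x $ Tc + lam * x $ Zc + of_int m\<psi> * x $ Psc + of_int m\<phi> * x $ Phc)
       * complex_of_real (ur (x $ Rc)) * complex_of_real (u\<theta> (x $ Thc))"

text \<open>A nontrivial regular solution of the wave equation on the region \<open>r \<le> \<rho>\<close>, of separated form, that
  vanishes at \<open>r = \<rho>\<close>. The coordinate expression of the wave operator is used where the
  coordinates form a chart; that set is dense, and both \<open>u\<close> and the metric are smooth on the whole region,
  so the equation holds on all of it.\<close>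

definition mode_solution ::
  "real \<Rightarrow> real \<Rightarrow> real \<Rightarrow> real \<Rightarrow> real \<Rightarrow> real \<Rightarrow> int \<Rightarrow> int \<Rightarrow>
   (real \<Rightarrow> real) \<Rightarrow> (real \<Rightarrow> real) \<Rightarrow> bool" where
  "mode_solution Q1 Q2 Rz \<rho> \<omega> lam m\<psi> m\<phi> ur u\<theta> \<longleftrightarrow>
     (let u = mode_fun \<omega> lam m\<psi> m\<phi> ur u\<theta> in
        lam * Rz \<in> \<int> \<and>
        ms_regular Rz \<rho> u \<and>
        (\<exists>x\<in>ms_region \<rho>. u x \<noteq> 0) \<and>
        (\<forall>x\<in>ms_interior \<rho>. box (ms_metric Q1 Q2 Rz) u x = 0) \<and>
        (\<forall>x\<in>ms_region \<rho>. x $ Rc = \<rho> \<longrightarrow> u x = 0))"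


section \<open>The angular eigenvalue problem\<close>

text \<open>The equation for \<open>u\<^sub>\<theta>\<close> when \<open>m\<^sub>\<psi> = 0\<close>. The boundary condition is that
  \<open>exp (i m\<^sub>\<phi> \<phi>) u\<^sub>\<theta>(\<theta>)\<close> is smooth on \<open>S\<^sup>3\<close>.\<close>

definition S3_regular :: "int \<Rightarrow> (real \<Rightarrow> real) \<Rightarrow> bool" where
  "S3_regular m\<phi> u\<theta> \<longleftrightarrow>
     (\<exists>S U. open S \<and> smooth_on S U \<and>
        (\<forall>\<theta>\<in>{0..pi/2}. \<forall>\<phi> \<psi>.
           (complex_of_real (sin \<theta>) * cis \<phi>, complex_of_real (cos \<theta>) * cis \<psi>) \<in> S \<and>
           cis (of_int m\<phi> * \<phi>) * complex_of_real (u\<theta> \<theta>) =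
             (U (complex_of_real (sin \<theta>) * cis \<phi>, complex_of_real (cos \<theta>) * cis \<psi>) :: complex)))"

definition angular_eigenfunction ::
  "real \<Rightarrow> real \<Rightarrow> real \<Rightarrow> real \<Rightarrow> real \<Rightarrow> int \<Rightarrow> real \<Rightarrow> (real \<Rightarrow> real) \<Rightarrow> bool" where
  "angular_eigenfunction Q1 Q2 Rz \<omega> lam m\<phi> E u\<theta> \<longleftrightarrow>
     S3_regular m\<phi> u\<theta> \<and>
     (\<exists>\<theta>\<in>{0..pi/2}. u\<theta> \<theta> \<noteq> 0) \<and>
     (\<forall>\<theta>\<in>{0<..<pi/2}.
        - (1 / sin (2 * \<theta>)) * deriv (\<lambda>s. sin (2 * s) * deriv u\<theta> s) \<theta>
        + ((of_int m\<phi>)\<^sup>2 / (sin \<theta>)\<^sup>2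
           + ((lam * Rz)\<^sup>2 - (\<omega> * Rz)\<^sup>2) * ((ms_a Q1 Q2 Rz)\<^sup>2 / Rz\<^sup>2) * (cos \<theta>)\<^sup>2) * u\<theta> \<theta>
        = E * u\<theta> \<theta>)"

definition angular_eigenvalues ::
  "real \<Rightarrow> real \<Rightarrow> real \<Rightarrow> real \<Rightarrow> real \<Rightarrow> int \<Rightarrow> real set" where
  "angular_eigenvalues Q1 Q2 Rz \<omega> lam m\<phi> =
     {E. \<exists>u\<theta>. angular_eigenfunction Q1 Q2 Rz \<omega> lam m\<phi> E u\<theta>}"

text \<open>Without the \<open>cos\<^sup>2 \<theta>\<close> term the eigenvalues are \<open>l (l + 2)\<close> with \<open>l = \<bar>m\<^sub>\<phi>\<bar>, \<bar>m\<^sub>\<phi>\<bar> + 2, \<bar>m\<^sub>\<phi>\<bar> + 4, \<dots>\<close>, each of them simple.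
  In general, the eigenvalue with exactly \<open>n\<close> eigenvalues below it gets the label \<open>l = \<bar>m\<^sub>\<phi>\<bar> + 2 n\<close>; thus
  for \<open>m\<^sub>\<phi> = - l\<close> (eigenfunction \<open>sin\<^sup>l \<theta>\<close> without the \<open>cos\<^sup>2 \<theta>\<close> term) the \<open>l\<close>-th eigenvalue is the lowest one.\<close>

definition labelled_eigenvalue ::
  "real \<Rightarrow> real \<Rightarrow> real \<Rightarrow> real \<Rightarrow> real \<Rightarrow> int \<Rightarrow> nat \<Rightarrow> real \<Rightarrow> bool" where
  "labelled_eigenvalue Q1 Q2 Rz \<omega> lam m\<phi> l E \<longleftrightarrow>
     E \<in> angular_eigenvalues Q1 Q2 Rz \<omega> lam m\<phi> \<and>
     finite {E' \<in> angular_eigenvalues Q1 Q2 Rz \<omega> lam m\<phi>. E' < E} \<and>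
     l = nat \<bar>m\<phi>\<bar> + 2 * card {E' \<in> angular_eigenvalues Q1 Q2 Rz \<omega> lam m\<phi>. E' < E}"

end

theory Submission
  imports Defs
begin

text \<open>
  The modes have \<open>\<lambda> = 0\<close>, \<open>m\<^sub>\<psi> = 0\<close>, \<open>m\<^sub>\<phi> = - l\<close>, and \<open>\<omega>\<close> is found in \<open>[0, 2 / (R R\<^sub>z)]\<close> by shooting.

  With \<open>c = \<omega>\<^sup>2 a\<^sup>2\<close>, the angular equation for \<open>u\<^sub>\<theta> = sin\<^sup>l \<theta> p (cos\<^sup>2 \<theta>)\<close> becomes a three-term recursion for
  the Taylor coefficients of \<open>p\<close>. For \<open>l\<close> large compared with \<open>c\<close> its minimal solution is a fixed point of a
  contraction, which depends continuously on \<open>c\<close>; it has nonnegative coefficients, so \<open>u\<^sub>\<theta>\<close> is positive and hence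
  belongs to the lowest eigenvalue \<open>\<mu>\<^sup>2 = l (l + 2) + O(1)\<close>.

  In the variable \<open>x = r\<^sup>2 / (r\<^sup>2 + a\<^sup>2) \<in> [0, 1)\<close> the radial equation is \<open>(x w')' = - g w\<close> with
  \<open>4 g = \<omega>\<^sup>2 a\<^sup>2 x / (1 - x)\<^sup>3 + (\<omega>\<^sup>2 (Q\<^sub>1 + Q\<^sub>2) - \<mu>\<^sup>2) / (1 - x)\<^sup>2 + (\<omega> R\<^sub>z + l)\<^sup>2 / (1 - x)\<close>, and its regular solution is a
  power series that converges on the whole range. For \<open>\<omega> = 0\<close> that solution is positive; for \<open>\<omega> = 2 / (R R\<^sub>z)\<close> it
  oscillates before the boundary \<open>r = R R\<^sub>z \<mu>\<close>. As \<open>\<omega>\<close> increases, the first zero appears at the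
  boundary, since an interior one would be a double zero.
\<close>


section \<open>Smooth functions\<close>

text \<open>The frequency, the eigenvalue and the position of the boundary are coupled: \<mu>
  depends on \<omega>, and the Dirichlet condition sits at a radius proportional to \<mu>. An
  eigenvalue for each single \<omega> is therefore not enough for shooting; \<mu> must vary
  continuously with \<omega>, which is why it is built from a contraction with explicit Lipschitz
  dependence on c. The variable x sends the singular points r^2 = 0, r^2 = -a^2 and infinity to 0,
  infinity and 1, so nothing obstructs the series at x = 0 before x = 1; a series in r^2 would only
  be guaranteed up to r = a. The frequency bound is uniform in l because the boundary moves out with
  \<mu>: at \<omega> = 2 / (R \<open>Rz\<close>) and r = R \<open>Rz\<close> \<mu> one has
  \<omega>^2 r^2 = 4 \<mu>^2, which beats the barrier \<mu>^2 for every l, and large l leaves room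
  for a full half-wave near the boundary.\<close>

lemma Ck_on_cong:
  assumes "open S" "\<And>x. x \<in> S \<Longrightarrow> F x = G x" "Ck_on k S F"
  shows "Ck_on k S G"
  using assms(2,3)
proof (induction k arbitrary: F G)
  case 0
  then show ?case using continuous_on_cong[of S S F G] by auto
next
  case (Suc k)
  have der: "(F has_derivative frechet_derivative F (at x)) (at x)" if "x \<in> S" for x
    using Suc.prems(2) that \<open>open S\<close>
    by (auto simp: differentiable_on_eq_differentiable_at frechet_derivative_works)
  have derG: "(G has_derivative frechet_derivative F (at x)) (at x)" if "x \<in> S" for x
    using has_derivative_transform_within_open[OF der[OF that] \<open>open S\<close> that] Suc.prems(1) by blast
  have "G differentiable_on S"
    using derG \<open>open S\<close> by (auto simp: differentiable_on_eq_differentiable_at differentiable_def)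
  moreover have "Ck_on k S (\<lambda>x. frechet_derivative G (at x) v)" for v
  proof (rule Suc.IH)
    show "Ck_on k S (\<lambda>x. frechet_derivative F (at x) v)" using Suc.prems(2) by simp
    show "frechet_derivative F (at x) v = frechet_derivative G (at x) v" if "x \<in> S" for x
      using frechet_derivative_at[OF derG[OF that]] by simp
  qed
  ultimately show ?case by simp
qed

text \<open>\<open>Ck_on\<close> speaks of the chosen \<open>frechet_derivative\<close>. This rule
  lets a derivative given by a formula take its place, so that closure properties follow by
  induction on k.\<close>

lemma Ck_on_SucI:
  assumes "open S" "\<And>x. x \<in> S \<Longrightarrow> (F has_derivative F' x) (at x)"
    and "\<And>v. Ck_on k S (\<lambda>x. F' x v)"
  shows "Ck_on (Suc k) S F"
proof -
  have "F differentiable_on S"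
    using assms(1,2) by (auto simp: differentiable_on_eq_differentiable_at differentiable_def)
  moreover have "Ck_on k S (\<lambda>x. frechet_derivative F (at x) v)" for v
    by (rule Ck_on_cong[OF assms(1) _ assms(3)[of v]]) (simp add: frechet_derivative_at[OF assms(2), symmetric])
  ultimately show ?thesis by simp
qed

lemma Ck_on_SucD:
  assumes "open S" "Ck_on (Suc k) S F"
  shows "x \<in> S \<Longrightarrow> (F has_derivative frechet_derivative F (at x)) (at x)"
    and "Ck_on k S (\<lambda>x. frechet_derivative F (at x) v)"
  using assms by (auto simp: differentiable_on_eq_differentiable_at frechet_derivative_works)

lemma Ck_on_imp_continuous_on: "Ck_on k S F \<Longrightarrow> continuous_on S F"
  by (cases k) (auto intro: differentiable_imp_continuous_on)

lemma Ck_on_Suc_imp: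
  assumes "open S" "Ck_on (Suc k) S F"
  shows "Ck_on k S F"
  using assms(2)
proof (induction k arbitrary: F)
  case 0
  then show ?case using Ck_on_imp_continuous_on[of "Suc 0" S F] by simp
next
  case (Suc k)
  show ?case
    by (rule Ck_on_SucI[OF assms(1) Ck_on_SucD(1)[OF assms(1) Suc.prems]])
      (auto intro: Suc.IH[OF Ck_on_SucD(2)[OF assms(1) Suc.prems]])
qed

section \<open>Closure properties of the smoothness classes\<close>

lemma Ck_on_const: "Ck_on k S (\<lambda>x. c)"
proof (induction k arbitrary: c)
  case (Suc k)
  show ?case
    unfolding Ck_on.simps frechet_derivative_const using Suc.IH differentiable_on_const by blast
qed simp

lemma smooth_on_const: "smooth_on S (\<lambda>x. c)"
  by (simp add: smooth_on_def Ck_on_const)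

lemma smooth_on_bounded_linear:
  assumes "open S" "bounded_linear F"
  shows "smooth_on S F"
  unfolding smooth_on_def
proof
  fix k show "Ck_on k S F"
  proof (cases k)
    case 0
    then show ?thesis using assms by (simp add: linear_continuous_on)
  next
    case (Suc n)
    show ?thesis unfolding Suc
      by (rule Ck_on_SucI[where F' = "\<lambda>x. F"]) (auto simp: assms Ck_on_const bounded_linear_imp_has_derivative)
  qed
qed

lemma Ck_on_add:
  assumes "open S" "Ck_on k S F" "Ck_on k S G"
  shows "Ck_on k S (\<lambda>x. F x + G x)"
  using assms(2,3)
proof (induction k arbitrary: F G)
  case 0
  then show ?case by (auto intro: continuous_intros)
next
  case (Suc k)
  note F = Ck_on_SucD[OF assms(1) Suc.prems(1)] and G = Ck_on_SucD[OF assms(1) Suc.prems(2)]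
  show ?case
  proof (rule Ck_on_SucI[OF assms(1)])
    show "((\<lambda>x. F x + G x) has_derivative
        (\<lambda>v. frechet_derivative F (at x) v + frechet_derivative G (at x) v)) (at x)" if "x \<in> S" for x
      by (intro has_derivative_add F(1) G(1) that)
    show "Ck_on k S (\<lambda>x. frechet_derivative F (at x) v + frechet_derivative G (at x) v)" for v
      by (rule Suc.IH[OF F(2) G(2)])
  qed
qed

lemma Ck_on_bilinear:
  assumes "open S" "bounded_bilinear bop" "Ck_on k S F" "Ck_on k S G"
  shows "Ck_on k S (\<lambda>x. bop (F x) (G x))"
  using assms(3,4)
proof (induction k arbitrary: F G)
  case 0
  then show ?case using bounded_bilinear.continuous_on[OF assms(2)] by auto
next
  case (Suc k)
  note F = Ck_on_SucD[OF assms(1) Suc.prems(1)] and G = Ck_on_SucD[OF assms(1) Suc.prems(2)]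
  show ?case
  proof (rule Ck_on_SucI[OF assms(1)])
    show "((\<lambda>x. bop (F x) (G x)) has_derivative
        (\<lambda>v. bop (F x) (frechet_derivative G (at x) v) + bop (frechet_derivative F (at x) v) (G x))) (at x)"
      if "x \<in> S" for x
      by (intro bounded_bilinear.FDERIV[OF assms(2)] F(1) G(1) that)
    show "Ck_on k S (\<lambda>x. bop (F x) (frechet_derivative G (at x) v) + bop (frechet_derivative F (at x) v) (G x))" for v
      by (intro Ck_on_add[OF assms(1)] Suc.IH[OF _ G(2)] Suc.IH[OF F(2)]
          Ck_on_Suc_imp[OF assms(1) Suc.prems(1)] Ck_on_Suc_imp[OF assms(1) Suc.prems(2)])
  qed
qed

lemma smooth_on_bilinear:
  "\<lbrakk>open S; bounded_bilinear bop; smooth_on S F; smooth_on S G\<rbrakk> \<Longrightarrow> smooth_on S (\<lambda>x. bop (F x) (G x))"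
  by (simp add: smooth_on_def Ck_on_bilinear)

lemma smooth_on_add:
  "\<lbrakk>open S; smooth_on S F; smooth_on S G\<rbrakk> \<Longrightarrow> smooth_on S (\<lambda>x. F x + G x)"
  by (simp add: smooth_on_def Ck_on_add)

lemma smooth_on_mult:
  fixes F G :: "_ \<Rightarrow> 'b::real_normed_algebra"
  shows "\<lbrakk>open S; smooth_on S F; smooth_on S G\<rbrakk> \<Longrightarrow> smooth_on S (\<lambda>x. F x * G x)"
  by (rule smooth_on_bilinear[OF _ bounded_bilinear_mult])

lemma smooth_on_power:
  fixes F :: "_ \<Rightarrow> 'b::real_normed_algebra_1"
  shows "\<lbrakk>open S; smooth_on S F\<rbrakk> \<Longrightarrow> smooth_on S (\<lambda>x. F x ^ n)"
  by (induction n) (auto intro: smooth_on_const smooth_on_mult)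

text \<open>A whole tower of derivatives \<open>g n\<close> makes the induction close: the chain
  rule for \<open>g n\<close> produces \<open>g (Suc n)\<close>, so order k + 1 at n needs only
  order k at n + 1 and the product rule.\<close>

lemma smooth_on_compose:
  fixes q :: "'a::real_normed_vector \<Rightarrow> real" and g :: "nat \<Rightarrow> real \<Rightarrow> 'b::real_normed_vector"
  assumes "open S" "smooth_on S q" "q ` S \<subseteq> T"
    and g: "\<And>n t. t \<in> T \<Longrightarrow> (g n has_vector_derivative g (Suc n) t) (at t)"
  shows "smooth_on S (\<lambda>x. g 0 (q x))"
proof -
  have "Ck_on k S (\<lambda>x. g n (q x))" for k n
  proof (induction k arbitrary: n)
    case 0
    have "continuous_on T (g n)"
      using has_vector_derivative_continuous[OF g] by (auto intro: continuous_at_imp_continuous_on)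
    moreover have "continuous_on S q"
      using assms(2) Ck_on.simps(1) unfolding smooth_on_def by blast
    ultimately show ?case
      unfolding Ck_on.simps using assms(3) by (rule continuous_on_compose2)
  next
    case (Suc k)
    have q: "Ck_on (Suc k) S q" using assms(2) by (simp add: smooth_on_def)
    show ?case
    proof (rule Ck_on_SucI[where F' = "\<lambda>x v. frechet_derivative q (at x) v *\<^sub>R g (Suc n) (q x)"])
      show "((\<lambda>x. g n (q x)) has_derivative (\<lambda>v. frechet_derivative q (at x) v *\<^sub>R g (Suc n) (q x))) (at x)"
        if "x \<in> S" for x
        using has_derivative_compose[OF Ck_on_SucD(1)[OF assms(1) q that], of "g n" "\<lambda>v. v *\<^sub>R g (Suc n) (q x)"]
          g[of "q x" n] that assms(3) by (auto simp: has_vector_derivative_def)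
      show "Ck_on k S (\<lambda>x. frechet_derivative q (at x) v *\<^sub>R g (Suc n) (q x))" for v
        by (intro Ck_on_bilinear[OF assms(1) bounded_bilinear_scaleR] Suc.IH Ck_on_SucD[OF assms(1) q])
    qed (rule assms(1))
  qed
  then show ?thesis by (simp add: smooth_on_def)
qed

lemma smooth_on_real_compose:
  fixes q :: "'a::real_normed_vector \<Rightarrow> real" and g :: "nat \<Rightarrow> real \<Rightarrow> real"
  assumes "open S" "smooth_on S q" "q ` S \<subseteq> T"
    and g: "\<And>n t. t \<in> T \<Longrightarrow> (g n has_real_derivative g (Suc n) t) (at t)"
  shows "smooth_on S (\<lambda>x. g 0 (q x))"
  using assms(1-3) by (rule smooth_on_compose) (use g in \<open>auto simp: has_real_derivative_iff_has_vector_derivative\<close>)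

lemma smooth_on_cis:
  assumes "open S" "smooth_on S q"
  shows "smooth_on S (\<lambda>x. cis (q x))"
proof -
  have "smooth_on S (\<lambda>x. (\<i> ^ 0) * cis (q x))"
  proof (rule smooth_on_compose[OF assms, where T = UNIV and g = "\<lambda>n t. \<i> ^ n * cis t"])
    show "((\<lambda>t. \<i> ^ n * cis t) has_vector_derivative \<i> ^ Suc n * cis t) (at t)" for n t
      unfolding cis_conv_exp
      by (rule has_vector_derivative_real_field) (auto intro!: derivative_eq_intros)
  qed simp
  then show ?thesis by simp
qed

lemma smooth_on_of_real: "open S \<Longrightarrow> smooth_on S q \<Longrightarrow> smooth_on S (\<lambda>x. complex_of_real (q x))"
  using smooth_on_bilinear[OF _ bounded_bilinear_scaleR _ smooth_on_const[of S "1::complex"], of q]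
  by (simp add: scaleR_conv_of_real)

lemma smooth_on_cmod_power2:
  assumes "open S" "bounded_linear F"
  shows "smooth_on S (\<lambda>x. (cmod (F x))\<^sup>2)"
proof -
  note F = smooth_on_bounded_linear[OF assms(1) bounded_linear_compose[OF _ assms(2)]]
  have "smooth_on S (\<lambda>x. (Re (F x))\<^sup>2 + (Im (F x))\<^sup>2)"
    by (intro smooth_on_add smooth_on_power assms(1) F bounded_linear_Re bounded_linear_Im)
  then show ?thesis by (simp add: cmod_power2)
qed

lemma smooth_on_inverse_real:
  fixes q :: "'a::real_normed_vector \<Rightarrow> real"
  assumes "open S" "smooth_on S q" "\<And>x. x \<in> S \<Longrightarrow> q x > 0"
  shows "smooth_on S (\<lambda>x. inverse (q x))"
proof -
  have "smooth_on S (\<lambda>x. (-1)^0 * fact 0 * inverse (q x) ^ Suc 0)"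
  proof (rule smooth_on_real_compose[OF assms(1,2), where T = "{0<..}" and g = "\<lambda>n t. (-1)^n * fact n * inverse t ^ Suc n"])
    show "((\<lambda>t. (-1) ^ n * fact n * inverse t ^ Suc n) has_real_derivative (- 1) ^ Suc n * fact (Suc n) * inverse t ^ Suc (Suc n)) (at t)"
      if "t \<in> {0<..}" for n t
      using that by (intro DERIV_cong[OF DERIV_cmult[OF DERIV_power[OF DERIV_inverse]]])
        (auto simp: power2_eq_square algebra_simps)
  qed (use assms(3) in auto)
  then show ?thesis by simp
qed

lemma has_vector_derivative_along:
  assumes "open S" "Ck_on (Suc k) S U" "\<gamma> s \<in> S" "(\<gamma> has_vector_derivative v) (at s)"
  shows "((\<lambda>s. U (\<gamma> s)) has_vector_derivative frechet_derivative U (at (\<gamma> s)) v) (at s)"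
proof -
  have D: "(U has_derivative frechet_derivative U (at (\<gamma> s))) (at (\<gamma> s))"
    by (rule Ck_on_SucD(1)[OF assms(1-3)])
  interpret bounded_linear "frechet_derivative U (at (\<gamma> s))"
    using D by (rule has_derivative_bounded_linear)
  show ?thesis
    using has_derivative_compose[OF assms(4)[unfolded has_vector_derivative_def] D]
    by (simp add: has_vector_derivative_def scaleR)
qed

section \<open>Power series solutions at a regular singular point\<close>

text \<open>Frobenius coefficients of the regular solution of (x w')' = g w with w(0) = 1. The
  indicial root 0 is double, hence the factor (k + 1)^2 on comparing coefficients of x^k.\<close>

fun frob :: "(nat \<Rightarrow> real) \<Rightarrow> nat \<Rightarrow> real" where
  "frob g 0 = 1"
| "frob g (Suc k) = (\<Sum>i\<le>k. g (k - i) * frob g i) / (real (Suc k))\<^sup>2"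

declare frob.simps(2) [simp del]

text \<open>Method of majorants: the recursion only adds and multiplies with positive weights, so a
  termwise majorant of g yields one of the solution. It supplies bounds that are uniform in the
  frequency.\<close>

lemma frob_mono:
  assumes "\<And>j. \<bar>g j\<bar> \<le> h j"
  shows "\<bar>frob g k\<bar> \<le> frob h k"
proof (induction k rule: less_induct)
  case (less k)
  show ?case
  proof (cases k)
    case (Suc m)
    have "\<bar>\<Sum>i\<le>m. g (m - i) * frob g i\<bar> \<le> (\<Sum>i\<le>m. \<bar>g (m - i) * frob g i\<bar>)"
      by (rule sum_abs)
    also have "\<dots> \<le> (\<Sum>i\<le>m. h (m - i) * frob h i)"
      unfolding abs_mult using less Suc by (intro sum_mono mult_mono assms) (auto intro: order_trans[OF abs_ge_zero assms])
    finally show ?thesis by (simp add: Suc frob.simps(2) divide_right_mono)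
  qed simp
qed

lemma frob_nonneg: "(\<And>j. g j \<ge> 0) \<Longrightarrow> frob g k \<ge> 0"
  using order_trans[OF abs_ge_zero frob_mono[of g g k]] by simp

lemma continuous_on_frob:
  assumes "\<And>j. continuous_on A (\<lambda>p. g p j)"
  shows "continuous_on A (\<lambda>p. frob (g p) k)"
proof (induction k rule: less_induct)
  case (less k)
  show ?case
  proof (cases k)
    case (Suc m)
    then show ?thesis by (auto simp: frob.simps(2) intro!: continuous_intros assms less)
  qed auto
qed

lemma fps_frob:
  "fps_deriv (fps_X * fps_deriv (Abs_fps (frob g))) = Abs_fps g * Abs_fps (frob g)"
proof (rule fps_ext)
  fix n
  have "fps_nth (fps_deriv (fps_X * fps_deriv (Abs_fps (frob g)))) n = (real (Suc n))\<^sup>2 * frob g (Suc n)"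
    by (cases n) (simp_all add: power2_eq_square algebra_simps)
  also have "\<dots> = (\<Sum>i\<le>n. g (n - i) * frob g i)"
    by (simp add: frob.simps(2))
  also have "\<dots> = (\<Sum>i=0..n. g i * frob g (n - i))"
    using sum.atLeastAtMost_rev[of "\<lambda>i. g i * frob g (n - i)" 0 n] by (simp add: atMost_atLeast0)
  finally show "fps_nth (fps_deriv (fps_X * fps_deriv (Abs_fps (frob g)))) n = fps_nth (Abs_fps g * Abs_fps (frob g)) n"
    by (simp add: fps_mult_nth)
qed

text \<open>The factor \<open>(k + 1)\<^sup>2\<close> gained at each step of the recursion beats the number of terms, so
  \<open>frob g\<close> converges wherever \<open>g\<close> is geometrically bounded.\<close>
lemma frob_geometric_bound:
  assumes r: "0 < r" and g: "\<And>j. 0 \<le> g j \<and> g j * r ^ j \<le> C"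
  shows "\<exists>D. \<forall>k. frob g k * r ^ k \<le> D"
proof -
  \<comment> \<open>Beyond N each step multiplies the bound by at most C r / (m + 1) \<le> 1, so the
    maximum over k \<le> N bounds every term.\<close>
  obtain N :: nat where N: "C * r \<le> real N" using real_arch_simple by blast
  have "C \<ge> 0" using g[of 0] by (auto intro: order_trans)
  define D where "D = Max ((\<lambda>k. frob g k * r ^ k) ` {..N})"
  have D: "frob g k * r ^ k \<le> D" if "k \<le> N" for k
    unfolding D_def using that by (intro Max_ge) auto
  have "D \<ge> 0" using D[of 0] by simp
  have "frob g k * r ^ k \<le> D" for k
  proof (induction k rule: less_induct)
    case (less k)
    show ?case
    proof (cases "k \<le> N")
      case False
      then obtain m where m: "k = Suc m" "N \<le> m" by (cases k) auto
      have "frob g k * r ^ k = (\<Sum>i\<le>m. (g (m - i) * r ^ (m - i)) * (frob g i * r ^ i)) * r / (real (Suc m))\<^sup>2"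
      proof -
        have "(g (m - i) * frob g i) * r ^ m = (g (m - i) * r ^ (m - i)) * (frob g i * r ^ i)" if "i \<le> m" for i
        proof -
          have "r ^ m = r ^ (m - i) * r ^ i" using that by (simp flip: power_add)
          then show ?thesis by (simp only: mult_ac)
        qed
        then have sum: "(\<Sum>i\<le>m. g (m - i) * frob g i) * r ^ m = (\<Sum>i\<le>m. (g (m - i) * r ^ (m - i)) * (frob g i * r ^ i))"
          unfolding sum_distrib_right by (intro sum.cong) auto
        show ?thesis
          unfolding m frob.simps(2) power_Suc sum[symmetric] by simp
      qed
      also have "\<dots> \<le> (\<Sum>i\<le>m. C * D) * r / (real (Suc m))\<^sup>2"
        using less m r g \<open>C \<ge> 0\<close> frob_nonneg[of g]
        by (intro divide_right_mono mult_right_mono sum_mono mult_mono) auto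
      also have "\<dots> = (C * r) * D / real (Suc m)"
        by (simp add: power2_eq_square)
      also have "\<dots> \<le> real (Suc m) * D / real (Suc m)"
        using N m \<open>D \<ge> 0\<close> by (intro divide_right_mono mult_right_mono) auto
      finally show ?thesis by simp
    qed (rule D)
  qed
  then show ?thesis by blast
qed

lemma poly_times_geometric_bounded:
  fixes r :: real
  assumes "0 < r" "r < 1"
  shows "\<exists>C. \<forall>j. (real (Suc j))\<^sup>2 * r ^ j \<le> C"
proof -
  \<comment> \<open>With r = q^2 it suffices to bound (j + 1) q^j, and this is at most the geometric
    sum 1 + q + ... + q^j because the powers decrease.\<close>
  define q where "q = sqrt r"
  have q: "0 < q" "q < 1" "q\<^sup>2 = r" using assms by (auto simp: q_def)
  have "(real (Suc j))\<^sup>2 * r ^ j \<le> (1 / (1 - q))\<^sup>2" for j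
  proof -
    have "real (Suc j) * q ^ j = (\<Sum>i<Suc j. q ^ j)" by simp
    also have "\<dots> \<le> (\<Sum>i<Suc j. q ^ i)"
      using q by (intro sum_mono power_decreasing) auto
    also have "\<dots> \<le> (\<Sum>i. q ^ i)"
      using q by (intro sum_le_suminf summable_geometric) auto
    also have "\<dots> = 1 / (1 - q)"
      using q by (intro suminf_geometric) auto
    finally have "(real (Suc j) * q ^ j)\<^sup>2 \<le> (1 / (1 - q))\<^sup>2"
      using q by (intro power_mono) auto
    then show ?thesis
      by (simp add: power_mult_distrib q(3)[symmetric] flip: power_mult) (simp add: mult.commute)
  qed
  then show ?thesis by blast
qed

text \<open>Coefficients of size (j + 1)^2 are those of a triple pole at x = 1, the worst
  singularity of the radial potential. The geometric bound at an intermediate radius r leaves a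
  convergent series in s / r.\<close>

lemma summable_frob_quadratic:
  fixes s :: real
  assumes s: "0 \<le> s" "s < 1" and G: "G \<ge> 0"
  shows "summable (\<lambda>k. frob (\<lambda>j. G * (real (Suc j))\<^sup>2) k * s ^ k)"
proof -
  obtain r where r: "s < r" "r < 1" using s dense by blast
  obtain C where C: "\<And>j. (real (Suc j))\<^sup>2 * r ^ j \<le> C"
    using poly_times_geometric_bounded[of r] r s by auto
  obtain D where D: "\<And>k. frob (\<lambda>j. G * (real (Suc j))\<^sup>2) k * r ^ k \<le> D"
    using frob_geometric_bound[of r "\<lambda>j. G * (real (Suc j))\<^sup>2" "G * C"] r s G
      mult_left_mono[OF C G] by (auto simp: mult.assoc)
  show ?thesis
  proof (rule summable_comparison_test[OF exI])
    show "summable (\<lambda>k. D * (s / r) ^ k)"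
      using r s by (intro summable_mult summable_geometric) auto
    show "\<forall>k\<ge>0. norm (frob (\<lambda>j. G * (real (Suc j))\<^sup>2) k * s ^ k) \<le> D * (s / r) ^ k"
    proof (intro allI impI)
      fix k
      have "frob (\<lambda>j. G * (real (Suc j))\<^sup>2) k * s ^ k = (frob (\<lambda>j. G * (real (Suc j))\<^sup>2) k * r ^ k) * (s / r) ^ k"
        using r s by (simp add: power_divide)
      also have "\<dots> \<le> D * (s / r) ^ k"
        using r s D by (intro mult_right_mono) auto
      finally show "norm (frob (\<lambda>j. G * (real (Suc j))\<^sup>2) k * s ^ k) \<le> D * (s / r) ^ k"
        using frob_nonneg[of "\<lambda>j. G * (real (Suc j))\<^sup>2" k] G s by simp
    qed
  qed
qed

lemma frob_conv_radius:
  assumes G: "\<And>j. \<bar>g j\<bar> \<le> G * (real (Suc j))\<^sup>2"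
  shows "fps_conv_radius (Abs_fps (frob g)) \<ge> 1" "fps_conv_radius (Abs_fps g) \<ge> 1"
proof -
  have "G \<ge> 0" using G[of 0] by simp
  \<comment> \<open>The disjunction lets one comparison argument serve both \<open>frob g\<close>
    and g itself.\<close>
  have *: "conv_radius f \<ge> 1" if f: "\<And>k. \<bar>f k\<bar> \<le> frob (\<lambda>j. G * (real (Suc j))\<^sup>2) k \<or> \<bar>f k\<bar> \<le> G * (real (Suc k))\<^sup>2"
    for f :: "nat \<Rightarrow> real"
  proof (rule conv_radius_geI_ex')
    fix s :: real assume "0 < s" "ereal s < 1"
    then have s: "0 \<le> s" "s < 1" by (auto simp: one_ereal_def)
    obtain r where r: "s < r" "r < 1" using s dense by blast
    obtain C where C: "\<And>j. (real (Suc j))\<^sup>2 * r ^ j \<le> C"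
      using poly_times_geometric_bounded[of r] r s by auto
    have "summable (\<lambda>k. frob (\<lambda>j. G * (real (Suc j))\<^sup>2) k * s ^ k + G * C * (s / r) ^ k)"
      using r s by (intro summable_add summable_frob_quadratic s \<open>G \<ge> 0\<close> summable_mult summable_geometric) auto
    then show "summable (\<lambda>k. f k * of_real s ^ k)"
    proof (rule summable_comparison_test'[where N = 0])
      fix k
      have "G * (real (Suc k))\<^sup>2 * s ^ k = G * ((real (Suc k))\<^sup>2 * r ^ k) * (s / r) ^ k"
        using r s by (simp add: power_divide)
      also have "\<dots> \<le> G * C * (s / r) ^ k"
        using r s C \<open>G \<ge> 0\<close> by (intro mult_right_mono mult_left_mono) auto
      finally have 1: "G * (real (Suc k))\<^sup>2 * s ^ k \<le> G * C * (s / r) ^ k" .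
      have 2: "0 \<le> G * (real (Suc k))\<^sup>2 * s ^ k" using \<open>G \<ge> 0\<close> s by simp
      have 3: "0 \<le> frob (\<lambda>j. G * (real (Suc j))\<^sup>2) k * s ^ k"
        using \<open>G \<ge> 0\<close> s frob_nonneg[of "\<lambda>j. G * (real (Suc j))\<^sup>2"] by simp
      have "\<bar>f k\<bar> * s ^ k \<le> frob (\<lambda>j. G * (real (Suc j))\<^sup>2) k * s ^ k \<or> \<bar>f k\<bar> * s ^ k \<le> G * (real (Suc k))\<^sup>2 * s ^ k"
        using f[of k] s by (auto intro!: mult_right_mono)
      then show "norm (f k * of_real s ^ k) \<le> frob (\<lambda>j. G * (real (Suc j))\<^sup>2) k * s ^ k + G * C * (s / r) ^ k"
        using 1 2 3 s by (auto simp: abs_mult)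
    qed
  qed
  show "fps_conv_radius (Abs_fps (frob g)) \<ge> 1" "fps_conv_radius (Abs_fps g) \<ge> 1"
    unfolding fps_conv_radius_def using frob_mono[of g, OF G] G by (auto intro!: *)
qed

lemma eval_fps_frob_ode:
  assumes G: "\<And>j. \<bar>g j\<bar> \<le> G * (real (Suc j))\<^sup>2" and x: "\<bar>x\<bar> < 1"
  shows "((\<lambda>x. x * eval_fps (fps_deriv (Abs_fps (frob g))) x) has_real_derivative
    eval_fps (Abs_fps g) x * eval_fps (Abs_fps (frob g)) x) (at x)"
proof -
  let ?W = "Abs_fps (frob g)"
  have le: "ereal (norm x) < fps_conv_radius F" if "fps_conv_radius F \<ge> 1" for F :: "real fps"
    using that x by (intro less_le_trans[OF _ that]) simp
  note W = frob_conv_radius[OF G]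
  have W': "fps_conv_radius (fps_deriv ?W) \<ge> 1"
    using W(1) fps_conv_radius_deriv order_trans by blast
  have XW: "fps_conv_radius (fps_X * fps_deriv ?W) \<ge> 1"
    using fps_conv_radius_mult[of fps_X "fps_deriv ?W"] W' by (auto intro: order_trans)
  have "(eval_fps (fps_X * fps_deriv ?W) has_real_derivative
     eval_fps (fps_deriv (fps_X * fps_deriv ?W)) x) (at x)"
    by (rule has_field_derivative_eval_fps[OF le[OF XW]])
  then have der: "(eval_fps (fps_X * fps_deriv ?W) has_real_derivative eval_fps (Abs_fps g) x * eval_fps ?W x) (at x)"
    unfolding fps_frob by (subst (asm) eval_fps_mult) (use le W in auto)
  have ev: "eventually (\<lambda>x. eval_fps (fps_X * fps_deriv ?W) x = x * eval_fps (fps_deriv ?W) x) (nhds x)"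
  proof -
    have "eventually (\<lambda>y. y \<in> {-1<..<1}) (nhds x)"
      using x by (intro eventually_nhds_in_open) auto
    then show ?thesis
    proof (rule eventually_mono)
      fix y :: real assume y: "y \<in> {-1<..<1}"
      then have "ereal (norm y) < fps_conv_radius (fps_deriv ?W)"
        using y by (intro less_le_trans[OF _ W']) auto
      then show "eval_fps (fps_X * fps_deriv ?W) y = y * eval_fps (fps_deriv ?W) y"
        by (subst eval_fps_mult) auto
    qed
  qed
  show ?thesis
    using der DERIV_cong_ev[OF refl ev refl] by blast
qed

section \<open>Taylor coefficients of the lowest angular eigenfunction\<close>

text \<open>Banach's theorem for the sup distance on sequences with entries in [0, 2], by iteration
  from 0. The distance appears only through a common bound d on all entries.\<close>

lemma contraction_box_fixpoint:
  fixes T :: "(nat \<Rightarrow> real) \<Rightarrow> nat \<Rightarrow> real"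
  assumes box: "\<And>x k. (\<And>j. x j \<in> {0..2}) \<Longrightarrow> T x k \<in> {0..2}"
    and contr: "\<And>x y d k. \<lbrakk>\<And>j. x j \<in> {0..2}; \<And>j. y j \<in> {0..2}; \<And>j. \<bar>x j - y j\<bar> \<le> d\<rbrakk> \<Longrightarrow> \<bar>T x k - T y k\<bar> \<le> d / 2"
  shows "\<exists>x. (\<forall>k. x k \<in> {0..2}) \<and> T x = x"
proof -
  define X where "X n = (T ^^ n) (\<lambda>_. 0)" for n
  have X: "X n k \<in> {0..2}" for n k
    by (induction n arbitrary: k) (use box in \<open>auto simp: X_def\<close>)
  have step: "\<bar>X (Suc n) k - X n k\<bar> \<le> 2 * (1/2) ^ n" for n k
  proof (induction n arbitrary: k)
    case 0
    then show ?case using X[of 0 k] X[of 1 k] by auto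
  next
    case (Suc n)
    have "\<bar>T (X (Suc n)) k - T (X n) k\<bar> \<le> (2 * (1/2) ^ n) / 2"
      by (rule contr[OF X X Suc])
    then show ?case by (simp add: X_def)
  qed
  have far: "\<bar>X (n + m) k - X n k\<bar> \<le> 4 * (1/2) ^ n" for n m k
  proof -
    have "\<bar>X (n + m) k - X n k\<bar> \<le> 4 * (1/2) ^ n - 4 * (1/2) ^ (n + m)"
    proof (induction m)
      case (Suc m)
      then show ?case using step[of "n + m" k] by simp
    qed simp
    then show ?thesis by (smt (verit) zero_le_power divide_nonneg_nonneg)
  qed
  have cauchy: "Cauchy (\<lambda>n. X n k)" for k
  proof (rule metric_CauchyI)
    fix e :: real assume "e > 0"
    obtain M where "(1/2::real) ^ M < e / 8"
      using real_arch_pow_inv[of "e / 8" "1/2"] \<open>e > 0\<close> by auto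
    then have M: "8 * (1/2::real) ^ M < e" by simp
    have "dist (X m k) (X n k) < e" if "m \<ge> M" "n \<ge> M" for m n
      using far[of M "m - M" k] far[of M "n - M" k] that M by (auto simp: dist_real_def)
    then show "\<exists>M. \<forall>m\<ge>M. \<forall>n\<ge>M. dist (X m k) (X n k) < e" by blast
  qed
  define x where "x k = lim (\<lambda>n. X n k)" for k
  have x: "(\<lambda>n. X n k) \<longlonglongrightarrow> x k" for k
    using Cauchy_convergent[OF cauchy[of k]] by (simp add: x_def convergent_LIMSEQ_iff)
  have xbox: "x k \<in> {0..2}" for k
    using LIMSEQ_le_const[OF x[of k], of 0] LIMSEQ_le_const2[OF x[of k], of 2] X by auto
  have close: "\<bar>x k - X n k\<bar> \<le> 4 * (1/2) ^ n" for n k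
  proof -
    have "(\<lambda>m. \<bar>X (m + n) k - X n k\<bar>) \<longlonglongrightarrow> \<bar>x k - X n k\<bar>"
      by (intro tendsto_intros LIMSEQ_ignore_initial_segment x)
    then show ?thesis
      by (rule LIMSEQ_le_const2) (use far[of n _ k] in \<open>simp add: add.commute\<close>)
  qed
  have "T x k = x k" for k
  proof -
    have "\<bar>T x k - T (X n) k\<bar> \<le> 2 * (1/2) ^ n" for n
      using contr[where x = x and y = "X n" and d = "4 * (1/2) ^ n" and k = k, OF xbox X close] by simp
    then have "\<bar>T x k - X (Suc n) k\<bar> \<le> 2 * (1/2) ^ n" for n
      by (simp add: X_def)
    then have bound: "\<forall>\<^sub>F n in sequentially. norm (T x k - X (Suc n) k) \<le> 2 * (1/2) ^ n"
      by simp
    have "(\<lambda>n. 2 * (1/2::real) ^ n) \<longlonglongrightarrow> 2 * 0"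
      by (intro tendsto_mult tendsto_const LIMSEQ_realpow_zero) auto
    then have "(\<lambda>n. T x k - X (Suc n) k) \<longlonglongrightarrow> 0"
      using Lim_null_comparison[OF bound] by simp
    moreover have "(\<lambda>n. T x k - X (Suc n) k) \<longlonglongrightarrow> T x k - x k"
      by (intro tendsto_intros LIMSEQ_Suc x)
    ultimately show ?thesis using LIMSEQ_unique by force
  qed
  then show ?thesis using xbox by blast
qed

text \<open>The three-term recursion for the Taylor coefficients at \<open>cos\<^sup>2 \<theta> = 0\<close> of a regular angular solution
  has a minimal (superexponentially decaying) solution; \<open>ang_step\<close> is the continued fraction for its
  coefficient ratios, normalised to be close to 1. The zeroth entry enters through the
  eigenvalue.\<close>
definition ang_d :: "nat \<Rightarrow> nat \<Rightarrow> real" where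
  "ang_d l k = 4 * (real k + 1) * (real k + real l + 2)"

text \<open>Let \<open>p k\<close> be the Taylor coefficients and write
  \<open>p (Suc k) / p k = c * \<tau> k / ang_d l k\<close>. Dividing the recursion at k + 1 by
  \<open>p (Suc k)\<close> gives
  \<open>ang_d l k / \<tau> k = ang_d l k + ang_e l c \<tau> k\<close>. The first summand is minus
  the eigenvalue shift, which the recursion at k = 0 expresses through
  \<open>\<tau> 0\<close>.\<close>

definition ang_e :: "nat \<Rightarrow> real \<Rightarrow> (nat \<Rightarrow> real) \<Rightarrow> nat \<Rightarrow> real" where
  "ang_e l c \<tau> k = c * (\<tau> 0 / (real l + 2) - \<tau> (Suc k) * (real k + 2) / (real k + real l + 3))"

definition ang_step :: "nat \<Rightarrow> real \<Rightarrow> (nat \<Rightarrow> real) \<Rightarrow> nat \<Rightarrow> real" where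
  "ang_step l c \<tau> k = ang_d l k / (ang_d l k + ang_e l c \<tau> k)"

lemma ang_d_ge: "ang_d l k \<ge> 4 * real l + 8"
  unfolding ang_d_def by (simp add: algebra_simps)

lemma ang_d_ge_8: "ang_d l k \<ge> 8" and ang_d_pos: "ang_d l k > 0"
  using ang_d_ge[of l k] by simp_all

lemma ang_weight0: "0 \<le> 1 / (real l + 2)" "1 / (real l + 2) \<le> 1"
  by (simp_all add: field_simps)

lemma ang_weight: "0 \<le> (real k + 2) / (real k + real l + 3)" "(real k + 2) / (real k + real l + 3) \<le> 1"
  by (simp_all add: field_simps)

text \<open>The origin of the smallness condition 4 c \<le> l + 2: both weighted entries lie in
  [0, 2], so the perturbation is at most 2 c \<le> (l + 2) / 2, while \<open>ang_d\<close> is at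
  least 4 (l + 2).\<close>

lemma ang_e_bound:
  assumes "0 \<le> c" "4 * c \<le> real l + 2" "\<And>j. \<tau> j \<in> {0..2}"
  shows "\<bar>ang_e l c \<tau> k\<bar> \<le> ang_d l k / 8"
proof -
  have 1: "\<tau> 0 * (1 / (real l + 2)) \<le> 2 * 1" "\<tau> (Suc k) * ((real k + 2) / (real k + real l + 3)) \<le> 2 * 1"
    using assms(3)[of 0] assms(3)[of "Suc k"] ang_weight0[of l] ang_weight[of k l] by (intro mult_mono; simp)+
  have 2: "0 \<le> \<tau> 0 * (1 / (real l + 2))" "0 \<le> \<tau> (Suc k) * ((real k + 2) / (real k + real l + 3))"
    using assms(3)[of 0] assms(3)[of "Suc k"] ang_weight0[of l] ang_weight[of k l] by (intro mult_nonneg_nonneg; simp)+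
  have "\<bar>\<tau> 0 / (real l + 2) - \<tau> (Suc k) * (real k + 2) / (real k + real l + 3)\<bar> \<le> 2"
    using 1 2 by simp
  then have "\<bar>ang_e l c \<tau> k\<bar> \<le> c * 2"
    unfolding ang_e_def abs_mult using assms(1) by (intro mult_mono) auto
  then show ?thesis using ang_d_ge[of l k] assms(2) by simp
qed

lemma quotient_diff_bound:
  fixes d e e' :: real
  assumes "d > 0" "\<bar>e\<bar> \<le> d / 8" "\<bar>e'\<bar> \<le> d / 8"
  shows "\<bar>d / (d + e) - d / (d + e')\<bar> \<le> 2 * \<bar>e - e'\<bar> / d"
proof -
  have p: "d + e \<ge> 7/8 * d" "d + e' \<ge> 7/8 * d" using assms by linarith+
  then have pos: "d + e > 0" "d + e' > 0" using assms by linarith+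
  have "d\<^sup>2 \<le> 2 * ((7/8 * d) * (7/8 * d))" using assms by (simp add: power2_eq_square)
  also have "\<dots> \<le> 2 * ((d + e) * (d + e'))"
    using p assms by (intro mult_left_mono mult_mono) auto
  finally have le: "d\<^sup>2 \<le> 2 * ((d + e) * (d + e'))" .
  have "d / (d + e) - d / (d + e') = d * (e' - e) / ((d + e) * (d + e'))"
    using pos by (simp add: field_simps)
  then have "\<bar>d / (d + e) - d / (d + e')\<bar> = d\<^sup>2 * \<bar>e - e'\<bar> / (d * ((d + e) * (d + e')))"
    using pos assms by (simp add: abs_mult power2_eq_square abs_minus_commute)
  also have "\<dots> \<le> (2 * ((d + e) * (d + e'))) * \<bar>e - e'\<bar> / (d * ((d + e) * (d + e')))"
    using pos assms le by (intro divide_right_mono mult_right_mono) auto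
  also have "\<dots> = 2 * \<bar>e - e'\<bar> / d" using pos by simp
  finally show ?thesis .
qed

text \<open>One estimate with two uses: for c = c' it is the contraction property, and for two fixed
  points it gives their Lipschitz dependence on c.\<close>

lemma ang_step_diff:
  assumes c: "0 \<le> c" "4 * c \<le> real l + 2" and c': "0 \<le> c'" "4 * c' \<le> real l + 2"
    and x: "\<And>j. x j \<in> {0..2}" and y: "\<And>j. y j \<in> {0..2}" and d: "\<And>j. \<bar>x j - y j\<bar> \<le> \<delta>"
  shows "\<bar>ang_step l c x k - ang_step l c' y k\<bar> \<le> \<delta> / 2 + \<bar>c - c'\<bar>"
proof -
  let ?A = "\<lambda>x::nat\<Rightarrow>real. x 0 * (1 / (real l + 2)) - x (Suc k) * ((real k + 2) / (real k + real l + 3))"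
  have "\<delta> \<ge> 0" using d[of 0] by (auto intro: order_trans)
  have Ay: "\<bar>?A y\<bar> \<le> 2"
  proof -
    have "y 0 * (1 / (real l + 2)) \<le> 2 * 1" "y (Suc k) * ((real k + 2) / (real k + real l + 3)) \<le> 2 * 1"
      using y[of 0] y[of "Suc k"] ang_weight0[of l] ang_weight[of k l] by (intro mult_mono; simp)+
    moreover have "0 \<le> y 0 * (1 / (real l + 2))" "0 \<le> y (Suc k) * ((real k + 2) / (real k + real l + 3))"
      using y[of 0] y[of "Suc k"] ang_weight0[of l] ang_weight[of k l] by (intro mult_nonneg_nonneg; simp)+
    ultimately show ?thesis by linarith
  qed
  have Axy: "\<bar>?A x - ?A y\<bar> \<le> 2 * \<delta>"
  proof -
    define p where "p = (x 0 - y 0) * (1 / (real l + 2))"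
    define q where "q = (x (Suc k) - y (Suc k)) * ((real k + 2) / (real k + real l + 3))"
    have "\<bar>p\<bar> \<le> \<delta> * 1" "\<bar>q\<bar> \<le> \<delta> * 1"
      unfolding abs_mult p_def q_def using d[of 0] d[of "Suc k"] ang_weight0[of l] ang_weight[of k l] \<open>\<delta> \<ge> 0\<close>
      by (intro mult_mono; simp)+
    moreover have "?A x - ?A y = p - q"
      by (simp only: left_diff_distrib p_def q_def)
    ultimately show ?thesis by (simp only:)
  qed
  have e: "ang_e l c x k = c * ?A x" "ang_e l c' y k = c' * ?A y" by (simp_all add: ang_e_def)
  have "ang_e l c x k - ang_e l c' y k = c * (?A x - ?A y) + (c - c') * ?A y"
    unfolding e by (simp only: left_diff_distrib right_diff_distrib)
  also have "\<bar>\<dots>\<bar> \<le> c * (2 * \<delta>) + \<bar>c - c'\<bar> * 2"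
  proof -
    have "\<bar>c * (?A x - ?A y)\<bar> \<le> c * (2 * \<delta>)" using Axy c by (simp add: abs_mult mult_left_mono)
    moreover have "\<bar>(c - c') * ?A y\<bar> \<le> \<bar>c - c'\<bar> * 2" unfolding abs_mult using Ay by (intro mult_left_mono) auto
    ultimately show ?thesis by (rule order_trans[OF abs_triangle_ineq add_mono])
  qed
  finally have e: "\<bar>ang_e l c x k - ang_e l c' y k\<bar> \<le> 2 * c * \<delta> + 2 * \<bar>c - c'\<bar>" by simp
  have dpos: "ang_d l k > 0" "ang_d l k \<ge> 8" using ang_d_pos ang_d_ge_8 by auto
  have "\<bar>ang_step l c x k - ang_step l c' y k\<bar> \<le> 2 * \<bar>ang_e l c x k - ang_e l c' y k\<bar> / ang_d l k"
    unfolding ang_step_def by (intro quotient_diff_bound dpos ang_e_bound assms)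
  also have "\<dots> \<le> 2 * (2 * c * \<delta> + 2 * \<bar>c - c'\<bar>) / ang_d l k"
    using e dpos by (intro divide_right_mono mult_left_mono) auto
  also have "\<dots> \<le> \<delta> / 2 + \<bar>c - c'\<bar>"
  proof -
    \<comment> \<open>Here \<open>ang_d\<close> \<ge> 4 (l + 2) \<ge> 16 c, which leaves the
      contraction factor 1/2 after division.\<close>
    have "4 * c * \<delta> \<le> (ang_d l k / 4) * \<delta>"
      using c ang_d_ge[of l k] \<open>\<delta> \<ge> 0\<close> by (intro mult_right_mono) auto
    moreover have "0 \<le> (ang_d l k / 4) * \<delta>" using dpos \<open>\<delta> \<ge> 0\<close> by simp
    moreover have "4 * \<bar>c - c'\<bar> \<le> ang_d l k * \<bar>c - c'\<bar>"
      using dpos by (intro mult_right_mono) auto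
    ultimately have "2 * (2 * c * \<delta> + 2 * \<bar>c - c'\<bar>) \<le> (\<delta> / 2 + \<bar>c - c'\<bar>) * ang_d l k"
      by (simp add: algebra_simps)
    then show ?thesis using dpos by (simp add: pos_divide_le_eq)
  qed
  finally show ?thesis .
qed

lemma ang_step_fixpoint:
  assumes c: "0 \<le> c" "4 * c \<le> real l + 2"
  shows "\<exists>\<tau>. (\<forall>k. \<tau> k \<in> {0..2}) \<and> ang_step l c \<tau> = \<tau>"
proof (rule contraction_box_fixpoint)
  fix x :: "nat \<Rightarrow> real" and k assume x: "\<And>j. x j \<in> {0..2}"
  have dpos: "ang_d l k > 0" by (rule ang_d_pos)
  have "\<bar>ang_e l c x k\<bar> \<le> ang_d l k / 8" by (rule ang_e_bound[OF c x])
  then have "ang_d l k + ang_e l c x k \<ge> ang_d l k / 2" using dpos by linarith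
  then show "ang_step l c x k \<in> {0..2}"
    unfolding ang_step_def using dpos by (auto simp: field_simps)
next
  fix x y :: "nat \<Rightarrow> real" and d k
  assume "\<And>j. x j \<in> {0..2}" "\<And>j. y j \<in> {0..2}" "\<And>j. \<bar>x j - y j\<bar> \<le> d"
  then show "\<bar>ang_step l c x k - ang_step l c y k\<bar> \<le> d / 2"
    using ang_step_diff[OF c c, of x y d k] by simp
qed

section \<open>The fixed point, the eigenvalue shift and the Taylor series they determine\<close>

definition ang_tau :: "nat \<Rightarrow> real \<Rightarrow> nat \<Rightarrow> real" where
  "ang_tau l c = (SOME \<tau>. (\<forall>k. \<tau> k \<in> {0..2}) \<and> ang_step l c \<tau> = \<tau>)"

lemma ang_tau:
  assumes "0 \<le> c" "4 * c \<le> real l + 2"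
  shows "ang_tau l c k \<in> {0..2}" "ang_step l c (ang_tau l c) = ang_tau l c"
  using someI_ex[OF ang_step_fixpoint[OF assms]] unfolding ang_tau_def[symmetric] by auto

text \<open>Feeding the fixed point property into \<open>ang_step_diff\<close> improves a bound
  \<delta> to \<delta> / 2 + |c - c'|. Repeating this from a crude bound given by the box drives it
  down to 2 |c - c'|.\<close>

lemma ang_tau_lipschitz:
  assumes c: "0 \<le> c" "4 * c \<le> real l + 2" and c': "0 \<le> c'" "4 * c' \<le> real l + 2"
  shows "\<bar>ang_tau l c k - ang_tau l c' k\<bar> \<le> 2 * \<bar>c - c'\<bar>"
proof -
  have *: "\<bar>ang_tau l c k - ang_tau l c' k\<bar> \<le> 2 * \<bar>c - c'\<bar> + 2 * (1/2) ^ n" for n k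
  proof (induction n arbitrary: k)
    case 0
    have "0 \<le> 2 * \<bar>c - c'\<bar>" by simp
    then show ?case using ang_tau(1)[OF c, of k] ang_tau(1)[OF c', of k]
      unfolding power_0 atLeastAtMost_iff by linarith
  next
    case (Suc n)
    have "\<bar>ang_step l c (ang_tau l c) k - ang_step l c' (ang_tau l c') k\<bar>
        \<le> (2 * \<bar>c - c'\<bar> + 2 * (1/2) ^ n) / 2 + \<bar>c - c'\<bar>"
      by (rule ang_step_diff[OF c c' ang_tau(1)[OF c] ang_tau(1)[OF c'] Suc])
    then show ?case by (simp add: ang_tau(2)[OF c] ang_tau(2)[OF c'] add_divide_distrib)
  qed
  have "(\<lambda>n. 2 * \<bar>c - c'\<bar> + 2 * (1/2) ^ n) \<longlonglongrightarrow> 2 * \<bar>c - c'\<bar> + 2 * 0"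
    by (intro tendsto_intros) auto
  then show ?thesis
    by (intro LIMSEQ_le_const[where X = "\<lambda>n. 2 * \<bar>c - c'\<bar> + 2 * (1/2) ^ n"]) (use * in auto)
qed

text \<open>The amount by which the eigenvalue differs from l (l + 2); its value is forced by the
  recursion at k = 0.\<close>

definition ang_shift :: "nat \<Rightarrow> real \<Rightarrow> real" where
  "ang_shift l c = - c * ang_tau l c 0 / (real l + 2)"

fun ang_coeff :: "nat \<Rightarrow> real \<Rightarrow> nat \<Rightarrow> real" where
  "ang_coeff l c 0 = 1"
| "ang_coeff l c (Suc k) = ang_coeff l c k * (c * ang_tau l c k / ang_d l k)"

definition ang_fps :: "nat \<Rightarrow> real \<Rightarrow> real fps" where
  "ang_fps l c = Abs_fps (ang_coeff l c)"

lemma ang_shift_bounds: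
  assumes "0 \<le> c" "4 * c \<le> real l + 2"
  shows "-1 \<le> ang_shift l c" "ang_shift l c \<le> 0"
proof -
  have "c * ang_tau l c 0 \<le> ((real l + 2) / 4) * 2"
    using assms ang_tau(1)[OF assms, of 0] by (intro mult_mono) auto
  then show "-1 \<le> ang_shift l c" by (simp add: ang_shift_def field_simps)
  show "ang_shift l c \<le> 0"
    using assms ang_tau(1)[OF assms, of 0] by (simp add: ang_shift_def)
qed

lemma continuous_on_ang_shift: "continuous_on {c. 0 \<le> c \<and> 4 * c \<le> real l + 2} (ang_shift l)"
proof -
  have "continuous_on {c. 0 \<le> c \<and> 4 * c \<le> real l + 2} (\<lambda>c. ang_tau l c 0)"
    by (rule lipschitz_on_continuous_on[where L=2], rule lipschitz_onI)
      (use ang_tau_lipschitz in \<open>auto simp: dist_real_def\<close>)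
  then show ?thesis unfolding ang_shift_def by (intro continuous_intros) auto
qed

text \<open>The gain from choosing the minimal solution: its ratios are at most c / (k + 1), so it
  is dominated by an exponential series. For a generic solution of the recursion the ratios tend to
  1, and the series is singular at cos^2 \<theta> = 1, that is, at \<theta> = 0.\<close>

lemma ang_coeff_bounds:
  assumes c: "0 \<le> c" "4 * c \<le> real l + 2"
  shows "0 \<le> ang_coeff l c k" "ang_coeff l c k \<le> c ^ k / fact k"
proof -
  have "0 \<le> ang_coeff l c k \<and> ang_coeff l c k \<le> c ^ k / fact k"
  proof (induction k)
    case (Suc k)
    have d: "ang_d l k \<ge> 2 * (real k + 1)" "ang_d l k > 0"
      using ang_d_pos[of l k] by (simp_all add: ang_d_def distrib_right distrib_left)
    have "c * ang_tau l c k / ang_d l k \<le> c * 2 / ((real k + 1) * 2)"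
      using ang_tau(1)[OF c, of k] c d by (intro frac_le mult_left_mono) auto
    then have "c * ang_tau l c k / ang_d l k \<le> c / (real k + 1)"
      using mult_divide_mult_cancel_right[of "2::real" c "real k + 1"] by simp
    moreover have "0 \<le> c * ang_tau l c k / ang_d l k"
      using ang_tau(1)[OF c, of k] c d by auto
    ultimately have "ang_coeff l c k * (c * ang_tau l c k / ang_d l k) \<le> (c ^ k / fact k) * (c / (real k + 1))"
      "0 \<le> ang_coeff l c k * (c * ang_tau l c k / ang_d l k)"
      using Suc c by (auto intro!: mult_mono simp del: times_divide_eq_right times_divide_eq_left)
    then show ?case by (simp add: field_simps)
  qed simp
  then show "0 \<le> ang_coeff l c k" "ang_coeff l c k \<le> c ^ k / fact k" by auto
qed

lemma ang_fps_conv_radius: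
  assumes c: "0 \<le> c" "4 * c \<le> real l + 2"
  shows "fps_conv_radius (ang_fps l c) = \<infinity>"
proof -
  have "summable (\<lambda>k. ang_coeff l c k * x ^ k)" for x :: real
  proof (rule summable_comparison_test'[where N = 0])
    show "summable (\<lambda>k. (c * \<bar>x\<bar>) ^ k /\<^sub>R fact k)" by (rule summable_exp_generic)
    show "norm (ang_coeff l c k * x ^ k) \<le> (c * \<bar>x\<bar>) ^ k /\<^sub>R fact k" for k
      using mult_right_mono[OF ang_coeff_bounds(2)[OF c, of k], of "\<bar>x\<bar> ^ k"] ang_coeff_bounds(1)[OF c, of k]
      by (simp add: abs_mult power_abs power_mult_distrib field_simps)
  qed
  then have "conv_radius (ang_coeff l c) \<ge> \<infinity>"
    by (intro conv_radius_geI_ex') auto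
  then show ?thesis by (simp add: fps_conv_radius_def ang_fps_def)
qed

lemma ang_fps_pos:
  assumes c: "0 \<le> c" "4 * c \<le> real l + 2" and x: "x \<ge> 0"
  shows "eval_fps (ang_fps l c) x > 0"
proof -
  have "summable (\<lambda>k. ang_coeff l c k * x ^ k)"
    using summable_fps[of x "ang_fps l c"] ang_fps_conv_radius[OF c] by (simp add: ang_fps_def)
  then have "(\<Sum>k\<in>{0}. ang_coeff l c k * x ^ k) \<le> (\<Sum>k. ang_coeff l c k * x ^ k)"
    using x ang_coeff_bounds(1)[OF c] by (intro sum_le_suminf) auto
  then show ?thesis by (simp add: eval_fps_def ang_fps_def)
qed

lemma ang_coeff_recursion:
  assumes c: "0 \<le> c" "4 * c \<le> real l + 2"
  shows "4 * (real k + 1)\<^sup>2 * ang_coeff l c (Suc k) =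
    (4 * real k * (real k + real l + 1) - ang_shift l c) * ang_coeff l c k
      - c * (if k = 0 then 0 else ang_coeff l c (k - 1))"
proof (cases k)
  case 0
  then show ?thesis by (simp add: ang_shift_def ang_d_def divide_simps)
next
  case (Suc m)
  let ?\<tau> = "ang_tau l c" and ?d = "ang_d l m" and ?p = "ang_coeff l c"
  have dpos: "?d > 0" by (rule ang_d_pos)
  have "\<bar>ang_e l c ?\<tau> m\<bar> \<le> ?d / 8" by (rule ang_e_bound[OF c ang_tau(1)[OF c]])
  then have pos: "?d + ang_e l c ?\<tau> m > 0" using dpos by linarith
  \<comment> \<open>The fixed point equation at m = k - 1 is used to express c times coefficient m
    through coefficient k, which is the third term of the recursion.\<close>
  have "?\<tau> m = ?d / (?d + ang_e l c ?\<tau> m)"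
    using ang_tau(2)[OF c] by (metis ang_step_def)
  then have tau: "?\<tau> m * (?d + ang_e l c ?\<tau> m) = ?d" using pos by simp
  have pk: "?p k * ?d = ?p m * (c * ?\<tau> m)" using dpos by (simp add: Suc)
  have "(c * ?p m) * ?d = (c * ?p m) * (?\<tau> m * (?d + ang_e l c ?\<tau> m))" by (simp add: tau)
  also have "\<dots> = (?p k * ?d) * (?d + ang_e l c ?\<tau> m)" by (simp add: pk)
  finally have cp: "c * ?p m = ?p k * (?d + ang_e l c ?\<tau> m)" using dpos by simp
  have frac: "(4 * x\<^sup>2) * (u / (4 * x * y)) = u * (x / y)" if "x > 0" "y > 0" for u x y :: real
    using that by (simp add: field_simps power2_eq_square)
  have "4 * (real k + 1)\<^sup>2 * ?p (Suc k) = ?p k * (c * ?\<tau> k * ((real k + 1) / (real k + real l + 2)))"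
    using frac[of "real k + 1" "real k + real l + 2" "c * ?\<tau> k"]
    unfolding ang_coeff.simps ang_d_def by (simp only: mult.left_commute)
  also have "\<dots> = (?d - ang_shift l c) * ?p k - ?p k * (?d + ang_e l c ?\<tau> m)"
    by (simp add: ang_e_def ang_shift_def Suc algebra_simps)
  also have "\<dots> = (?d - ang_shift l c) * ?p k - c * ?p m" by (simp only: cp)
  also have "?d = 4 * real k * (real k + real l + 1)" by (simp add: ang_d_def Suc algebra_simps)
  finally show ?thesis by (simp add: Suc del: ang_coeff.simps)
qed

text \<open>This is the angular equation in x = cos^2 \<theta> after the factor sin^l \<theta> has
  been split off, with eigenvalue l (l + 2) plus the shift.\<close>

lemma ang_fps_ode:
  assumes c: "0 \<le> c" "4 * c \<le> real l + 2"
  shows "4 * x * (1 - x) * eval_fps (fps_deriv (fps_deriv (ang_fps l c))) x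
    + 4 * (1 - (real l + 2) * x) * eval_fps (fps_deriv (ang_fps l c)) x
    + (ang_shift l c + c * x) * eval_fps (ang_fps l c) x = 0"
proof -
  let ?P = "ang_fps l c"
  have r: "fps_conv_radius ?P = \<infinity>" "fps_conv_radius (fps_deriv ?P) = \<infinity>"
    "fps_conv_radius (fps_deriv (fps_deriv ?P)) = \<infinity>"
    using ang_fps_conv_radius[OF c] fps_conv_radius_deriv[of ?P] fps_conv_radius_deriv[of "fps_deriv ?P"] by auto
  have [simp]: "fps_conv_radius (F * G) = \<infinity>" if "fps_conv_radius F = \<infinity>" "fps_conv_radius G = \<infinity>" for F G :: "real fps"
    using fps_conv_radius_mult[of F G] that by simp
  have [simp]: "fps_conv_radius (F + G) = \<infinity>" if "fps_conv_radius F = \<infinity>" "fps_conv_radius G = \<infinity>" for F G :: "real fps"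
    using fps_conv_radius_add[of F G] that by simp
  have [simp]: "fps_conv_radius (F - G) = \<infinity>" if "fps_conv_radius F = \<infinity>" "fps_conv_radius G = \<infinity>" for F G :: "real fps"
    using fps_conv_radius_diff[of F G] that by simp
  let ?L = "fps_const 4 * (fps_X * fps_deriv (fps_deriv ?P) - fps_X * (fps_X * fps_deriv (fps_deriv ?P)))
    + fps_const 4 * (fps_deriv ?P - fps_const (real l + 2) * (fps_X * fps_deriv ?P))
    + fps_const (ang_shift l c) * ?P + fps_const c * (fps_X * ?P)"
  have "?L = 0"
  proof (rule fps_ext)
    fix n
    have rec: "4 * (real n + 1)\<^sup>2 * fps_nth ?P (Suc n) =
      (4 * real n * (real n + real l + 1) - ang_shift l c) * fps_nth ?P n
        - c * (if n = 0 then 0 else fps_nth ?P (n - 1))"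
      using ang_coeff_recursion[OF c, of n] by (simp add: ang_fps_def del: ang_coeff.simps)
    consider "n = 0" | "n = 1" | m where "n = Suc (Suc m)" by (metis One_nat_def not0_implies_Suc)
    then show "fps_nth ?L n = fps_nth 0 n"
      using rec by cases (simp_all add: algebra_simps power2_eq_square)
  qed
  then have "eval_fps ?L x = 0" by simp
  then show ?thesis
    by (simp add: eval_fps_add eval_fps_diff eval_fps_mult r algebra_simps)
qed

section \<open>The lowest angular eigenfunction\<close>

definition ang_fun :: "nat \<Rightarrow> real \<Rightarrow> real \<Rightarrow> real" where
  "ang_fun l c \<theta> = sin \<theta> ^ l * eval_fps (ang_fps l c) ((cos \<theta>)\<^sup>2)"

definition ang_fun' :: "nat \<Rightarrow> real \<Rightarrow> real \<Rightarrow> real" where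
  "ang_fun' l c \<theta> = real l * sin \<theta> ^ (l - 1) * cos \<theta> * eval_fps (ang_fps l c) ((cos \<theta>)\<^sup>2)
    - 2 * sin \<theta> ^ (Suc l) * cos \<theta> * eval_fps (fps_deriv (ang_fps l c)) ((cos \<theta>)\<^sup>2)"

text \<open>The Sturm-Liouville flux sin (2 \<theta>) u' for l \<ge> 2, with the powers of sin
  \<theta> collected into one factor.\<close>

definition ang_flux :: "nat \<Rightarrow> real \<Rightarrow> real \<Rightarrow> real" where
  "ang_flux l c \<theta> = 2 * (cos \<theta>)\<^sup>2 * sin \<theta> ^ l *
     (real l * eval_fps (ang_fps l c) ((cos \<theta>)\<^sup>2)
       - 2 * (sin \<theta>)\<^sup>2 * eval_fps (fps_deriv (ang_fps l c)) ((cos \<theta>)\<^sup>2))"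

lemma ang_fun_derivs:
  assumes c: "0 \<le> c" "4 * c \<le> real l + 2"
  shows "(ang_fun l c has_real_derivative ang_fun' l c \<theta>) (at \<theta>)"
    and "continuous_on UNIV (ang_fun' l c)"
    and "l \<ge> 2 \<Longrightarrow> sin \<theta> \<noteq> 0 \<Longrightarrow> ((\<lambda>s. sin (2 * s) * ang_fun' l c s) has_real_derivative
       sin (2 * \<theta>) * (((real l)\<^sup>2 / (sin \<theta>)\<^sup>2 - c * (cos \<theta>)\<^sup>2) - (real l * (real l + 2) + ang_shift l c)) * ang_fun l c \<theta>) (at \<theta>)"
proof -
  let ?P = "ang_fps l c"
  let ?p = "eval_fps ?P" and ?p' = "eval_fps (fps_deriv ?P)" and ?p'' = "eval_fps (fps_deriv (fps_deriv ?P))"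
  have r: "fps_conv_radius ?P = \<infinity>" "fps_conv_radius (fps_deriv ?P) = \<infinity>"
    "fps_conv_radius (fps_deriv (fps_deriv ?P)) = \<infinity>"
    using ang_fps_conv_radius[OF c] fps_conv_radius_deriv[of ?P] fps_conv_radius_deriv[of "fps_deriv ?P"] by auto
  have dp: "(?p has_real_derivative ?p' x) (at x)" "(?p' has_real_derivative ?p'' x) (at x)" for x
    by (rule has_field_derivative_eval_fps; simp add: r)+
  have cp: "continuous_on UNIV ?p" "continuous_on UNIV ?p'"
    using dp by (auto intro!: continuous_at_imp_continuous_on DERIV_isCont)
  have dC: "((\<lambda>\<theta>. (cos \<theta>)\<^sup>2) has_real_derivative - 2 * cos \<theta> * sin \<theta>) (at \<theta>)" for \<theta> :: real
    by (auto intro!: derivative_eq_intros)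
  have dS: "((\<lambda>\<theta>. sin \<theta> ^ n) has_real_derivative real n * sin \<theta> ^ (n - 1) * cos \<theta>) (at \<theta>)" for \<theta> :: real and n
    by (auto intro!: derivative_eq_intros)
  note dP = DERIV_chain2[OF dp(1) dC] DERIV_chain2[OF dp(2) dC]
  have 1: "(ang_fun l c has_real_derivative ang_fun' l c \<theta>) (at \<theta>)" for \<theta>
    unfolding ang_fun_def[abs_def] ang_fun'_def
    by (rule DERIV_cong[OF DERIV_mult[OF dS dP(1)]]) (simp add: algebra_simps)
  have 2: "continuous_on UNIV (ang_fun' l c)"
    unfolding ang_fun'_def[abs_def] by (intro continuous_intros continuous_on_compose2[OF cp(1)] continuous_on_compose2[OF cp(2)]) auto
  have 3: "sin (2 * \<theta>) * ang_fun' l c \<theta> = ang_flux l c \<theta>" if "l \<ge> 2" for \<theta>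
  proof -
    have "sin \<theta> * sin \<theta> ^ (l - 1) = sin \<theta> ^ l" using that by (simp flip: power_Suc)
    then show ?thesis
      unfolding ang_fun'_def ang_flux_def sin_double
      by (simp add: algebra_simps power2_eq_square)
  qed
  have 4: "((\<lambda>s. sin (2 * s) * ang_fun' l c s) has_real_derivative
       sin (2 * \<theta>) * (((real l)\<^sup>2 / (sin \<theta>)\<^sup>2 - c * (cos \<theta>)\<^sup>2) - (real l * (real l + 2) + ang_shift l c)) * ang_fun l c \<theta>) (at \<theta>)"
    if l: "l \<ge> 2" and s: "sin \<theta> \<noteq> 0" for \<theta>
  proof -
    \<comment> \<open>Writing l = m + 2 turns the quotient by sin^2 \<theta> into a polynomial
      identity.\<close>
    obtain m where m: "l = Suc (Suc m)" using l by (metis add_2_eq_Suc le_Suc_ex)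
    define S C where "S = sin \<theta>" and "C = cos \<theta>"
    define P0 P1 P2 where "P0 = ?p (C\<^sup>2)" and "P1 = ?p' (C\<^sup>2)" and "P2 = ?p'' (C\<^sup>2)"
    have SC: "S\<^sup>2 = 1 - C\<^sup>2" by (simp add: S_def C_def sin_squared_eq)
    have ode: "4 * C\<^sup>2 * S\<^sup>2 * P2 + 4 * (1 - (real l + 2) * C\<^sup>2) * P1 + (ang_shift l c + c * C\<^sup>2) * P0 = 0"
      using ang_fps_ode[OF c, of "C\<^sup>2"] by (simp add: P0_def P1_def P2_def SC)
    have "(ang_flux l c has_real_derivative
      2 * (- 2 * C * S) * S ^ l * (real l * P0 - 2 * S\<^sup>2 * P1)
      + 2 * C\<^sup>2 * (real l * S ^ (l - 1) * C) * (real l * P0 - 2 * S\<^sup>2 * P1)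
      + 2 * C\<^sup>2 * S ^ l * (real l * (P1 * (- 2 * C * S)) - 4 * S * C * P1 - 2 * S\<^sup>2 * (P2 * (- 2 * C * S)))) (at \<theta>)"
      unfolding ang_flux_def[abs_def] S_def C_def P0_def P1_def P2_def
      by (rule DERIV_cong[OF DERIV_mult[OF DERIV_mult[OF DERIV_cmult[OF dC] dS]
              DERIV_diff[OF DERIV_cmult[OF dP(1)] DERIV_mult[OF DERIV_cmult[OF dS[of 2]] dP(2)]]]])
        (simp add: algebra_simps power2_eq_square)
    also have "2 * (- 2 * C * S) * S ^ l * (real l * P0 - 2 * S\<^sup>2 * P1)
      + 2 * C\<^sup>2 * (real l * S ^ (l - 1) * C) * (real l * P0 - 2 * S\<^sup>2 * P1)
      + 2 * C\<^sup>2 * S ^ l * (real l * (P1 * (- 2 * C * S)) - 4 * S * C * P1 - 2 * S\<^sup>2 * (P2 * (- 2 * C * S)))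
      = 2 * S * C * S ^ m * ((real l)\<^sup>2 * C\<^sup>2 * P0 - 2 * real l * S\<^sup>2 * P0
          + S\<^sup>2 * (4 * S\<^sup>2 * P1 - (4 * real l + 4) * C\<^sup>2 * P1 + 4 * C\<^sup>2 * S\<^sup>2 * P2))"
      unfolding m by (simp add: algebra_simps power2_eq_square)
    also have "4 * S\<^sup>2 * P1 - (4 * real l + 4) * C\<^sup>2 * P1 + 4 * C\<^sup>2 * S\<^sup>2 * P2 = - (ang_shift l c + c * C\<^sup>2) * P0"
      using ode unfolding SC by (simp add: algebra_simps)
    also have "2 * S * C * S ^ m * ((real l)\<^sup>2 * C\<^sup>2 * P0 - 2 * real l * S\<^sup>2 * P0 + S\<^sup>2 * (- (ang_shift l c + c * C\<^sup>2) * P0))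
       = 2 * S * C * (((real l)\<^sup>2 - (real l)\<^sup>2 * S\<^sup>2 - c * C\<^sup>2 * S\<^sup>2) - 2 * real l * S\<^sup>2 - ang_shift l c * S\<^sup>2) * (S ^ m * P0)"
      by (simp add: SC algebra_simps)
    also have "\<dots> = 2 * S * C * (((real l)\<^sup>2 / S\<^sup>2 - c * C\<^sup>2) - (real l * (real l + 2) + ang_shift l c)) * (S ^ l * P0)"
      using s unfolding m by (simp add: S_def[symmetric] field_simps power2_eq_square)
    finally show ?thesis
      using 3[OF l] by (simp add: ang_fun_def S_def C_def P0_def sin_double)
  qed
  show "(ang_fun l c has_real_derivative ang_fun' l c \<theta>) (at \<theta>)" "continuous_on UNIV (ang_fun' l c)"
    by (fact 1 2)+
  show "((\<lambda>s. sin (2 * s) * ang_fun' l c s) has_real_derivative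
       sin (2 * \<theta>) * (((real l)\<^sup>2 / (sin \<theta>)\<^sup>2 - c * (cos \<theta>)\<^sup>2) - (real l * (real l + 2) + ang_shift l c)) * ang_fun l c \<theta>) (at \<theta>)"
    if "l \<ge> 2" "sin \<theta> \<noteq> 0" using that by (rule 4)
qed

lemma ang_fun_pos:
  assumes "0 \<le> c" "4 * c \<le> real l + 2" "0 < \<theta>" "\<theta> < pi / 2"
  shows "ang_fun l c \<theta> > 0"
  unfolding ang_fun_def using assms by (intro mult_pos_pos ang_fps_pos zero_less_power sin_gt_zero) auto

lemma smooth_on_eval_fps:
  fixes P :: "real fps"
  assumes "open S" "smooth_on S q" "\<And>x. x \<in> S \<Longrightarrow> ereal \<bar>q x\<bar> < fps_conv_radius P"
  shows "smooth_on S (\<lambda>x. eval_fps P (q x))"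
proof -
  define G where "G n = eval_fps ((fps_deriv ^^ n) P)" for n
  have rad: "fps_conv_radius ((fps_deriv ^^ n) P) \<ge> fps_conv_radius P" for n
    by (induction n) (auto intro: order_trans[OF _ fps_conv_radius_deriv])
  have "smooth_on S (\<lambda>x. G 0 (q x))"
  proof (rule smooth_on_real_compose[OF assms(1,2), where T = "q ` S"])
    fix n t assume t: "t \<in> q ` S"
    have "ereal (norm t) < fps_conv_radius ((fps_deriv ^^ n) P)"
      using t assms(3) by (auto intro: less_le_trans[OF _ rad])
    then show "(G n has_real_derivative G (Suc n) t) (at t)"
      unfolding G_def funpow.simps o_def by (rule has_field_derivative_eval_fps)
  qed auto
  then show ?thesis by (simp add: G_def)
qed

lemma ang_fun_S3_regular:
  assumes c: "0 \<le> c" "4 * c \<le> real l + 2"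
  shows "S3_regular (- int l) (ang_fun l c)"
  unfolding S3_regular_def
proof (intro exI conjI ballI allI)
  \<comment> \<open>On the sphere sin^l \<theta> exp (-i l \<phi>) is the l-th power of the
    conjugate of the first coordinate, and cos^2 \<theta> is the squared modulus of the second. This
    is why the factor sin^l \<theta> gives regularity on the axis.\<close>
  let ?U = "\<lambda>z::complex \<times> complex. cnj (fst z) ^ l * complex_of_real (eval_fps (ang_fps l c) ((cmod (snd z))\<^sup>2))"
  show "open (UNIV :: (complex \<times> complex) set)" by simp
  show "smooth_on UNIV ?U"
    by (intro smooth_on_mult smooth_on_power smooth_on_of_real smooth_on_eval_fps smooth_on_cmod_power2
        smooth_on_bounded_linear bounded_linear_compose[OF bounded_linear_cnj bounded_linear_fst] bounded_linear_snd)
      (auto simp: ang_fps_conv_radius[OF c])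
  fix \<theta> \<phi> \<psi> :: real
  show "cis (of_int (- int l) * \<phi>) * complex_of_real (ang_fun l c \<theta>)
     = ?U (complex_of_real (sin \<theta>) * cis \<phi>, complex_of_real (cos \<theta>) * cis \<psi>)"
    by (simp add: ang_fun_def power_mult_distrib norm_mult cis_cnj Complex.DeMoivre)
qed auto

lemma ang_fun_eigenfunction:
  assumes "Rz > 0" "c = \<omega>\<^sup>2 * (ms_a Q1 Q2 Rz)\<^sup>2" "4 * c \<le> real l + 2" "l \<ge> 2"
  shows "angular_eigenfunction Q1 Q2 Rz \<omega> 0 (- int l) (real l * (real l + 2) + ang_shift l c) (ang_fun l c)"
proof -
  have c: "0 \<le> c" "4 * c \<le> real l + 2" using assms by auto
  have du: "deriv (ang_fun l c) = ang_fun' l c"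
    using ang_fun_derivs(1)[OF c] by (auto intro!: DERIV_imp_deriv)
  have eq: "- (1 / sin (2 * \<theta>)) * deriv (\<lambda>s. sin (2 * s) * deriv (ang_fun l c) s) \<theta>
        + ((of_int (- int l))\<^sup>2 / (sin \<theta>)\<^sup>2
           + ((0 * Rz)\<^sup>2 - (\<omega> * Rz)\<^sup>2) * ((ms_a Q1 Q2 Rz)\<^sup>2 / Rz\<^sup>2) * (cos \<theta>)\<^sup>2) * ang_fun l c \<theta>
        = (real l * (real l + 2) + ang_shift l c) * ang_fun l c \<theta>" if "\<theta> \<in> {0<..<pi/2}" for \<theta>
  proof -
    have s: "sin \<theta> \<noteq> 0" "sin (2 * \<theta>) \<noteq> 0"
      using that sin_gt_zero[of \<theta>] sin_gt_zero[of "2 * \<theta>"] by auto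
    have "((0 * Rz)\<^sup>2 - (\<omega> * Rz)\<^sup>2) * ((ms_a Q1 Q2 Rz)\<^sup>2 / Rz\<^sup>2) = - c"
      using assms by (simp add: power_mult_distrib)
    then show ?thesis
      unfolding du DERIV_imp_deriv[OF ang_fun_derivs(3)[OF c assms(4) s(1)]] using s(2) by (simp add: algebra_simps)
  qed
  have "ang_fun l c (pi / 4) \<noteq> 0" using ang_fun_pos[OF c, of "pi/4"] by simp
  then have "\<exists>\<theta>\<in>{0..pi/2}. ang_fun l c \<theta> \<noteq> 0" by (intro bexI[of _ "pi/4"]) auto
  then show ?thesis
    unfolding angular_eigenfunction_def using ang_fun_S3_regular[OF c] eq by blast
qed

section \<open>Absence of lower eigenvalues\<close>

text \<open>Once q > 0 and W \<ge> 0, the system q' = A W, W' = B q with positive A and B pushes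
  both upwards, so W cannot return to 0 at b.\<close>

lemma sturm_half:
  fixes q W A B :: "real \<Rightarrow> real"
  assumes q: "\<And>t. t \<in> {a<..<b} \<Longrightarrow> (q has_real_derivative A t * W t) (at t)"
    and W: "\<And>t. t \<in> {a<..<b} \<Longrightarrow> (W has_real_derivative B t * q t) (at t)"
    and pos: "\<And>t. t \<in> {a<..<b} \<Longrightarrow> A t > 0" "\<And>t. t \<in> {a<..<b} \<Longrightarrow> B t > 0"
    and t0: "t0 \<in> {a<..<b}" "q t0 > 0" "W t0 \<ge> 0"
    and lim: "(W \<longlongrightarrow> 0) (at_left b)"
  shows False
proof -
  have cont: "continuous_on {c..d} q" "continuous_on {c..d} W" if "a < c" "d < b" for c d
    using that by (auto intro!: continuous_at_imp_continuous_on DERIV_isCont[OF q] DERIV_isCont[OF W])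
  have qpos: "q t > 0" if t: "t0 \<le> t" "t < b" for t
  proof (rule ccontr)
    assume "\<not> q t > 0"
    \<comment> \<open>Up to the first zero of q both functions are nondecreasing, so q could not
      have come down to that zero.\<close>
    define Z where "Z = {s \<in> {t0..t}. q s \<le> 0}"
    have "closed Z"
      unfolding Z_def using t t0 by (intro continuous_on_closed_Collect_le cont continuous_on_const closed_atLeastAtMost) auto
    then have Zc: "compact Z"
      using bounded_subset[OF bounded_closed_interval, of Z t0 t] unfolding compact_eq_bounded_closed Z_def by blast
    have Zne: "Z \<noteq> {}" using t \<open>\<not> q t > 0\<close> by (auto simp: Z_def)
    obtain s where s: "s \<in> Z" "\<And>r. r \<in> Z \<Longrightarrow> s \<le> r"
      using compact_attains_inf[OF Zc Zne] by blast
    have s': "t0 \<le> s" "s \<le> t" "q s \<le> 0" using s(1) by (auto simp: Z_def)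
    have sb: "a < t0" "s < b" using t t0 s' by auto
    have qp: "q r > 0" if "t0 \<le> r" "r < s" for r
      using s(2)[of r] that s' by (force simp: Z_def)
    have Wge: "W t0 \<le> W r" if "t0 \<le> r" "r \<le> s" for r
    proof (rule DERIV_nonneg_imp_increasing_open[OF that(1)])
      show "\<exists>y. (W has_real_derivative y) (at x) \<and> 0 \<le> y" if "t0 < x" "x < r" for x
        using W[of x] pos(2)[of x] qp[of x] that \<open>r \<le> s\<close> sb by (intro exI[of _ "B x * q x"]) auto
      show "continuous_on {t0..r} W" using sb that by (intro cont) auto
    qed
    have "q t0 \<le> q s"
    proof (rule DERIV_nonneg_imp_increasing_open[OF s'(1)])
      show "\<exists>y. (q has_real_derivative y) (at x) \<and> 0 \<le> y" if "t0 < x" "x < s" for x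
        using q[of x] pos(1)[of x] Wge[of x] that t0(3) sb by (intro exI[of _ "A x * W x"]) auto
      show "continuous_on {t0..s} q" using sb by (intro cont) auto
    qed
    then show False using t0(2) s'(3) by simp
  qed
  have Wless: "W s < W t" if "t0 \<le> s" "s < t" "t < b" for s t
  proof (rule DERIV_pos_imp_increasing_open[OF that(2)])
    show "\<exists>y. (W has_real_derivative y) (at x) \<and> 0 < y" if "s < x" "x < t" for x
      using W[of x] pos(2)[of x] qpos[of x] that \<open>t < b\<close> \<open>t0 \<le> s\<close> t0 by (intro exI[of _ "B x * q x"]) auto
    show "continuous_on {s..t} W" using that t0 by (intro cont) auto
  qed
  define t1 where "t1 = (t0 + b) / 2"
  have t1: "t0 < t1" "t1 < b" using t0 by (auto simp: t1_def)
  have "W t1 > 0" using Wless[of t0 t1] t1 t0(3) by simp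
  have "eventually (\<lambda>t. W t < W t1) (at_left b)"
    using order_tendstoD(2)[OF lim \<open>W t1 > 0\<close>] .
  moreover have "eventually (\<lambda>t. t \<in> {t1<..<b}) (at_left b)"
    using t1 by (intro eventually_at_leftI) auto
  ultimately have "eventually (\<lambda>t. False) (at_left b)"
    by eventually_elim (use Wless[of t1] t1 in fastforce)
  then show False by (simp add: trivial_limit_at_left_real)
qed

text \<open>A change of sign makes q positive at a point where it is nonzero. The sign of W there
  decides the direction: \<open>sturm_half\<close> is run towards b, or, after the reflection t -> b
  - t, which reverses the sign of W, towards 0.\<close>

lemma sturm_trivial:
  fixes q W A B :: "real \<Rightarrow> real"
  assumes q: "\<And>t. t \<in> {0<..<b} \<Longrightarrow> (q has_real_derivative A t * W t) (at t)"
    and W: "\<And>t. t \<in> {0<..<b} \<Longrightarrow> (W has_real_derivative B t * q t) (at t)"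
    and pos: "\<And>t. t \<in> {0<..<b} \<Longrightarrow> A t > 0" "\<And>t. t \<in> {0<..<b} \<Longrightarrow> B t > 0"
    and lim: "(W \<longlongrightarrow> 0) (at_left b)" "(W \<longlongrightarrow> 0) (at_right 0)"
    and t0: "t0 \<in> {0<..<b}"
  shows "q t0 = 0"
proof (rule ccontr)
  assume "q t0 \<noteq> 0"
  define \<sigma> :: real where "\<sigma> = (if q t0 > 0 then 1 else - 1)"
  have \<sigma>: "\<sigma> * q t0 > 0" using \<open>q t0 \<noteq> 0\<close> by (auto simp: \<sigma>_def)
  have q1: "((\<lambda>t. \<sigma> * q t) has_real_derivative A t * (\<sigma> * W t)) (at t)" if "t \<in> {0<..<b}" for t
    using DERIV_cmult[OF q[OF that], of \<sigma>] by (simp add: mult_ac)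
  have W1: "((\<lambda>t. \<sigma> * W t) has_real_derivative B t * (\<sigma> * q t)) (at t)" if "t \<in> {0<..<b}" for t
    using DERIV_cmult[OF W[OF that], of \<sigma>] by (simp add: mult_ac)
  have lim1: "((\<lambda>t. \<sigma> * W t) \<longlongrightarrow> 0) (at_left b)" "((\<lambda>t. \<sigma> * W t) \<longlongrightarrow> 0) (at_right 0)"
    by (rule tendsto_mult_right_zero[OF lim(1)]) (rule tendsto_mult_right_zero[OF lim(2)])
  show False
  proof (cases "\<sigma> * W t0 \<ge> 0")
    case True
    show False by (rule sturm_half[OF q1 W1 pos t0 \<sigma> True lim1(1)])
  next
    case False
    have refl: "((\<lambda>t. b - t) has_real_derivative - 1) (at t)" for t
      by (auto intro!: derivative_eq_intros)
    have q2: "((\<lambda>t. \<sigma> * q (b - t)) has_real_derivative A (b - t) * (- (\<sigma> * W (b - t)))) (at t)" if "t \<in> {0<..<b}" for t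
      using DERIV_chain2[where g = "\<lambda>t. b - t" and x = t, OF q1 refl] that by simp
    have W2: "((\<lambda>t. - (\<sigma> * W (b - t))) has_real_derivative B (b - t) * (\<sigma> * q (b - t))) (at t)" if "t \<in> {0<..<b}" for t
      using DERIV_minus[OF DERIV_chain2[where g = "\<lambda>t. b - t" and x = t, OF W1 refl]] that by simp
    have lim2: "((\<lambda>t. - (\<sigma> * W (b - t))) \<longlongrightarrow> 0) (at_left b)"
    proof -
      have "filterlim (\<lambda>t. b - t) (at_right 0) (at_left b)"
        unfolding filterlim_at
        by (auto intro!: tendsto_eq_intros simp: eventually_at_filter)
      from filterlim_compose[OF lim1(2) this] show ?thesis
        using tendsto_minus[of _ "0::real"] by fastforce
    qed
    show False
    proof (rule sturm_half[OF q2 W2, where ?t0.0 = "b - t0"])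
      show "A (b - t) > 0" "B (b - t) > 0" if "t \<in> {0<..<b}" for t
        using that by (auto intro: pos)
      show "b - t0 \<in> {0<..<b}" "\<sigma> * q (b - (b - t0)) > 0" "- (\<sigma> * W (b - (b - t0))) \<ge> 0"
        using t0 \<sigma> False by auto
    qed (assumption | rule lim2)+
  qed
qed

text \<open>Restricting the smooth extension to the meridian \<phi> = \<psi> = 0 bounds u and u' up
  to both ends of the interval. These bounds are the form in which the boundary conditions enter the
  comparison below.\<close>

lemma S3_regular_derivative:
  assumes "S3_regular m u"
  obtains u' K where "\<And>t. t \<in> {0<..<pi/2} \<Longrightarrow> (u has_real_derivative u' t) (at t)"
    "\<And>t. t \<in> {0<..<pi/2} \<Longrightarrow> u' differentiable (at t)"
    "\<And>t. t \<in> {0<..<pi/2} \<Longrightarrow> \<bar>u t\<bar> \<le> K" "\<And>t. t \<in> {0<..<pi/2} \<Longrightarrow> \<bar>u' t\<bar> \<le> K"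
    "continuous_on {0..pi/2} u"
proof -
  obtain S and U :: "complex \<times> complex \<Rightarrow> complex" where S: "open S" "smooth_on S U" and U:
    "\<forall>\<theta>\<in>{0..pi/2}. \<forall>\<phi> \<psi>. (complex_of_real (sin \<theta>) * cis \<phi>, complex_of_real (cos \<theta>) * cis \<psi>) \<in> S \<and>
       cis (of_int m * \<phi>) * complex_of_real (u \<theta>) = U (complex_of_real (sin \<theta>) * cis \<phi>, complex_of_real (cos \<theta>) * cis \<psi>)"
    using assms unfolding S3_regular_def by blast
  define \<gamma> where "\<gamma> t = (complex_of_real (sin t), complex_of_real (cos t))" for t :: real
  have \<gamma>: "\<gamma> t \<in> S" "complex_of_real (u t) = U (\<gamma> t)" if "t \<in> {0..pi/2}" for t
    using U[rule_format, OF that, of 0 0] by (simp_all add: \<gamma>_def)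
  have d\<gamma>: "(\<gamma> has_vector_derivative (complex_of_real (cos t), - complex_of_real (sin t))) (at t)" for t
    unfolding \<gamma>_def[abs_def]
    by (intro has_vector_derivative_Pair)
      (auto intro!: derivative_eq_intros simp: has_vector_derivative_complex_iff has_vector_derivative_real_field)
  define D where "D v t = frechet_derivative U (at (\<gamma> t)) v" for v t
  have C1: "Ck_on (Suc 0) S (\<lambda>x. frechet_derivative U (at x) v)" for v
    using S Ck_on_SucD(2)[of S "Suc 0" U v] by (auto simp: smooth_on_def simp del: Ck_on.simps)
  have dD: "D v differentiable (at t)" if "t \<in> {0..pi/2}" for v t
    using has_vector_derivative_along[OF S(1) C1[of v], of \<gamma> t] \<gamma>(1)[OF that] d\<gamma>
    unfolding D_def[abs_def] by (auto intro: differentiableI_vector)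
  define F where "F t = cos t *\<^sub>R D (1, 0) t - sin t *\<^sub>R D (0, 1) t" for t
  have dF: "F differentiable (at t)" if "t \<in> {0..pi/2}" for t
    unfolding F_def using dD[OF that]
    by (intro derivative_intros) (auto intro!: derivative_intros simp: real_differentiable_def)
  have dU: "((\<lambda>t. U (\<gamma> t)) has_vector_derivative F t) (at t)" if "t \<in> {0..pi/2}" for t
  proof -
    have "bounded_linear (frechet_derivative U (at (\<gamma> t)))"
      using Ck_on_SucD(1)[OF S(1), of 0 U "\<gamma> t"] S(2) \<gamma>(1)[OF that]
      by (auto simp: smooth_on_def simp del: Ck_on.simps intro: has_derivative_bounded_linear)
    then interpret bounded_linear "frechet_derivative U (at (\<gamma> t))" .
    have "(complex_of_real (cos t), - complex_of_real (sin t)) = cos t *\<^sub>R (1, 0) - sin t *\<^sub>R (0, 1)"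
      by (simp add: scaleR_conv_of_real)
    then have "frechet_derivative U (at (\<gamma> t)) (complex_of_real (cos t), - complex_of_real (sin t)) = F t"
      by (simp only: diff scaleR F_def D_def)
    then show ?thesis
      using has_vector_derivative_along[OF S(1) _ \<gamma>(1)[OF that] d\<gamma>, of 0 U] S(2)
      by (auto simp: smooth_on_def simp del: Ck_on.simps)
  qed
  have contU: "continuous_on {0..pi/2} F" "continuous_on {0..pi/2} (\<lambda>t. U (\<gamma> t))"
    by (intro continuous_at_imp_continuous_on ballI differentiable_imp_continuous_within dF, assumption)
      (intro continuous_at_imp_continuous_on ballI has_vector_derivative_continuous[OF dU], assumption)
  then have "bounded (F ` {0..pi/2})" "bounded ((\<lambda>t. U (\<gamma> t)) ` {0..pi/2})"
    by (auto intro: compact_imp_bounded compact_continuous_image)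
  then obtain K1 K2 where K: "\<And>t. t \<in> {0..pi/2} \<Longrightarrow> norm (F t) \<le> K1" "\<And>t. t \<in> {0..pi/2} \<Longrightarrow> norm (U (\<gamma> t)) \<le> K2"
    unfolding bounded_iff by blast
  show ?thesis
  proof (rule that[of "\<lambda>t. Re (F t)" "max K1 K2"])
    fix t assume t: "t \<in> {0<..<pi/2}"
    then have t': "t \<in> {0..pi/2}" by auto
    have "((\<lambda>t. Re (U (\<gamma> t))) has_real_derivative Re (F t)) (at t)"
      using dU[OF t'] by (simp add: has_vector_derivative_complex_iff)
    moreover have "u s = Re (U (\<gamma> s))" if "s \<in> {0<..<pi/2}" for s
      using \<gamma>(2)[of s] that by (metis Re_complex_of_real atLeastAtMost_iff greaterThanLessThan_iff less_imp_le)
    ultimately show "(u has_real_derivative Re (F t)) (at t)"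
      using has_field_derivative_transform_within_open[of "\<lambda>t. Re (U (\<gamma> t))" _ t "{0<..<pi/2}" u] t by auto
    show "(\<lambda>t. Re (F t)) differentiable (at t)"
      using dF[OF t'] by (intro bounded_linear_imp_differentiable[OF bounded_linear_Re, THEN differentiable_compose] )
  next
    have "continuous_on {0..pi/2} (\<lambda>t. Re (U (\<gamma> t)))"
      using contU(2) by (intro continuous_intros)
    moreover have "Re (U (\<gamma> t)) = u t" if "t \<in> {0..pi/2}" for t
      by (simp flip: \<gamma>(2)[OF that])
    ultimately show "continuous_on {0..pi/2} u" by (rule continuous_on_eq)
  next
    fix t assume t: "t \<in> {0<..<pi/2}"
    then have t': "t \<in> {0..pi/2}" by auto
    show "\<bar>u t\<bar> \<le> max K1 K2" using K(2)[OF t'] by (simp flip: \<gamma>(2)[OF t'])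
    show "\<bar>Re (F t)\<bar> \<le> max K1 K2" using K(1)[OF t'] abs_Re_le_cmod[of "F t"] by linarith
  qed
qed

text \<open>Sturm comparison with the positive solution v. For k = sin (2 \<theta>) and the
  Wronskian W = k (u' v - u v'), the quotient q = u / v satisfies q' = W / (k v^2) and W' = k (E -
  E') v^2 q. If E' < E, both coefficients are positive. Since k vanishes at both ends, so does W,
  and \<open>sturm_trivial\<close> forces u = 0.\<close>

lemma ang_fun_lowest:
  assumes "Rz > 0" "c = \<omega>\<^sup>2 * (ms_a Q1 Q2 Rz)\<^sup>2" "4 * c \<le> real l + 2" "l \<ge> 2"
    and E': "E' \<in> angular_eigenvalues Q1 Q2 Rz \<omega> 0 (- int l)"
  shows "real l * (real l + 2) + ang_shift l c \<le> E'"
proof (rule ccontr)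
  define E where "E = real l * (real l + 2) + ang_shift l c"
  assume "\<not> ?thesis"
  then have EE: "E' < E" by (simp add: E_def)
  have c: "0 \<le> c" "4 * c \<le> real l + 2" using assms by auto
  obtain u where reg: "S3_regular (- int l) u" and nz: "\<exists>\<theta>\<in>{0..pi/2}. u \<theta> \<noteq> 0" and eq: "\<And>\<theta>. \<theta> \<in> {0<..<pi/2} \<Longrightarrow>
        - (1 / sin (2 * \<theta>)) * deriv (\<lambda>s. sin (2 * s) * deriv u s) \<theta>
        + ((of_int (- int l))\<^sup>2 / (sin \<theta>)\<^sup>2
           + ((0 * Rz)\<^sup>2 - (\<omega> * Rz)\<^sup>2) * ((ms_a Q1 Q2 Rz)\<^sup>2 / Rz\<^sup>2) * (cos \<theta>)\<^sup>2) * u \<theta>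
        = E' * u \<theta>"
    using E' unfolding angular_eigenvalues_def angular_eigenfunction_def by blast
  obtain u' K where u': "\<And>t. t \<in> {0<..<pi/2} \<Longrightarrow> (u has_real_derivative u' t) (at t)"
    "\<And>t. t \<in> {0<..<pi/2} \<Longrightarrow> u' differentiable (at t)"
    "\<And>t. t \<in> {0<..<pi/2} \<Longrightarrow> \<bar>u t\<bar> \<le> K" "\<And>t. t \<in> {0<..<pi/2} \<Longrightarrow> \<bar>u' t\<bar> \<le> K"
    and cont: "continuous_on {0..pi/2} u"
    by (rule S3_regular_derivative[OF reg], rule that)
  have cc: "((0 * Rz)\<^sup>2 - (\<omega> * Rz)\<^sup>2) * ((ms_a Q1 Q2 Rz)\<^sup>2 / Rz\<^sup>2) = - c"
    using assms(1,2) by (simp add: power_mult_distrib)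
  define V where "V t = (real l)\<^sup>2 / (sin t)\<^sup>2 - c * (cos t)\<^sup>2" for t
  define k where "k t = sin (2 * t)" for t :: real
  have k: "k t > 0" "sin t > 0" if "t \<in> {0<..<pi/2}" for t
    using that by (auto simp: k_def intro!: sin_gt_zero)
  have du: "((\<lambda>s. k s * u' s) has_real_derivative k t * (V t - E') * u t) (at t)" if t: "t \<in> {0<..<pi/2}" for t
  proof -
    obtain u'' where "(u' has_real_derivative u'') (at t)"
      using u'(2)[OF t] by (auto simp: real_differentiable_def)
    then have "((\<lambda>s. k s * u' s) has_real_derivative 2 * cos (2 * t) * u' t + k t * u'') (at t)"
      unfolding k_def by (auto intro!: derivative_eq_intros)
    then obtain X where X: "((\<lambda>s. k s * u' s) has_real_derivative X) (at t)" by blast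
    have "((\<lambda>s. sin (2 * s) * deriv u s) has_real_derivative X) (at t)"
      by (rule has_field_derivative_transform_within_open[OF X _ t])
        (auto simp: k_def DERIV_imp_deriv[OF u'(1)])
    then have "deriv (\<lambda>s. sin (2 * s) * deriv u s) t = X" by (rule DERIV_imp_deriv)
    then have "- (1 / k t) * X + V t * u t = E' * u t"
      using eq[OF t] unfolding cc V_def k_def by simp
    then have "X = k t * (V t - E') * u t"
      using k(1)[OF t] by (simp add: field_simps)
    with X show ?thesis by simp
  qed
  define v v' where "v = ang_fun l c" and "v' = ang_fun' l c"
  have v: "(v has_real_derivative v' t) (at t)" for t
    unfolding v_def v'_def by (rule ang_fun_derivs[OF c])
  have dv: "((\<lambda>s. k s * v' s) has_real_derivative k t * (V t - E) * v t) (at t)" if t: "t \<in> {0<..<pi/2}" for t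
    using ang_fun_derivs(3)[OF c assms(4), of t] k(2)[OF t] by (simp add: k_def V_def E_def v_def v'_def)
  have vpos: "v t > 0" if t: "t \<in> {0<..<pi/2}" for t
    unfolding v_def using ang_fun_pos[OF c] t by auto
  define W where "W t = (k t * u' t) * v t - u t * (k t * v' t)" for t
  have dW: "(W has_real_derivative (k t * (E - E') * (v t)\<^sup>2) * (u t / v t)) (at t)" if t: "t \<in> {0<..<pi/2}" for t
    unfolding W_def
    by (rule DERIV_cong[OF DERIV_diff[OF DERIV_mult[OF du[OF t] v] DERIV_mult[OF u'(1)[OF t] dv[OF t]]]])
      (use vpos[OF t] in \<open>simp add: algebra_simps power2_eq_square\<close>)
  have dq: "((\<lambda>t. u t / v t) has_real_derivative (1 / (k t * (v t)\<^sup>2)) * W t) (at t)" if t: "t \<in> {0<..<pi/2}" for t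
    by (rule DERIV_cong[OF DERIV_divide[OF u'(1)[OF t] v]])
      (use vpos[OF t] k(1)[OF t] in \<open>simp_all add: W_def field_simps power2_eq_square\<close>)
  obtain K' where K': "\<And>t. t \<in> {0..pi/2} \<Longrightarrow> \<bar>v t\<bar> \<le> K'" "\<And>t. t \<in> {0..pi/2} \<Longrightarrow> \<bar>v' t\<bar> \<le> K'"
  proof -
    have "continuous_on {0..pi/2} v" "continuous_on {0..pi/2} v'"
      using v ang_fun_derivs(2)[OF c] continuous_on_subset[of UNIV v' "{0..pi/2}"]
      by (auto intro!: continuous_at_imp_continuous_on DERIV_isCont simp: v'_def)
    then have "bounded (v ` {0..pi/2})" "bounded (v' ` {0..pi/2})"
      by (auto intro: compact_imp_bounded compact_continuous_image)
    then obtain K1 K2 where "\<forall>t\<in>{0..pi/2}. \<bar>v t\<bar> \<le> K1" "\<forall>t\<in>{0..pi/2}. \<bar>v' t\<bar> \<le> K2"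
      unfolding bounded_iff by auto
    then show ?thesis by (intro that[of "max K1 K2"]) force+
  qed
  have Wle: "norm (W t) \<le> 2 * K * K' * \<bar>k t\<bar>" if t: "t \<in> {0<..<pi/2}" for t
  proof -
    have t': "t \<in> {0..pi/2}" using t by auto
    have K0: "0 \<le> K" "0 \<le> K'" using u'(3)[OF t] K'(1)[OF t'] by auto
    have "\<bar>u' t * v t\<bar> \<le> K * K'" "\<bar>u t * v' t\<bar> \<le> K * K'"
      unfolding abs_mult using u'(3,4)[OF t] K'[OF t'] K0 by (auto intro!: mult_mono)
    then have "\<bar>u' t * v t - u t * v' t\<bar> \<le> 2 * K * K'" by linarith
    then have "\<bar>k t\<bar> * \<bar>u' t * v t - u t * v' t\<bar> \<le> \<bar>k t\<bar> * (2 * K * K')"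
      by (intro mult_left_mono) auto
    then show ?thesis by (simp add: W_def algebra_simps flip: abs_mult)
  qed
  have k0: "((\<lambda>t. 2 * K * K' * \<bar>k t\<bar>) \<longlongrightarrow> 0) (at_left (pi/2))" "((\<lambda>t. 2 * K * K' * \<bar>k t\<bar>) \<longlongrightarrow> 0) (at_right 0)"
    unfolding k_def by (auto intro!: tendsto_eq_intros)
  have lim: "(W \<longlongrightarrow> 0) (at_left (pi/2))" "(W \<longlongrightarrow> 0) (at_right 0)"
    by (rule Lim_null_comparison[OF _ k0(1)], rule eventually_at_leftI[of 0], use Wle in auto)
      (rule Lim_null_comparison[OF _ k0(2)], rule eventually_at_rightI[of 0 "pi/2"], use Wle in auto)
  have "u t / v t = 0" if t: "t \<in> {0<..<pi/2}" for t
  proof (rule sturm_trivial[OF dq dW _ _ lim t])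
    fix t assume t: "t \<in> {0<..<pi/2}"
    show "0 < 1 / (k t * (v t)\<^sup>2)" "0 < k t * (E - E') * (v t)\<^sup>2"
      using k(1)[OF t] vpos[OF t] EE by simp_all
  qed
  then have u0: "u t = 0" if "t \<in> {0<..<pi/2}" for t
    using vpos that by fastforce
  have "u t = 0" if "t \<in> {0..pi/2}" for t
  proof -
    have "closure {0<..<pi/2} = {0..pi/2}" by (rule closure_greaterThanLessThan) simp
    then show ?thesis using continuous_constant_on_closure[of "{0<..<pi/2}" u 0 t] cont u0 that by auto
  qed
  then show False using nz by blast
qed

section \<open>Zeros of solutions of the radial equation\<close>

text \<open>Uniqueness for the Cauchy problem at z, continued down to the singular point. The
  equation degenerates at 0, so the estimate is made on [e, z] for each e > 0 and continuity of w
  gives the value at 0. The conclusion contradicts the normalisation w(0) = 1.\<close>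

lemma double_zero_imp_trivial:
  fixes w w' g :: "real \<Rightarrow> real"
  assumes w: "\<And>x. x \<in> {0..<1} \<Longrightarrow> (w has_real_derivative w' x) (at x)"
    and w': "\<And>x. x \<in> {0..<1} \<Longrightarrow> ((\<lambda>x. x * w' x) has_real_derivative g x * w x) (at x)"
    and g: "continuous_on {0..<1} g"
    and z: "0 < z" "z < 1" "w z = 0" "w' z = 0"
  shows "w 0 = 0"
proof -
  have zero: "w e = 0" if e: "0 < e" "e < z" for e
  proof -
    \<comment> \<open>A Gronwall argument run backwards: F' \<ge> -K F with K a bound for 1/x + |g|,
      hence F exp (K x) is nondecreasing and F(z) = 0 forces F(e) = 0.\<close>
    define F where "F x = (w x)\<^sup>2 + (x * w' x)\<^sup>2" for x
    have "compact ((\<lambda>x. 1 / x + \<bar>g x\<bar>) ` {e..z})"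
      using e z by (intro compact_continuous_image continuous_intros continuous_on_subset[OF g]) auto
    then have "bounded ((\<lambda>x. 1 / x + \<bar>g x\<bar>) ` {e..z})" by (rule compact_imp_bounded)
    then obtain K where K: "\<And>x. x \<in> {e..z} \<Longrightarrow> norm (1 / x + \<bar>g x\<bar>) \<le> K"
      unfolding bounded_iff by blast
    have dF: "(F has_real_derivative 2 * w x * w' x + 2 * (x * w' x) * (g x * w x)) (at x)" if "x \<in> {0..<1}" for x
      unfolding F_def
      by (rule DERIV_cong[OF DERIV_add[OF DERIV_power[OF w[OF that]] DERIV_power[OF w'[OF that]]]]) simp
    have "F e * exp (K * e) \<le> F z * exp (K * z)"
    proof (rule DERIV_nonneg_imp_increasing_open[where f = "\<lambda>x. F x * exp (K * x)"])
      fix x assume x: "e < x" "x < z"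
      define p where "p = x * w' x"
      have x0: "x > 0" "x \<in> {0..<1}" using x e z by auto
      have "\<bar>(1 / x + g x) * (2 * w x * p)\<bar> \<le> K * ((w x)\<^sup>2 + p\<^sup>2)"
        unfolding abs_mult
      proof (rule mult_mono)
        show "\<bar>1 / x + g x\<bar> \<le> K" using K[of x] x x0 abs_triangle_ineq[of "1 / x" "g x"] by simp
        then show "0 \<le> K" by (rule order_trans[OF abs_ge_zero])
        have "0 \<le> (\<bar>w x\<bar> - \<bar>p\<bar>)\<^sup>2" by simp
        then show "\<bar>2\<bar> * \<bar>w x\<bar> * \<bar>p\<bar> \<le> (w x)\<^sup>2 + p\<^sup>2"
          by (simp add: power2_diff)
      qed simp
      then have "0 \<le> (1 / x + g x) * (2 * w x * p) + K * ((w x)\<^sup>2 + p\<^sup>2)" by linarith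
      also have "\<dots> = 2 * w x * w' x + 2 * (x * w' x) * (g x * w x) + K * F x"
        using x0 by (simp add: p_def F_def field_simps)
      finally have "0 \<le> (2 * w x * w' x + 2 * (x * w' x) * (g x * w x) + K * F x) * exp (K * x)" by simp
      moreover have "((\<lambda>x. F x * exp (K * x)) has_real_derivative
         (2 * w x * w' x + 2 * (x * w' x) * (g x * w x) + K * F x) * exp (K * x)) (at x)"
        using dF[OF x0(2)] by (auto intro!: derivative_eq_intros simp: algebra_simps)
      ultimately show "\<exists>y. ((\<lambda>x. F x * exp (K * x)) has_real_derivative y) (at x) \<and> 0 \<le> y" by blast
    next
      show "continuous_on {e..z} (\<lambda>x. F x * exp (K * x))"
        using e z by (auto intro!: continuous_intros continuous_at_imp_continuous_on DERIV_isCont[OF dF])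
    qed (use e in simp)
    moreover have "F z = 0" using z by (simp add: F_def)
    ultimately have "F e \<le> 0" by (simp add: mult_le_0_iff)
    then have "(w e)\<^sup>2 \<le> 0" unfolding F_def by (smt (verit) zero_le_power2)
    then show ?thesis by simp
  qed
  have "isCont w 0" using w[of 0] by (auto intro: DERIV_isCont)
  then have "(w \<longlongrightarrow> w 0) (at_right 0)"
    by (auto simp: isCont_def intro: tendsto_mono[OF at_le])
  moreover have "(w \<longlongrightarrow> 0) (at_right 0)"
    by (rule tendsto_eventually, rule eventually_at_rightI[of 0 z]) (use zero z in auto)
  ultimately show ?thesis by (rule tendsto_unique[rotated]) simp
qed

text \<open>In the variable \<open>ln x\<close> the equation reads \<open>w'' = x g w\<close>; compare with \<open>sin (K ln x)\<close>.\<close>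
lemma oscillation:
  fixes w w' g :: "real \<Rightarrow> real"
  assumes w: "\<And>x. x \<in> {x1..x2} \<Longrightarrow> (w has_real_derivative w' x) (at x)"
    and w': "\<And>x. x \<in> {x1..x2} \<Longrightarrow> ((\<lambda>x. x * w' x) has_real_derivative g x * w x) (at x)"
    and K: "K > 0" "\<And>x. x \<in> {x1..x2} \<Longrightarrow> x * g x \<le> - K\<^sup>2"
    and x: "0 < x1" "x1 \<le> x2" "K * ln (x2 / x1) \<ge> pi"
  shows "\<exists>x\<in>{x1..x2}. w x \<le> 0"
proof (rule ccontr)
  assume "\<not> ?thesis"
  then have wpos: "w x > 0" if "x \<in> {x1..x2}" for x using that by force
  \<comment> \<open>The next zero of sin (K ln (x / x1)) after x1.\<close>
  define x3 where "x3 = x1 * exp (pi / K)"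
  have "exp (pi / K) \<le> exp (ln (x2 / x1))"
    using x(3) K(1) by (simp add: pos_divide_le_eq mult.commute)
  also have "\<dots> = x2 / x1" using x by simp
  finally have le: "x1 * exp (pi / K) \<le> x2"
    unfolding pos_le_divide_eq[OF x(1)] by (simp only: mult.commute)
  then have x3: "x1 < x3" "x3 \<le> x2"
    using x K le by (simp_all add: x3_def)
  define S where "S x = K * ln (x / x1)" for x
  have S: "(S has_real_derivative K / x) (at x)" if "x \<in> {x1..x3}" for x
    unfolding S_def using that x by (auto intro!: derivative_eq_intros simp: field_simps)
  have S3: "S x3 = pi" "S x1 = 0" using x K by (simp_all add: S_def x3_def)
  \<comment> \<open>The Wronskian of w and the sine in the variable ln x. Positivity of w makes it
    nonincreasing, yet it is negative at x1 and positive at x3.\<close>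
  define W where "W x = x * w' x * sin (S x) - w x * (K * cos (S x))" for x
  have dW: "(W has_real_derivative (g x + K\<^sup>2 / x) * w x * sin (S x)) (at x)" if "x \<in> {x1..x3}" for x
  proof -
    have xx: "x \<in> {x1..x2}" "x > 0" using that x3 x by auto
    have ds: "((\<lambda>x. sin (S x)) has_real_derivative cos (S x) * (K / x)) (at x)"
      and dc: "((\<lambda>x. cos (S x)) has_real_derivative - sin (S x) * (K / x)) (at x)"
      by (rule DERIV_chain2[OF DERIV_sin S[OF that]]) (rule DERIV_chain2[OF DERIV_cos S[OF that]])
    show ?thesis
      unfolding W_def
      by (rule DERIV_cong[OF DERIV_diff[OF DERIV_mult[OF w'[OF xx(1)] ds] DERIV_mult[OF w[OF xx(1)] DERIV_cmult[OF dc]]]])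
        (use xx(2) in \<open>simp add: field_simps power2_eq_square\<close>)
  qed
  have "W x3 \<le> W x1"
  proof (rule DERIV_nonpos_imp_decreasing_open[OF less_imp_le[OF x3(1)]])
    fix y assume y: "x1 < y" "y < x3"
    have y': "y \<in> {x1..x2}" "y \<in> {x1..x3}" "y > 0" using y x3 x by auto
    have "S y = K * (ln y - ln x1)" "S x3 = K * (ln x3 - ln x1)" using y' x x3 by (simp_all add: S_def ln_div)
    moreover have "ln x1 < ln y" "ln y < ln x3" using y x y' x3 by simp_all
    ultimately have "0 < S y" "S y < pi" unfolding S3(1)[symmetric] using K by simp_all
    then have "sin (S y) \<ge> 0" by (intro sin_ge_zero) auto
    moreover have "g y + K\<^sup>2 / y \<le> 0" using K(2)[OF y'(1)] y'(3) by (simp add: field_simps)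
    ultimately have "(g y + K\<^sup>2 / y) * w y * sin (S y) \<le> 0"
      using wpos[OF y'(1)] by (simp add: mult_nonpos_nonneg)
    then show "\<exists>z. (W has_real_derivative z) (at y) \<and> z \<le> 0" using dW[OF y'(2)] by blast
  next
    show "continuous_on {x1..x3} W"
      using dW by (auto intro!: continuous_at_imp_continuous_on DERIV_isCont[OF dW])
  qed
  moreover have "W x3 = w x3 * K" "W x1 = - w x1 * K" by (simp_all add: W_def S3)
  moreover have "w x3 * K > 0" "w x1 * K > 0" using wpos K x x3 by simp_all
  ultimately show False by simp
qed

text \<open>Continuation in a parameter: the first parameter at which a zero appears puts it at the right end,
  because an interior zero of a nonnegative function would be a double one.\<close>
lemma first_zero_at_end:
  fixes W :: "real \<Rightarrow> real \<Rightarrow> real"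
  assumes cont: "continuous_on ({0..1} \<times> {0..p}) (\<lambda>(\<sigma>, q). W q \<sigma>)"
    and start: "\<And>\<sigma>. \<sigma> \<in> {0..1} \<Longrightarrow> W 0 \<sigma> > 0"
    and left: "\<And>q. q \<in> {0..p} \<Longrightarrow> W q 0 > 0"
    and diff: "\<And>q \<sigma>. q \<in> {0..p} \<Longrightarrow> 0 < \<sigma> \<Longrightarrow> \<sigma> < 1 \<Longrightarrow> (W q has_real_derivative W' q \<sigma>) (at \<sigma>)"
    and double: "\<And>q \<sigma>. q \<in> {0..p} \<Longrightarrow> 0 < \<sigma> \<Longrightarrow> \<sigma> < 1 \<Longrightarrow> W q \<sigma> = 0 \<Longrightarrow> W' q \<sigma> \<noteq> 0"
    and stop: "\<exists>\<sigma>\<in>{0..1}. W p \<sigma> \<le> 0" and "0 \<le> p"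
  shows "\<exists>q\<in>{0..p}. W q 1 = 0"
proof -
  \<comment> \<open>Compactness of this set provides the least parameter q with a nonpositive value;
    for that q the function is still nonnegative, as a limit from smaller parameters.\<close>
  define Z where "Z = {x \<in> {0..1} \<times> {0..p}. (\<lambda>(\<sigma>, q). W q \<sigma>) x \<le> 0}"
  have cs: "compact ({0..1::real} \<times> {0..p})" by (intro compact_Times compact_Icc)
  have "closed Z"
    unfolding Z_def by (intro continuous_on_closed_Collect_le cont continuous_on_const compact_imp_closed cs)
  then have "compact Z"
    using compact_Int_closed[OF cs, of Z] by (simp add: Z_def Int_absorb1)
  then have "compact (snd ` Z)"
    by (intro compact_continuous_image continuous_intros)
  moreover have "snd ` Z \<noteq> {}"
  proof -
    obtain \<sigma> where "\<sigma> \<in> {0..1}" "W p \<sigma> \<le> 0" using stop by blast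
    then have "(\<sigma>, p) \<in> Z" using \<open>0 \<le> p\<close> by (simp add: Z_def)
    then show ?thesis by blast
  qed
  ultimately obtain q where q: "q \<in> snd ` Z" "\<And>q'. q' \<in> snd ` Z \<Longrightarrow> q \<le> q'"
    using compact_attains_inf[of "snd ` Z"] by blast
  then obtain \<sigma> where \<sigma>: "\<sigma> \<in> {0..1}" "q \<in> {0..p}" "W q \<sigma> \<le> 0" by (auto simp: Z_def)
  have q0: "q > 0" using start[OF \<sigma>(1)] \<sigma> by (cases "q = 0") auto
  have before: "W q' s > 0" if "0 \<le> q'" "q' < q" "s \<in> {0..1}" for q' s
    using q(2)[of q'] that \<sigma>(2) by (force simp: Z_def image_iff)
  have nonneg: "W q s \<ge> 0" if s: "s \<in> {0..1}" for s
  proof -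
    have "continuous_on {0..p} (\<lambda>q. W q s)"
      using continuous_on_compose2[OF cont continuous_on_Pair[OF continuous_on_const[of "{0..p}" s] continuous_on_id]] s
      by (simp add: image_subset_iff)
    then have "((\<lambda>q. W q s) \<longlongrightarrow> W q s) (at q within {0..p})"
      using \<sigma>(2) by (simp add: continuous_on_def)
    then have "((\<lambda>q. W q s) \<longlongrightarrow> W q s) (at q within {0<..<q})"
      by (rule tendsto_within_subset) (use \<sigma>(2) in auto)
    moreover have "at q within {0<..<q} = at_left q"
      using q0 by (intro at_within_nhd[of _ "{0<..}"]) auto
    ultimately have "((\<lambda>q. W q s) \<longlongrightarrow> W q s) (at_left q)" by simp
    then show ?thesis
      by (rule tendsto_lowerbound, intro eventually_at_leftI[of 0])
        (use before[OF _ _ s] q0 in \<open>auto intro: less_imp_le simp: trivial_limit_at_left_real\<close>)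
  qed
  have W0: "W q \<sigma> = 0" using nonneg[OF \<sigma>(1)] \<sigma>(3) by simp
  have "\<sigma> \<noteq> 0" using left[OF \<sigma>(2)] W0 by auto
  have "\<sigma> = 1"
  proof (rule ccontr)
    assume "\<sigma> \<noteq> 1"
    then have s: "0 < \<sigma>" "\<sigma> < 1" using \<sigma>(1) \<open>\<sigma> \<noteq> 0\<close> by auto
    have "W' q \<sigma> = 0"
    proof (rule DERIV_local_min[OF diff[OF \<sigma>(2) s], of "min \<sigma> (1 - \<sigma>)"])
      show "0 < min \<sigma> (1 - \<sigma>)" using s by simp
      show "\<forall>y. \<bar>\<sigma> - y\<bar> < min \<sigma> (1 - \<sigma>) \<longrightarrow> W q \<sigma> \<le> W q y"
        using nonneg unfolding W0 by (auto simp: abs_less_iff)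
    qed
    then show False using double[OF \<sigma>(2) s W0] by simp
  qed
  then show ?thesis using W0 \<sigma>(2) by blast
qed

section \<open>The radial solution\<close>

text \<open>The Taylor coefficients j (j + 1) / 2, j + 1 and 1 belong to x / (1 - x)^3, 1 / (1 -
  x)^2 and 1 / (1 - x). The minus sign is included, so the equation reads (x w')' = g w for the
  series g of \<open>rad_pot\<close>.\<close>

definition rad_pot :: "real \<Rightarrow> real \<Rightarrow> real \<Rightarrow> nat \<Rightarrow> real" where
  "rad_pot A B C j = - (A * (real j * (real j + 1) / 2) + B * (real j + 1) + C) / 4"

definition rad_fps :: "real \<Rightarrow> real \<Rightarrow> real \<Rightarrow> real fps" where
  "rad_fps A B C = Abs_fps (frob (rad_pot A B C))"

lemma rad_pot_bound:
  assumes "\<bar>A\<bar> \<le> M" "\<bar>B\<bar> \<le> M" "\<bar>C\<bar> \<le> M"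
  shows "\<bar>rad_pot A B C j\<bar> \<le> M * (real (Suc j))\<^sup>2"
proof -
  have M: "M \<ge> 0" using assms(1) by linarith
  define X where "X = (real (Suc j))\<^sup>2"
  have X: "real j * (real j + 1) / 2 \<le> X" "real j + 1 \<le> X" "1 \<le> X" "0 \<le> real j * (real j + 1) / 2"
    by (simp_all add: X_def power2_eq_square algebra_simps)
  have "\<bar>A * (real j * (real j + 1) / 2)\<bar> \<le> M * X" "\<bar>B * (real j + 1)\<bar> \<le> M * X" "\<bar>C\<bar> \<le> M * X"
    using mult_mono[OF assms(1) X(1) M X(4)] mult_mono[OF assms(2) X(2) M] mult_mono[OF assms(3) X(3) M]
    by (simp_all add: abs_mult)
  moreover have "0 \<le> M * X" using M by (simp add: X_def)
  ultimately have "\<bar>A * (real j * (real j + 1) / 2) + B * (real j + 1) + C\<bar> \<le> 4 * (M * X)"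
    by linarith
  then show ?thesis by (simp add: rad_pot_def X_def)
qed

lemma rad_pot_bound':
  "\<bar>rad_pot A B C j\<bar> \<le> (\<bar>A\<bar> + \<bar>B\<bar> + \<bar>C\<bar>) * (real (Suc j))\<^sup>2"
  by (rule rad_pot_bound) auto

lemma rad_conv_radius: "fps_conv_radius (rad_fps A B C) \<ge> 1" "fps_conv_radius (Abs_fps (rad_pot A B C)) \<ge> 1"
  unfolding rad_fps_def by (rule frob_conv_radius[OF rad_pot_bound'])+

lemma eval_rad_pot:
  assumes "\<bar>x\<bar> < 1"
  shows "eval_fps (Abs_fps (rad_pot A B C)) x = - (A * x / (1 - x) ^ 3 + B / (1 - x)\<^sup>2 + C / (1 - x)) / 4"
proof -
  let ?F = "Abs_fps (rad_pot A B C)"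
  have r: "ereal \<bar>x\<bar> < fps_conv_radius ?F"
    by (rule less_le_trans[OF _ rad_conv_radius(2)]) (use assms in auto)
  have XF: "ereal \<bar>x\<bar> < fps_conv_radius (fps_X * F)" "eval_fps (fps_X * F) x = x * eval_fps F x"
    if "ereal \<bar>x\<bar> < fps_conv_radius F" for F :: "real fps"
    using that fps_conv_radius_mult[of fps_X F] by (auto simp: eval_fps_mult intro: less_le_trans)
  have cF: "ereal \<bar>x\<bar> < fps_conv_radius (fps_const k * F)" "eval_fps (fps_const k * F) x = k * eval_fps F x"
    if "ereal \<bar>x\<bar> < fps_conv_radius F" for F :: "real fps" and k
    using that fps_conv_radius_mult[of "fps_const k" F] by (auto simp: eval_fps_mult intro: less_le_trans)
  \<comment> \<open>The coefficients are quadratic in j, so their third differences vanish and (1 -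
    x)^3 times the series is a polynomial of degree at most 2; this is that fact solved for the
    series.\<close>
  have id: "?F = fps_const 3 * (fps_X * ?F) + fps_const (- 3) * (fps_X * (fps_X * ?F)) + fps_X * (fps_X * (fps_X * ?F))
     + fps_of_poly [:- (B + C) / 4, - (A - B - 2 * C) / 4, - C / 4:]"
  proof (rule fps_ext)
    fix n
    consider "n = 0" | "n = 1" | "n = 2" | m where "n = Suc (Suc (Suc m))"
      by (metis One_nat_def Suc_1 not0_implies_Suc)
    then show "fps_nth ?F n = fps_nth (fps_const 3 * (fps_X * ?F) + fps_const (- 3) * (fps_X * (fps_X * ?F)) + fps_X * (fps_X * (fps_X * ?F))
     + fps_of_poly [:- (B + C) / 4, - (A - B - 2 * C) / 4, - C / 4:]) n"
      by cases (simp_all add: rad_pot_def field_simps numeral_2_eq_2 coeff_pCons)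
  qed
  define e where "e = eval_fps ?F x"
  have cr: "ereal \<bar>x\<bar> < fps_conv_radius (F + G)" "eval_fps (F + G) x = eval_fps F x + eval_fps G x"
    if "ereal \<bar>x\<bar> < fps_conv_radius F" "ereal \<bar>x\<bar> < fps_conv_radius G" for F G :: "real fps"
    by (rule less_le_trans[OF _ fps_conv_radius_add]) (use that in \<open>simp_all add: eval_fps_add\<close>)
  have "e = 3 * (x * e) + (- 3) * (x * (x * e)) + x * (x * (x * e)) + poly [:- (B + C) / 4, - (A - B - 2 * C) / 4, - C / 4:] x"
    unfolding e_def by (subst id) (simp add: cr XF cF r)
  then have "e * (1 - x) ^ 3 = - (A * x + B * (1 - x) + C * (1 - x)\<^sup>2) / 4"
    by (simp add: field_simps power3_eq_cube power2_eq_square)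
  then have "e = - ((A * x + B * (1 - x) + C * (1 - x)\<^sup>2) / (1 - x) ^ 3) / 4"
    using assms by (simp add: field_simps)
  also have "(A * x + B * (1 - x) + C * (1 - x)\<^sup>2) / (1 - x) ^ 3 = A * x / (1 - x) ^ 3 + B / (1 - x)\<^sup>2 + C / (1 - x)"
    using assms by (simp add: add_divide_distrib power3_eq_cube power2_eq_square)
  finally show ?thesis by (simp add: e_def)
qed

lemma rad_deriv:
  assumes "\<bar>x\<bar> < 1"
  shows "(eval_fps (rad_fps A B C) has_real_derivative eval_fps (fps_deriv (rad_fps A B C)) x) (at x)"
  by (rule has_field_derivative_eval_fps, rule less_le_trans[OF _ rad_conv_radius(1)]) (use assms in auto)

lemma rad_ode:
  assumes "\<bar>x\<bar> < 1"
  shows "((\<lambda>x. x * eval_fps (fps_deriv (rad_fps A B C)) x) has_real_derivative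
    - (A * x / (1 - x) ^ 3 + B / (1 - x)\<^sup>2 + C / (1 - x)) / 4 * eval_fps (rad_fps A B C) x) (at x)"
  using eval_fps_frob_ode[OF rad_pot_bound' assms, of A B C] unfolding eval_rad_pot[OF assms] rad_fps_def .

text \<open>Weierstrass M-test: compactness bounds A, B, C by one M and keeps Z at most some s < 1,
  so \<open>frob\<close> of M (j + 1)^2 at s majorises all the series at once. Each coefficient is
  continuous in the parameter.\<close>

lemma continuous_on_rad:
  fixes A B C Z :: "real \<Rightarrow> real"
  assumes cont: "continuous_on {0..p} A" "continuous_on {0..p} B" "continuous_on {0..p} C" "continuous_on {0..p} Z"
    and Z: "\<And>q. q \<in> {0..p} \<Longrightarrow> 0 \<le> Z q \<and> Z q < 1"
  shows "continuous_on ({0..1} \<times> {0..p}) (\<lambda>(\<sigma>, q). eval_fps (rad_fps (A q) (B q) (C q)) (\<sigma> * Z q))"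
proof (cases "p \<ge> 0")
  case True
  have bnd: "\<exists>M. \<forall>q\<in>{0..p}. \<bar>F q\<bar> \<le> M" if "continuous_on {0..p} F" for F :: "real \<Rightarrow> real"
    using compact_imp_bounded[OF compact_continuous_image[OF that compact_Icc]] unfolding bounded_iff by auto
  obtain MA MB MC where "\<forall>q\<in>{0..p}. \<bar>A q\<bar> \<le> MA" "\<forall>q\<in>{0..p}. \<bar>B q\<bar> \<le> MB" "\<forall>q\<in>{0..p}. \<bar>C q\<bar> \<le> MC"
    using bnd[OF cont(1)] bnd[OF cont(2)] bnd[OF cont(3)] by blast
  then obtain M where M: "\<And>q. q \<in> {0..p} \<Longrightarrow> \<bar>A q\<bar> \<le> M \<and> \<bar>B q\<bar> \<le> M \<and> \<bar>C q\<bar> \<le> M" "M \<ge> 0"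
    using that[of "max 0 (max MA (max MB MC))"] by (auto simp: le_max_iff_disj)
  obtain q0 where q0: "q0 \<in> {0..p}" "\<And>q. q \<in> {0..p} \<Longrightarrow> Z q \<le> Z q0"
    using continuous_attains_sup[OF compact_Icc _ cont(4)] True by auto
  define s where "s = Z q0"
  have s: "0 \<le> s" "s < 1" using Z[OF q0(1)] by (auto simp: s_def)
  define S where "S = {0..1::real} \<times> {0..p}"
  define f where "f k x = (case x of (\<sigma>, q) \<Rightarrow> frob (rad_pot (A q) (B q) (C q)) k * (\<sigma> * Z q) ^ k)" for k and x :: "real \<times> real"
  have "uniform_limit S (\<lambda>n x. \<Sum>k<n. f k x) (\<lambda>x. \<Sum>k. f k x) sequentially"
  proof (rule Weierstrass_m_test)
    show "summable (\<lambda>k. frob (\<lambda>j. M * (real (Suc j))\<^sup>2) k * s ^ k)"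
      by (rule summable_frob_quadratic[OF s M(2)])
    fix k x assume "x \<in> S"
    then obtain \<sigma> q where x: "x = (\<sigma>, q)" "\<sigma> \<in> {0..1}" "q \<in> {0..p}" by (auto simp: S_def)
    have "\<bar>frob (rad_pot (A q) (B q) (C q)) k\<bar> \<le> frob (\<lambda>j. M * (real (Suc j))\<^sup>2) k"
      using M(1)[OF x(3)] by (intro frob_mono rad_pot_bound) auto
    moreover have "\<bar>\<sigma> * Z q\<bar> ^ k \<le> s ^ k"
    proof (rule power_mono)
      have "\<sigma> * Z q \<le> 1 * s" using x Z[OF x(3)] q0(2)[OF x(3)] by (intro mult_mono) (auto simp: s_def)
      then show "\<bar>\<sigma> * Z q\<bar> \<le> s" using x Z[OF x(3)] by (simp add: abs_mult)
    qed simp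
    ultimately show "norm (f k x) \<le> frob (\<lambda>j. M * (real (Suc j))\<^sup>2) k * s ^ k"
      using frob_nonneg[of "\<lambda>j. M * (real (Suc j))\<^sup>2" k] M(2)
      by (auto simp: f_def x(1) abs_mult power_abs intro!: mult_mono)
  qed
  moreover have "continuous_on S (\<lambda>x. \<Sum>k<n. f k x)" for n
  proof (rule continuous_on_sum)
    fix k
    have snd: "continuous_on S (\<lambda>x. F (snd x))" if "continuous_on {0..p} F" for F :: "real \<Rightarrow> real"
      by (rule continuous_on_compose2[OF that]) (auto simp: S_def intro!: continuous_intros)
    have fr: "continuous_on S (\<lambda>x. frob (rad_pot (A (snd x)) (B (snd x)) (C (snd x))) k)"
      unfolding rad_pot_def by (intro continuous_on_frob continuous_intros snd cont) auto
    have "continuous_on S (\<lambda>x. frob (rad_pot (A (snd x)) (B (snd x)) (C (snd x))) k * (fst x * Z (snd x)) ^ k)"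
      by (intro continuous_on_mult[OF fr] continuous_on_power continuous_on_mult continuous_on_fst continuous_on_id snd cont)
    then show "continuous_on S (f k)"
      by (simp add: f_def[abs_def] case_prod_beta)
  qed
  ultimately have "continuous_on S (\<lambda>x. \<Sum>k. f k x)"
    using trivial_limit_sequentially
    by (intro uniform_limit_theorem) auto
  then show ?thesis
    by (simp add: S_def f_def eval_fps_def rad_fps_def case_prod_beta)
qed simp

section \<open>Positivity and shooting for the radial solution\<close>

lemma rad_at_0: "eval_fps (rad_fps A B C) 0 = 1"
  by (simp add: eval_fps_at_0 rad_fps_def)

text \<open>The sign condition makes every coefficient of the potential nonnegative, and then those
  of the solution as well. It describes zero frequency, where no zero can occur.\<close>

lemma rad_pos:
  assumes "\<And>j. A * (real j * (real j + 1) / 2) + B * (real j + 1) + C \<le> 0" "0 \<le> x" "x < 1"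
  shows "eval_fps (rad_fps A B C) x > 0"
proof -
  have nn: "frob (rad_pot A B C) k \<ge> 0" for k
  proof (rule frob_nonneg)
    show "rad_pot A B C j \<ge> 0" for j using assms(1)[of j] by (simp add: rad_pot_def)
  qed
  have "ereal (norm x) < fps_conv_radius (rad_fps A B C)"
    by (rule less_le_trans[OF _ rad_conv_radius(1)]) (use assms in auto)
  from summable_fps[OF this] have "summable (\<lambda>k. frob (rad_pot A B C) k * x ^ k)"
    by (simp add: rad_fps_def)
  then have "(\<Sum>k\<in>{0}. frob (rad_pot A B C) k * x ^ k) \<le> (\<Sum>k. frob (rad_pot A B C) k * x ^ k)"
    using assms(2) nn by (intro sum_le_suminf) auto
  then show ?thesis by (simp add: eval_fps_def rad_fps_def)
qed

text \<open>The right end Z q moves with the parameter, as the boundary does with \<mu>. Writing x =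
  \<sigma> Z(q) puts all parameters on the fixed interval [0, 1], where
  \<open>first_zero_at_end\<close> applies.\<close>

lemma rad_shooting:
  fixes A B C Z :: "real \<Rightarrow> real"
  assumes p: "p \<ge> 0"
    and cont: "continuous_on {0..p} A" "continuous_on {0..p} B" "continuous_on {0..p} C" "continuous_on {0..p} Z"
    and Z: "\<And>q. q \<in> {0..p} \<Longrightarrow> 0 < Z q \<and> Z q < 1"
    and start: "\<And>j. A 0 * (real j * (real j + 1) / 2) + B 0 * (real j + 1) + C 0 \<le> 0"
    and stop: "K > 0" "0 < x1" "x1 \<le> Z p" "K * ln (Z p / x1) \<ge> pi"
      "\<And>x. x \<in> {x1..Z p} \<Longrightarrow> K\<^sup>2 \<le> x * (A p * x / (1 - x) ^ 3 + B p / (1 - x)\<^sup>2 + C p / (1 - x)) / 4"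
  shows "\<exists>q\<in>{0..p}. eval_fps (rad_fps (A q) (B q) (C q)) (Z q) = 0"
proof -
  let ?w = "\<lambda>q. eval_fps (rad_fps (A q) (B q) (C q))"
  let ?w' = "\<lambda>q. eval_fps (fps_deriv (rad_fps (A q) (B q) (C q)))"
  let ?g = "\<lambda>q x. - (A q * x / (1 - x) ^ 3 + B q / (1 - x)\<^sup>2 + C q / (1 - x)) / 4"
  have inner: "0 \<le> \<sigma> * Z q" "\<sigma> * Z q < 1" if "\<sigma> \<in> {0..1}" "q \<in> {0..p}" for \<sigma> q
  proof -
    have "\<sigma> * Z q \<le> 1 * Z q" using Z[OF that(2)] that(1) by (intro mult_right_mono) auto
    then show "\<sigma> * Z q < 1" using Z[OF that(2)] by linarith
    show "0 \<le> \<sigma> * Z q" using Z[OF that(2)] that(1) by simp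
  qed
  have "\<exists>q\<in>{0..p}. ?w q (1 * Z q) = 0"
  proof (rule first_zero_at_end[where W = "\<lambda>q \<sigma>. ?w q (\<sigma> * Z q)" and W' = "\<lambda>q \<sigma>. ?w' q (\<sigma> * Z q) * Z q"])
    show "continuous_on ({0..1} \<times> {0..p}) (\<lambda>(\<sigma>, q). ?w q (\<sigma> * Z q))"
      using Z by (intro continuous_on_rad cont) (auto intro: less_imp_le)
    show "?w 0 (\<sigma> * Z 0) > 0" if "\<sigma> \<in> {0..1}" for \<sigma>
      using inner[OF that, of 0] p by (intro rad_pos start) auto
    show "?w q (0 * Z q) > 0" for q by (simp add: rad_at_0)
    show "((\<lambda>\<sigma>. ?w q (\<sigma> * Z q)) has_real_derivative ?w' q (\<sigma> * Z q) * Z q) (at \<sigma>)"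
      if "q \<in> {0..p}" "0 < \<sigma>" "\<sigma> < 1" for q \<sigma>
    proof (rule DERIV_chain2[where f = "?w q" and g = "\<lambda>\<sigma>. \<sigma> * Z q"])
      show "(?w q has_real_derivative ?w' q (\<sigma> * Z q)) (at (\<sigma> * Z q))"
        using inner[of \<sigma> q] that by (intro rad_deriv) auto
      show "((\<lambda>\<sigma>. \<sigma> * Z q) has_real_derivative Z q) (at \<sigma>)" by (auto intro!: derivative_eq_intros)
    qed
    show "?w' q (\<sigma> * Z q) * Z q \<noteq> 0" if "q \<in> {0..p}" "0 < \<sigma>" "\<sigma> < 1" "?w q (\<sigma> * Z q) = 0" for q \<sigma>
    proof
      assume "?w' q (\<sigma> * Z q) * Z q = 0"
      then have "?w' q (\<sigma> * Z q) = 0" using Z[OF that(1)] by auto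
      moreover have "0 < \<sigma> * Z q" "\<sigma> * Z q < 1" using inner[of \<sigma> q] that Z[OF that(1)] by auto
      moreover have "continuous_on {0..<1} (?g q)" by (intro continuous_intros) auto
      ultimately have "?w q 0 = 0"
        using that(4) by (intro double_zero_imp_trivial[of "?w q" "?w' q" "?g q" "\<sigma> * Z q"] rad_deriv rad_ode) auto
      then show False by (simp add: rad_at_0)
    qed
    have "\<exists>x\<in>{x1..Z p}. ?w p x \<le> 0"
    proof (rule oscillation[where g = "?g p" and w' = "?w' p" and K = K])
      fix x assume x: "x \<in> {x1..Z p}"
      have "\<bar>x\<bar> < 1" using x stop(2) Z[of p] p by auto
      then show "(?w p has_real_derivative ?w' p x) (at x)"
        "((\<lambda>x. x * ?w' p x) has_real_derivative ?g p x * ?w p x) (at x)"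
        by (rule rad_deriv, rule rad_ode)
      show "x * ?g p x \<le> - K\<^sup>2" using stop(5)[OF x] by (simp add: algebra_simps)
    qed (use stop in auto)
    then obtain x where x: "x \<in> {x1..Z p}" "?w p x \<le> 0" by blast
    show "\<exists>\<sigma>\<in>{0..1}. ?w p (\<sigma> * Z p) \<le> 0"
      using x stop(2) Z[of p] p by (intro bexI[of _ "x / Z p"]) auto
  qed (rule p)
  then show ?thesis by simp
qed

section \<open>The wave operator on separated functions\<close>

lemma UNIV_coord: "(UNIV :: coord set) = {Tc, Rc, Thc, Phc, Psc, Zc}"
  using coord.exhaust by blast

lemma sum_coord: "(\<Sum>i\<in>UNIV. F i) = F Tc + F Rc + F Thc + F Phc + F Psc + F Zc"
  for F :: "coord \<Rightarrow> 'a::comm_monoid_add"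
  by (simp add: UNIV_coord add_ac)

lemma prod_coord: "(\<Prod>i\<in>UNIV. F i) = F Tc * F Rc * F Thc * F Phc * F Psc * F Zc"
  for F :: "coord \<Rightarrow> 'a::comm_monoid_mult"
  by (simp add: UNIV_coord mult_ac)

lemma all_coord: "(\<forall>i::coord. P i) \<longleftrightarrow> P Tc \<and> P Rc \<and> P Thc \<and> P Phc \<and> P Psc \<and> P Zc"
  by (metis coord.exhaust)

text \<open>The metric couples only t with \<phi> and z with \<psi>. The two off-diagonal entries of
  each block are kept separate so that row operations stay within this family.\<close>

definition blk :: "real \<Rightarrow> real \<Rightarrow> real \<Rightarrow> real \<Rightarrow> real \<Rightarrow> real \<Rightarrow> real \<Rightarrow> real \<Rightarrow> real \<Rightarrow> real \<Rightarrow> real ^ coord ^ coord" where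
  "blk tt t\<phi> \<phi>t \<phi>\<phi> zz z\<psi> \<psi>z \<psi>\<psi> rr \<theta>\<theta> = (\<chi> i j. case (i, j) of
      (Tc, Tc) \<Rightarrow> tt | (Tc, Phc) \<Rightarrow> t\<phi> | (Phc, Tc) \<Rightarrow> \<phi>t | (Phc, Phc) \<Rightarrow> \<phi>\<phi>
    | (Zc, Zc) \<Rightarrow> zz | (Zc, Psc) \<Rightarrow> z\<psi> | (Psc, Zc) \<Rightarrow> \<psi>z | (Psc, Psc) \<Rightarrow> \<psi>\<psi>
    | (Rc, Rc) \<Rightarrow> rr | (Thc, Thc) \<Rightarrow> \<theta>\<theta> | _ \<Rightarrow> 0)"

lemma blk_nth:
  "blk tt t\<phi> \<phi>t \<phi>\<phi> zz z\<psi> \<psi>z \<psi>\<psi> rr \<theta>\<theta> $ i $ j = (case (i, j) of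
      (Tc, Tc) \<Rightarrow> tt | (Tc, Phc) \<Rightarrow> t\<phi> | (Phc, Tc) \<Rightarrow> \<phi>t | (Phc, Phc) \<Rightarrow> \<phi>\<phi>
    | (Zc, Zc) \<Rightarrow> zz | (Zc, Psc) \<Rightarrow> z\<psi> | (Psc, Zc) \<Rightarrow> \<psi>z | (Psc, Psc) \<Rightarrow> \<psi>\<psi>
    | (Rc, Rc) \<Rightarrow> rr | (Thc, Thc) \<Rightarrow> \<theta>\<theta> | _ \<Rightarrow> 0)"
  by (simp add: blk_def)

section \<open>Determinant and inverse of a block matrix\<close>

lemma det_blk_row_t: "det (blk tt t\<phi> \<phi>t \<phi>\<phi> zz z\<psi> \<psi>z \<psi>\<psi> rr \<theta>\<theta>) =
    det (blk (tt + k * \<phi>t) (t\<phi> + k * \<phi>\<phi>) \<phi>t \<phi>\<phi> zz z\<psi> \<psi>z \<psi>\<psi> rr \<theta>\<theta>)"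
  by (subst det_row_operation[of Tc Phc _ k, symmetric])
    (auto intro!: arg_cong[where f = det] simp: vec_eq_iff all_coord row_def blk_nth)

lemma det_blk_row_\<phi>: "det (blk tt t\<phi> \<phi>t \<phi>\<phi> zz z\<psi> \<psi>z \<psi>\<psi> rr \<theta>\<theta>) =
    det (blk tt t\<phi> (\<phi>t + k * tt) (\<phi>\<phi> + k * t\<phi>) zz z\<psi> \<psi>z \<psi>\<psi> rr \<theta>\<theta>)"
  by (subst det_row_operation[of Phc Tc _ k, symmetric])
    (auto intro!: arg_cong[where f = det] simp: vec_eq_iff all_coord row_def blk_nth)

lemma det_blk_row_z: "det (blk tt t\<phi> \<phi>t \<phi>\<phi> zz z\<psi> \<psi>z \<psi>\<psi> rr \<theta>\<theta>) =
    det (blk tt t\<phi> \<phi>t \<phi>\<phi> (zz + k * \<psi>z) (z\<psi> + k * \<psi>\<psi>) \<psi>z \<psi>\<psi> rr \<theta>\<theta>)"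
  by (subst det_row_operation[of Zc Psc _ k, symmetric])
    (auto intro!: arg_cong[where f = det] simp: vec_eq_iff all_coord row_def blk_nth)

lemma det_blk_row_\<psi>: "det (blk tt t\<phi> \<phi>t \<phi>\<phi> zz z\<psi> \<psi>z \<psi>\<psi> rr \<theta>\<theta>) =
    det (blk tt t\<phi> \<phi>t \<phi>\<phi> zz z\<psi> (\<psi>z + k * zz) (\<psi>\<psi> + k * z\<psi>) rr \<theta>\<theta>)"
  by (subst det_row_operation[of Psc Zc _ k, symmetric])
    (auto intro!: arg_cong[where f = det] simp: vec_eq_iff all_coord row_def blk_nth)

lemma det_blk_diag: "det (blk tt 0 0 \<phi>\<phi> zz 0 0 \<psi>\<psi> rr \<theta>\<theta>) = tt * \<phi>\<phi> * zz * \<psi>\<psi> * rr * \<theta>\<theta>"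
proof -
  have "blk tt 0 0 \<phi>\<phi> zz 0 0 \<psi>\<psi> rr \<theta>\<theta> $ i $ j = 0" if "i \<noteq> j" for i j
    using that by (cases i; cases j) (simp_all add: blk_nth)
  then show ?thesis
    by (subst det_diagonal) (simp_all add: prod_coord blk_nth)
qed

text \<open>Elimination within each block reduces to a diagonal matrix. The pivots are
  \<open>tt\<close>, \<open>zz\<close> and the two Schur complements, which the assumptions make
  nonzero.\<close>

lemma det_blk:
  assumes "tt \<noteq> 0" "zz \<noteq> 0" "tt * \<phi>\<phi> - t\<phi> * \<phi>t \<noteq> 0" "zz * \<psi>\<psi> - z\<psi> * \<psi>z \<noteq> 0"
  shows "det (blk tt t\<phi> \<phi>t \<phi>\<phi> zz z\<psi> \<psi>z \<psi>\<psi> rr \<theta>\<theta>) = (tt * \<phi>\<phi> - t\<phi> * \<phi>t) * (zz * \<psi>\<psi> - z\<psi> * \<psi>z) * rr * \<theta>\<theta>"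
proof -
  define \<phi>\<phi>' where "\<phi>\<phi>' = \<phi>\<phi> - \<phi>t / tt * t\<phi>"
  define \<psi>\<psi>' where "\<psi>\<psi>' = \<psi>\<psi> - \<psi>z / zz * z\<psi>"
  have e: "tt * \<phi>\<phi>' = tt * \<phi>\<phi> - t\<phi> * \<phi>t" "zz * \<psi>\<psi>' = zz * \<psi>\<psi> - z\<psi> * \<psi>z"
    using assms(1,2) by (simp_all add: \<phi>\<phi>'_def \<psi>\<psi>'_def field_simps)
  have nz: "\<phi>\<phi>' \<noteq> 0" "\<psi>\<psi>' \<noteq> 0" using e assms by auto
  have "det (blk tt t\<phi> \<phi>t \<phi>\<phi> zz z\<psi> \<psi>z \<psi>\<psi> rr \<theta>\<theta>) = det (blk tt t\<phi> 0 \<phi>\<phi>' zz z\<psi> 0 \<psi>\<psi>' rr \<theta>\<theta>)"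
    by (subst det_blk_row_\<phi>[of _ _ _ _ _ _ _ _ _ _ "- \<phi>t / tt"], subst det_blk_row_\<psi>[of _ _ _ _ _ _ _ _ _ _ "- \<psi>z / zz"])
      (use assms in \<open>simp add: \<phi>\<phi>'_def \<psi>\<psi>'_def\<close>)
  also have "\<dots> = det (blk tt 0 0 \<phi>\<phi>' zz 0 0 \<psi>\<psi>' rr \<theta>\<theta>)"
    by (subst det_blk_row_t[of _ _ _ _ _ _ _ _ _ _ "- t\<phi> / \<phi>\<phi>'"], subst det_blk_row_z[of _ _ _ _ _ _ _ _ _ _ "- z\<psi> / \<psi>\<psi>'"])
      (use nz in simp)
  also have "\<dots> = (tt * \<phi>\<phi>') * (zz * \<psi>\<psi>') * rr * \<theta>\<theta>"
    by (simp add: det_blk_diag)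
  finally show ?thesis unfolding e .
qed

lemma matrix_inv_eqI:
  fixes A B :: "real ^ 'n ^ 'n"
  assumes "A ** B = mat 1"
  shows "matrix_inv A = B"
proof -
  have BA: "B ** A = mat 1" using assms matrix_left_right_inverse by blast
  have inv: "A ** matrix_inv A = mat 1 \<and> matrix_inv A ** A = mat 1"
    unfolding matrix_inv_def by (rule someI[of _ B]) (use assms BA in blast)
  have "matrix_inv A = B ** (A ** matrix_inv A)"
    by (simp add: matrix_mul_assoc BA)
  also have "\<dots> = B" using inv by simp
  finally show ?thesis .
qed

lemma matrix_inv_blk:
  assumes D: "D = tt * \<phi>\<phi> - t\<phi> * \<phi>t" "D \<noteq> 0" "D' = zz * \<psi>\<psi> - z\<psi> * \<psi>z" "D' \<noteq> 0" "rr \<noteq> 0" "\<theta>\<theta> \<noteq> 0"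
  shows "matrix_inv (blk tt t\<phi> \<phi>t \<phi>\<phi> zz z\<psi> \<psi>z \<psi>\<psi> rr \<theta>\<theta>) =
    blk (\<phi>\<phi> / D) (- t\<phi> / D) (- \<phi>t / D) (tt / D) (\<psi>\<psi> / D') (- z\<psi> / D') (- \<psi>z / D') (zz / D') (1 / rr) (1 / \<theta>\<theta>)"
proof (rule matrix_inv_eqI)
  have eq: "tt * \<phi>\<phi> / D - t\<phi> * \<phi>t / D = 1" "zz * \<psi>\<psi> / D' - z\<psi> * \<psi>z / D' = 1"
    using D by (simp_all flip: diff_divide_distrib)
  show "blk tt t\<phi> \<phi>t \<phi>\<phi> zz z\<psi> \<psi>z \<psi>\<psi> rr \<theta>\<theta> **
    blk (\<phi>\<phi> / D) (- t\<phi> / D) (- \<phi>t / D) (tt / D) (\<psi>\<psi> / D') (- z\<psi> / D') (- \<psi>z / D') (zz / D') (1 / rr) (1 / \<theta>\<theta>) = mat 1"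
    unfolding vec_eq_iff all_coord
    using eq D(5,6) by (simp add: matrix_matrix_mult_def mat_def sum_coord blk_nth algebra_simps)
qed

lemma pdI:
  assumes "open S" "x \<in> S" "\<And>y. y \<in> S \<Longrightarrow> F y = G y"
    "((\<lambda>s. G (x + s *\<^sub>R axis i 1)) has_vector_derivative d) (at 0)"
  shows "pd i F x = d"
proof -
  have "continuous_on UNIV (\<lambda>s::real. x + s *\<^sub>R axis i 1)"
    by (intro continuous_intros)
  then have T: "open ((\<lambda>s::real. x + s *\<^sub>R axis i 1) -` S)"
    using assms(1) by (simp add: open_vimage continuous_on_eq_continuous_at)
  have "((\<lambda>s. F (x + s *\<^sub>R axis i 1)) has_vector_derivative d) (at 0)"
    by (rule has_vector_derivative_transform_within_open[OF assms(4) T]) (use assms(2,3) in auto)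
  then show ?thesis unfolding pd_def by (rule vector_derivative_at)
qed

lemma open_ms_interior: "open (ms_interior \<rho>)"
  unfolding ms_interior_def
  by (intro open_Collect_conj open_Collect_less continuous_intros)

section \<open>The inverse metric and separation of variables\<close>

context
  fixes Q1 Q2 Rz :: real
  assumes Q: "Q1 > 0" "Q2 > 0" "Rz > 0"
begin

definition "ms_blk x = (let a = ms_a Q1 Q2 Rz; f = ms_f Q1 Q2 Rz x; h = ms_h Q1 Q2 Rz x; r = x $ Rc;
          C = (cos (x $ Thc))\<^sup>2; S = (sin (x $ Thc))\<^sup>2 in
     blk (- (1 / h)) (- (a * sqrt (Q1 * Q2) / (h * f)) * S) (- (a * sqrt (Q1 * Q2) / (h * f)) * S)
       (h * (r\<^sup>2 + a\<^sup>2 - a\<^sup>2 * Q1 * Q2 * S / (h\<^sup>2 * f\<^sup>2)) * S)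
       (1 / h) (- (a * sqrt (Q1 * Q2) / (h * f)) * C) (- (a * sqrt (Q1 * Q2) / (h * f)) * C)
       (h * (r\<^sup>2 + a\<^sup>2 * Q1 * Q2 * C / (h\<^sup>2 * f\<^sup>2)) * C) (h * f / (r\<^sup>2 + a\<^sup>2)) (h * f))"

lemma ms_metric_eq_blk: "ms_metric Q1 Q2 Rz x = ms_blk x"
  unfolding ms_metric_def ms_blk_def Let_def vec_eq_iff all_coord by (simp add: blk_nth)

text \<open>The terms with a^2 Q1 Q2 in the \<phi>\<phi> and \<psi>\<psi> entries cancel the squares
  of the off-diagonal entries, so the block determinants -(r^2 + a^2) sin^2 \<theta> and r^2 cos^2
  \<theta> are free of h. The inverse is written with a common factor 1 / (h f), which the volume
  density will cancel. Its z, \<psi> block is left implicit because the modes depend on neither z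
  nor \<psi>.\<close>

lemma ms_metric_inverse:
  fixes x :: "real ^ coord"
  defines "a \<equiv> ms_a Q1 Q2 Rz" and "f \<equiv> ms_f Q1 Q2 Rz x" and "h \<equiv> ms_h Q1 Q2 Rz x" and "r \<equiv> x $ Rc"
    and "c \<equiv> cos (x $ Thc)" and "s \<equiv> sin (x $ Thc)"
  assumes x: "x \<in> ms_interior \<rho>"
  shows "sqrt \<bar>det (ms_metric Q1 Q2 Rz x)\<bar> = h * f * r * s * c"
    and "h * f * r * s * c > 0"
    and "matrix_inv (ms_metric Q1 Q2 Rz x) = 
      blk (- (f * h\<^sup>2 - a\<^sup>2 * Q1 * Q2 * s\<^sup>2 / (f * (r\<^sup>2 + a\<^sup>2))) / (h * f))
        (- (a * sqrt (Q1 * Q2) / (r\<^sup>2 + a\<^sup>2)) / (h * f)) (- (a * sqrt (Q1 * Q2) / (r\<^sup>2 + a\<^sup>2)) / (h * f))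
        (f / ((r\<^sup>2 + a\<^sup>2) * s\<^sup>2) / (h * f))
        (matrix_inv (ms_metric Q1 Q2 Rz x) $ Zc $ Zc) (matrix_inv (ms_metric Q1 Q2 Rz x) $ Zc $ Psc)
        (matrix_inv (ms_metric Q1 Q2 Rz x) $ Psc $ Zc) (matrix_inv (ms_metric Q1 Q2 Rz x) $ Psc $ Psc)
        ((r\<^sup>2 + a\<^sup>2) / (h * f)) (1 / (h * f))"
    and "f * h\<^sup>2 = f + Q1 + Q2 + Q1 * Q2 / f"
    and "f > 0"
proof -
  have r: "r > 0" and s: "s > 0" and c: "c > 0"
    using x by (auto simp: ms_interior_def r_def s_def c_def intro!: sin_gt_zero cos_gt_zero_pi)
  have f: "f > 0" using r unfolding f_def ms_f_def r_def by (simp add: add_pos_nonneg)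
  have h: "h > 0" using f Q unfolding h_def ms_h_def f_def by (simp add: add_pos_pos)
  have hsq: "h\<^sup>2 = (1 + Q1 / f) * (1 + Q2 / f)"
    using f Q unfolding h_def ms_h_def f_def by (simp add: add_nonneg_nonneg)
  have A: "r\<^sup>2 + a\<^sup>2 > 0" using r by (simp add: add_pos_nonneg)
  define q where "q = sqrt (Q1 * Q2)"
  have q: "q\<^sup>2 = Q1 * Q2" using Q by (simp add: q_def)
  let ?tp = "- (a * q / (h * f)) * s\<^sup>2" and ?zp = "- (a * q / (h * f)) * c\<^sup>2"
  let ?pp = "h * (r\<^sup>2 + a\<^sup>2 - a\<^sup>2 * Q1 * Q2 * s\<^sup>2 / (h\<^sup>2 * f\<^sup>2)) * s\<^sup>2"
  let ?ss = "h * (r\<^sup>2 + a\<^sup>2 * Q1 * Q2 * c\<^sup>2 / (h\<^sup>2 * f\<^sup>2)) * c\<^sup>2"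
  have m: "ms_metric Q1 Q2 Rz x = blk (- (1 / h)) ?tp ?tp ?pp (1 / h) ?zp ?zp ?ss (h * f / (r\<^sup>2 + a\<^sup>2)) (h * f)"
    unfolding ms_metric_eq_blk ms_blk_def Let_def a_def f_def h_def r_def c_def s_def q_def ..
  have "?tp * ?tp = q\<^sup>2 * a\<^sup>2 * s ^ 4 / (h\<^sup>2 * f\<^sup>2)" "?zp * ?zp = q\<^sup>2 * a\<^sup>2 * c ^ 4 / (h\<^sup>2 * f\<^sup>2)"
    by (simp_all add: power2_eq_square power4_eq_xxxx mult_ac)
  moreover have "- (1 / h) * ?pp = - ((r\<^sup>2 + a\<^sup>2) * s\<^sup>2) + q\<^sup>2 * a\<^sup>2 * s ^ 4 / (h\<^sup>2 * f\<^sup>2)"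
    "(1 / h) * ?ss = r\<^sup>2 * c\<^sup>2 + q\<^sup>2 * a\<^sup>2 * c ^ 4 / (h\<^sup>2 * f\<^sup>2)"
    using h unfolding q by (simp_all add: algebra_simps power2_eq_square power4_eq_xxxx)
  ultimately have D: "- (1 / h) * ?pp - ?tp * ?tp = - ((r\<^sup>2 + a\<^sup>2) * s\<^sup>2)"
    "(1 / h) * ?ss - ?zp * ?zp = r\<^sup>2 * c\<^sup>2" by simp_all
  have D0: "- ((r\<^sup>2 + a\<^sup>2) * s\<^sup>2) \<noteq> 0" "r\<^sup>2 * c\<^sup>2 \<noteq> 0" using A r s c by auto
  show pos: "h * f * r * s * c > 0" using h f r s c by simp
  have "det (ms_metric Q1 Q2 Rz x) = - ((r\<^sup>2 + a\<^sup>2) * s\<^sup>2) * (r\<^sup>2 * c\<^sup>2) * (h * f / (r\<^sup>2 + a\<^sup>2)) * (h * f)"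
    unfolding m by (subst det_blk) (use h D D0 in simp_all)
  also have "\<dots> = - (h * f * r * s * c)\<^sup>2"
  proof -
    define B where "B = r\<^sup>2 + a\<^sup>2"
    have "B > 0" using A by (simp add: B_def)
    then show ?thesis unfolding B_def[symmetric] by (simp add: power2_eq_square mult_ac)
  qed
  finally show "sqrt \<bar>det (ms_metric Q1 Q2 Rz x)\<bar> = h * f * r * s * c"
    using pos by simp
  have inv: "matrix_inv (ms_metric Q1 Q2 Rz x) =
    blk (?pp / (- ((r\<^sup>2 + a\<^sup>2) * s\<^sup>2))) (- ?tp / (- ((r\<^sup>2 + a\<^sup>2) * s\<^sup>2))) (- ?tp / (- ((r\<^sup>2 + a\<^sup>2) * s\<^sup>2))) (- (1 / h) / (- ((r\<^sup>2 + a\<^sup>2) * s\<^sup>2)))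
      (?ss / (r\<^sup>2 * c\<^sup>2)) (- ?zp / (r\<^sup>2 * c\<^sup>2)) (- ?zp / (r\<^sup>2 * c\<^sup>2)) ((1 / h) / (r\<^sup>2 * c\<^sup>2))
      (1 / (h * f / (r\<^sup>2 + a\<^sup>2))) (1 / (h * f))"
    unfolding m by (rule matrix_inv_blk) (use D D0 h f A in simp_all)
  have e1: "?pp / (- ((r\<^sup>2 + a\<^sup>2) * s\<^sup>2)) = - (f * h\<^sup>2 - a\<^sup>2 * Q1 * Q2 * s\<^sup>2 / (f * (r\<^sup>2 + a\<^sup>2))) / (h * f)"
  proof -
    define B where "B = r\<^sup>2 + a\<^sup>2"
    have "B > 0" using A by (simp add: B_def)
    then show ?thesis unfolding B_def[symmetric] using h f s by (simp add: field_simps power2_eq_square)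
  qed
  have e2: "- ?tp / (- ((r\<^sup>2 + a\<^sup>2) * s\<^sup>2)) = - (a * sqrt (Q1 * Q2) / (r\<^sup>2 + a\<^sup>2)) / (h * f)"
    using h f s A by (simp add: q_def)
  have e3: "- (1 / h) / (- ((r\<^sup>2 + a\<^sup>2) * s\<^sup>2)) = f / ((r\<^sup>2 + a\<^sup>2) * s\<^sup>2) / (h * f)"
    using h f s A by simp
  show "matrix_inv (ms_metric Q1 Q2 Rz x) = 
      blk (- (f * h\<^sup>2 - a\<^sup>2 * Q1 * Q2 * s\<^sup>2 / (f * (r\<^sup>2 + a\<^sup>2))) / (h * f))
        (- (a * sqrt (Q1 * Q2) / (r\<^sup>2 + a\<^sup>2)) / (h * f)) (- (a * sqrt (Q1 * Q2) / (r\<^sup>2 + a\<^sup>2)) / (h * f))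
        (f / ((r\<^sup>2 + a\<^sup>2) * s\<^sup>2) / (h * f))
        (matrix_inv (ms_metric Q1 Q2 Rz x) $ Zc $ Zc) (matrix_inv (ms_metric Q1 Q2 Rz x) $ Zc $ Psc)
        (matrix_inv (ms_metric Q1 Q2 Rz x) $ Psc $ Zc) (matrix_inv (ms_metric Q1 Q2 Rz x) $ Psc $ Psc)
        ((r\<^sup>2 + a\<^sup>2) / (h * f)) (1 / (h * f))"
    unfolding inv e1 e2 e3 by (simp add: blk_nth)
  show "f * h\<^sup>2 = f + Q1 + Q2 + Q1 * Q2 / f"
    unfolding hsq using f by (simp add: field_simps)
  show "f > 0" by (rule f)
qed


text \<open>Separation of variables: E is the separation constant, and the two hypotheses on second
  derivatives are the radial and angular equations in divergence form.\<close>

lemma box_mode_fun: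
  fixes ur ur' u\<theta> u\<theta>' :: "real \<Rightarrow> real" and m :: int
  defines "a \<equiv> ms_a Q1 Q2 Rz"
  assumes r1: "\<And>r. 0 < r \<Longrightarrow> r < \<rho> \<Longrightarrow> (ur has_real_derivative ur' r) (at r)"
    and r2: "\<And>r. 0 < r \<Longrightarrow> r < \<rho> \<Longrightarrow> ((\<lambda>r. r * (r\<^sup>2 + a\<^sup>2) * ur' r) has_real_derivative
       - r * (\<omega>\<^sup>2 * (r\<^sup>2 + Q1 + Q2) + (\<omega> * sqrt (Q1 * Q2) - a * of_int m)\<^sup>2 / (r\<^sup>2 + a\<^sup>2) - E) * ur r) (at r)"
    and t1: "\<And>t. 0 < t \<Longrightarrow> t < pi / 2 \<Longrightarrow> (u\<theta> has_real_derivative u\<theta>' t) (at t)"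
    and t2: "\<And>t. 0 < t \<Longrightarrow> t < pi / 2 \<Longrightarrow> ((\<lambda>t. sin (2 * t) * u\<theta>' t) has_real_derivative
       sin (2 * t) * ((of_int m)\<^sup>2 / (sin t)\<^sup>2 - \<omega>\<^sup>2 * a\<^sup>2 * (cos t)\<^sup>2 - E) * u\<theta> t) (at t)"
    and x: "x \<in> ms_interior \<rho>"
  shows "box (ms_metric Q1 Q2 Rz) (mode_fun \<omega> 0 0 m ur u\<theta>) x = 0"
proof -
  define u where "u = mode_fun \<omega> 0 0 m ur u\<theta>"
  define e where "e y = cis (- \<omega> * y $ Tc + of_int m * y $ Phc)" for y :: "real ^ coord"
  define g where "g = ms_metric Q1 Q2 Rz"
  define J where "J y = sqrt \<bar>det (g y)\<bar>" for y
  define f where "f y = ms_f Q1 Q2 Rz y" for y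
  define q where "q = sqrt (Q1 * Q2)"
  have q: "q\<^sup>2 = Q1 * Q2" using Q by (simp add: q_def)
  have u: "u y = e y * of_real (ur (y $ Rc)) * of_real (u\<theta> (y $ Thc))" for y
    by (simp add: u_def mode_fun_def e_def)
  note int = open_ms_interior[of \<rho>]
  have axis: "(y + s *\<^sub>R axis i 1) $ j = (if i = j then y $ j + s else y $ j)" for y :: "real ^ coord" and s i j
    by (simp add: axis_def)
  have de: "((\<lambda>s. K * e (y + s *\<^sub>R axis i 1)) has_vector_derivative
     K * ((if i = Tc then - \<i> * of_real \<omega> else if i = Phc then \<i> * of_int m else 0) * e y)) (at 0)" for y i K
    unfolding e_def axis cis_conv_exp
    by (rule has_vector_derivative_mult_right, cases i)
      (auto intro!: has_vector_derivative_real_field derivative_eq_intros simp: algebra_simps)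
  have dr: "((\<lambda>s. K * complex_of_real (\<phi> (y $ i + s))) has_vector_derivative K * of_real d) (at 0)"
    if "(\<phi> has_real_derivative d) (at (y $ i))" for \<phi> d and y :: "real ^ coord" and i K
  proof -
    have "((\<lambda>s. \<phi> (y $ i + s)) has_real_derivative d) (at 0)"
      using that DERIV_shift[of \<phi> d "0::real" "y $ i"] by (simp add: add.commute)
    then show ?thesis
      by (intro has_vector_derivative_mult_right has_vector_derivative_of_real)
        (simp add: has_real_derivative_iff_has_vector_derivative)
  qed
  have bd: "0 < y $ Rc" "y $ Rc < \<rho>" "0 < y $ Thc" "y $ Thc < pi / 2" if "y \<in> ms_interior \<rho>" for y
    using that by (auto simp: ms_interior_def)
  define pu where "pu j y = (case j of
      Tc \<Rightarrow> of_real (ur (y $ Rc) * u\<theta> (y $ Thc)) * (- \<i> * of_real \<omega>) * e y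
    | Phc \<Rightarrow> of_real (ur (y $ Rc) * u\<theta> (y $ Thc)) * (\<i> * of_int m) * e y
    | Rc \<Rightarrow> of_real (u\<theta> (y $ Thc)) * of_real (ur' (y $ Rc)) * e y
    | Thc \<Rightarrow> of_real (ur (y $ Rc)) * of_real (u\<theta>' (y $ Thc)) * e y
    | _ \<Rightarrow> 0)" for j and y :: "real ^ coord"
  have pd_u: "pd j u y = pu j y" if y: "y \<in> ms_interior \<rho>" for j y
  proof (rule pdI[OF int y, where G = u])
    show "((\<lambda>s. u (y + s *\<^sub>R axis j 1)) has_vector_derivative pu j y) (at 0)"
    proof (cases j)
      case Rc
      show ?thesis
        using dr[OF r1, of y Rc "of_real (u\<theta> (y $ Thc)) * e y"] bd[OF y]
        by (simp add: Rc u pu_def axis_def e_def mult_ac)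
    next
      case Thc
      show ?thesis
        using dr[OF t1, of y Thc "of_real (ur (y $ Rc)) * e y"] bd[OF y]
        by (simp add: Thc u pu_def axis_def e_def mult_ac)
    qed (use de[of "of_real (ur (y $ Rc) * u\<theta> (y $ Thc))" y j] in \<open>simp_all add: u pu_def axis_def mult_ac\<close>)
  qed simp
  define sc where "sc t = sin t * cos t" for t :: real
  define fr where "fr r t = r\<^sup>2 + a\<^sup>2 * (cos t)\<^sup>2" for r t :: real
  \<comment> \<open>These are the entries of the inverse metric times the volume density; h has
    dropped out.\<close>
  define ktt where "ktt r t = - r * sc t * (fr r t + Q1 + Q2 + Q1 * Q2 / fr r t - a\<^sup>2 * Q1 * Q2 * (sin t)\<^sup>2 / (fr r t * (r\<^sup>2 + a\<^sup>2)))" for r t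
  define ktp where "ktp r t = - r * sc t * (a * q / (r\<^sup>2 + a\<^sup>2))" for r t
  define kpp where "kpp r t = r * sc t * (fr r t / ((r\<^sup>2 + a\<^sup>2) * (sin t)\<^sup>2))" for r t
  define G where "G i y = (case i of
      Tc \<Rightarrow> \<i> * of_real ((- \<omega> * ktt (y $ Rc) (y $ Thc) + of_int m * ktp (y $ Rc) (y $ Thc)) * ur (y $ Rc) * u\<theta> (y $ Thc)) * e y
    | Phc \<Rightarrow> \<i> * of_real ((- \<omega> * ktp (y $ Rc) (y $ Thc) + of_int m * kpp (y $ Rc) (y $ Thc)) * ur (y $ Rc) * u\<theta> (y $ Thc)) * e y
    | Rc \<Rightarrow> of_real (sc (y $ Thc) * u\<theta> (y $ Thc)) * e y * of_real (y $ Rc * ((y $ Rc)\<^sup>2 + a\<^sup>2) * ur' (y $ Rc))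
    | Thc \<Rightarrow> of_real (y $ Rc * ur (y $ Rc) / 2) * e y * of_real (sin (2 * y $ Thc) * u\<theta>' (y $ Thc))
    | _ \<Rightarrow> 0)" for i and y :: "real ^ coord"
  have flux: "(\<Sum>j\<in>UNIV. (J y * matrix_inv (g y) $ i $ j) *\<^sub>R pd j u y) = G i y" if y: "y \<in> ms_interior \<rho>" for i y
  proof -
    define h where "h = ms_h Q1 Q2 Rz y"
    note M = ms_metric_inverse[OF y, folded a_def h_def g_def q_def]
    have f: "ms_f Q1 Q2 Rz y = fr (y $ Rc) (y $ Thc)"
      by (simp add: ms_f_def fr_def a_def)
    define k where "k = h * fr (y $ Rc) (y $ Thc)"
    have Jy: "J y = k * (y $ Rc * sc (y $ Thc))"
      unfolding J_def M(1) f by (simp add: sc_def k_def)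
    have kp: "k \<noteq> 0" using M(2) unfolding f k_def by auto
    have *: "J y * (X / k) = y $ Rc * sc (y $ Thc) * X" for X
      using kp by (simp add: Jy)
    obtain zz zp pz pp where inv: "matrix_inv (g y) = blk
        (- (fr (y $ Rc) (y $ Thc) + Q1 + Q2 + Q1 * Q2 / fr (y $ Rc) (y $ Thc) - a\<^sup>2 * Q1 * Q2 * (sin (y $ Thc))\<^sup>2 / (fr (y $ Rc) (y $ Thc) * ((y $ Rc)\<^sup>2 + a\<^sup>2))) / k)
        (- (a * q / ((y $ Rc)\<^sup>2 + a\<^sup>2)) / k) (- (a * q / ((y $ Rc)\<^sup>2 + a\<^sup>2)) / k)
        (fr (y $ Rc) (y $ Thc) / (((y $ Rc)\<^sup>2 + a\<^sup>2) * (sin (y $ Thc))\<^sup>2) / k)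
        zz zp pz pp (((y $ Rc)\<^sup>2 + a\<^sup>2) / k) (1 / k)"
      using M(3) unfolding M(4) unfolding f k_def by metis
    have A: "J y * matrix_inv (g y) $ Tc $ Tc = ktt (y $ Rc) (y $ Thc)"
      "J y * matrix_inv (g y) $ Tc $ Phc = ktp (y $ Rc) (y $ Thc)"
      "J y * matrix_inv (g y) $ Phc $ Tc = ktp (y $ Rc) (y $ Thc)"
      "J y * matrix_inv (g y) $ Phc $ Phc = kpp (y $ Rc) (y $ Thc)"
      "J y * matrix_inv (g y) $ Rc $ Rc = y $ Rc * sc (y $ Thc) * ((y $ Rc)\<^sup>2 + a\<^sup>2)"
      "J y * matrix_inv (g y) $ Thc $ Thc = y $ Rc * sc (y $ Thc)"
      unfolding inv blk_nth by (simp_all only: prod.case coord.case * ktt_def ktp_def kpp_def)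
    have B: "matrix_inv (g y) $ i $ j = 0" if "i \<noteq> j" "\<not> (i \<in> {Tc, Phc} \<and> j \<in> {Tc, Phc})" "j \<notin> {Zc, Psc}" for i j
      unfolding inv blk_nth using that by (cases i; cases j) simp_all
    have P: "pd Zc u y = 0" "pd Psc u y = 0" by (simp_all add: pd_u[OF y] pu_def)
    have sd: "sin (y $ Thc * 2) = 2 * sin (y $ Thc) * cos (y $ Thc)"
      by (subst mult.commute) (rule sin_double)
    show ?thesis
      by (cases i)
        (simp_all add: sum_coord A B P pd_u[OF y], simp_all add: G_def pu_def sc_def sd sin_double scaleR_conv_of_real algebra_simps)
  qed
  define E1 where "E1 = \<omega>\<^sup>2 * ((x $ Rc)\<^sup>2 + Q1 + Q2) + (\<omega> * q - a * of_int m)\<^sup>2 / ((x $ Rc)\<^sup>2 + a\<^sup>2) - E"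
  define E2 where "E2 = (of_int m)\<^sup>2 / (sin (x $ Thc))\<^sup>2 - \<omega>\<^sup>2 * a\<^sup>2 * (cos (x $ Thc))\<^sup>2 - E"
  \<comment> \<open>Each term of the divergence is a real multiple of u, so the wave equation
    reduces to the vanishing of the sum of these multiples.\<close>
  define dG where "dG i = (case i of
      Tc \<Rightarrow> \<omega> * (- \<omega> * ktt (x $ Rc) (x $ Thc) + of_int m * ktp (x $ Rc) (x $ Thc))
    | Phc \<Rightarrow> - of_int m * (- \<omega> * ktp (x $ Rc) (x $ Thc) + of_int m * kpp (x $ Rc) (x $ Thc))
    | Rc \<Rightarrow> - (x $ Rc) * sc (x $ Thc) * E1
    | Thc \<Rightarrow> x $ Rc * sc (x $ Thc) * E2
    | _ \<Rightarrow> 0)" for i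
  have pdG: "pd i (\<lambda>y. \<Sum>j\<in>UNIV. (J y * matrix_inv (g y) $ i $ j) *\<^sub>R pd j u y) x
     = of_real (dG i * ur (x $ Rc) * u\<theta> (x $ Thc)) * e x" for i
  proof (rule pdI[OF int x flux])
    show "((\<lambda>s. G i (x + s *\<^sub>R axis i 1)) has_vector_derivative of_real (dG i * ur (x $ Rc) * u\<theta> (x $ Thc)) * e x) (at 0)"
    proof (cases i)
      case Rc
      show ?thesis
        using dr[OF r2, of x Rc "of_real (sc (x $ Thc) * u\<theta> (x $ Thc)) * e x"] bd[OF x]
        by (simp add: Rc G_def dG_def E1_def q_def axis_def e_def mult_ac)
    next
      case Thc
      have sd: "sin (x $ Thc * 2) = 2 * sin (x $ Thc) * cos (x $ Thc)"
        by (subst mult.commute) (rule sin_double)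
      show ?thesis
        using dr[OF t2, of x Thc "of_real (x $ Rc * ur (x $ Rc) / 2) * e x"] bd[OF x]
        by (simp add: Thc G_def dG_def E2_def axis_def e_def sd sc_def mult_ac)
    next
      case Tc
      show ?thesis
        using de[of "\<i> * of_real ((- \<omega> * ktt (x $ Rc) (x $ Thc) + of_int m * ktp (x $ Rc) (x $ Thc)) * ur (x $ Rc) * u\<theta> (x $ Thc))" x i]
        by (simp add: Tc G_def dG_def axis_def algebra_simps)
    next
      case Phc
      show ?thesis
        using de[of "\<i> * of_real ((- \<omega> * ktp (x $ Rc) (x $ Thc) + of_int m * kpp (x $ Rc) (x $ Thc)) * ur (x $ Rc) * u\<theta> (x $ Thc))" x i]
        by (simp add: Phc G_def dG_def axis_def algebra_simps)
    qed (simp_all add: G_def dG_def)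
  qed
  have "(\<Sum>i\<in>UNIV. dG i) = 0"
  proof -
    define r S C where "r = x $ Rc" and "S = sin (x $ Thc)" and "C = cos (x $ Thc)"
    define F B where "F = fr r (x $ Thc)" and "B = r\<^sup>2 + a\<^sup>2"
    have r: "r > 0" and S: "S > 0"
      using bd[OF x] by (auto simp: r_def S_def intro!: sin_gt_zero)
    have F: "F > 0" and B: "B > 0" using r by (auto simp: F_def B_def fr_def add_pos_nonneg)
    \<comment> \<open>The two expressions for f behind separability: the first collapses the terms
      with 1/f in the tt entry and splits the \<phi>\<phi> entry, the second splits \<omega>^2 f
      into an r part and a \<theta> part.\<close>
    have FB: "F = B - a\<^sup>2 * S\<^sup>2" by (simp add: F_def B_def fr_def S_def cos_squared_eq algebra_simps)
    have FC: "r\<^sup>2 = F - a\<^sup>2 * C\<^sup>2" by (simp add: F_def fr_def C_def)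
    have i1: "Q1 * Q2 / F - a\<^sup>2 * Q1 * Q2 * S\<^sup>2 / (F * B) = q\<^sup>2 / B"
    proof -
      have "Q1 * Q2 / F - a\<^sup>2 * Q1 * Q2 * S\<^sup>2 / (F * B) = (Q1 * Q2) * (B - a\<^sup>2 * S\<^sup>2) / (F * B)"
        using F B by (simp add: field_simps)
      then show ?thesis unfolding q FB[symmetric] using F by simp
    qed
    have i2: "F / (B * S\<^sup>2) = 1 / S\<^sup>2 - a\<^sup>2 / B"
      unfolding FB using B S by (simp add: field_simps)
    have k: "ktt r (x $ Thc) = - r * sc (x $ Thc) * (F + Q1 + Q2 + q\<^sup>2 / B)"
      "ktp r (x $ Thc) = - r * sc (x $ Thc) * (a * q / B)"
      "kpp r (x $ Thc) = r * sc (x $ Thc) * (1 / S\<^sup>2 - a\<^sup>2 / B)"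
      unfolding ktt_def ktp_def kpp_def F_def[symmetric] B_def[symmetric] S_def[symmetric] i2 i1[symmetric]
      by simp_all
    have "(\<Sum>i\<in>UNIV. dG i) = r * sc (x $ Thc) *
      (\<omega>\<^sup>2 * (F + Q1 + Q2 + q\<^sup>2 / B) - 2 * \<omega> * of_int m * (a * q / B) - (of_int m)\<^sup>2 * (1 / S\<^sup>2 - a\<^sup>2 / B) - E1 + E2)"
      unfolding sum_coord dG_def coord.case r_def[symmetric] k by (simp add: algebra_simps power2_eq_square)
    also have "\<omega>\<^sup>2 * (F + Q1 + Q2 + q\<^sup>2 / B) - 2 * \<omega> * of_int m * (a * q / B) - (of_int m)\<^sup>2 * (1 / S\<^sup>2 - a\<^sup>2 / B) - E1 + E2 = 0"
      unfolding E1_def E2_def r_def[symmetric] B_def[symmetric] S_def[symmetric] C_def[symmetric]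
      unfolding FC using B by (simp add: field_simps power2_eq_square)
    finally show ?thesis by simp
  qed
  then have "(\<Sum>i\<in>UNIV. of_real (dG i * ur (x $ Rc) * u\<theta> (x $ Thc)) * e x) = 0"
    by (simp flip: sum_distrib_right of_real_sum)
  then have "(\<Sum>i\<in>UNIV. pd i (\<lambda>y. \<Sum>j\<in>UNIV. (J y * matrix_inv (g y) $ i $ j) *\<^sub>R pd j u y) x) = 0"
    unfolding pdG .
  then show ?thesis unfolding box_def u_def[symmetric] g_def[symmetric] J_def by simp
qed

end

section \<open>Existence of mode solutions\<close>

definition mode_E :: "nat \<Rightarrow> real \<Rightarrow> real \<Rightarrow> real" where
  "mode_E l a \<omega> = real l * (real l + 2) + ang_shift l (\<omega>\<^sup>2 * a\<^sup>2)"

text \<open>Here Q stands for Q1 + Q2. The last parameter comes from sqrt (Q1 Q2) = a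
  \<open>Rz\<close> and m_\<phi> = -l, which turn the square in the radial equation into a^2
  (\<omega> \<open>Rz\<close> + l)^2.\<close>

definition mode_rad :: "nat \<Rightarrow> real \<Rightarrow> real \<Rightarrow> real \<Rightarrow> real \<Rightarrow> real fps" where
  "mode_rad l a Q Rz \<omega> = rad_fps (\<omega>\<^sup>2 * a\<^sup>2) (\<omega>\<^sup>2 * Q - mode_E l a \<omega>) ((\<omega> * Rz + real l)\<^sup>2)"

lemma mode_E_bounds:
  assumes "4 * (\<omega>\<^sup>2 * a\<^sup>2) \<le> real l + 2"
  shows "real l * (real l + 2) - 1 \<le> mode_E l a \<omega>" "mode_E l a \<omega> \<le> real l * (real l + 2)"
  using ang_shift_bounds[of "\<omega>\<^sup>2 * a\<^sup>2" l] assms by (simp_all add: mode_E_def)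

text \<open>Y is r^2 / a^2 at the boundary r = R \<open>Rz\<close> \<mu>, so Y / (1 + Y) is the
  boundary in the variable x. The lower bounds on l have separate tasks: 4 p^2 a^2 \<le> l + 2 keeps
  the angular construction valid up to p, 8 pi \<le> l makes room for a half-wave, and 2 a \<le> l R
  \<open>Rz\<close> keeps Y \<ge> 2.\<close>

lemma dirichlet_frequency:
  fixes a R Rz Q :: real and l :: nat
  defines "p \<equiv> 2 / (R * Rz)"
  defines "Y \<equiv> \<lambda>\<omega>. R\<^sup>2 * Rz\<^sup>2 * mode_E l a \<omega> / a\<^sup>2"
  assumes pos: "a > 0" "R > 0" "Rz > 0" "Q > 0"
    and l: "l \<ge> 1" "4 * (p\<^sup>2 * a\<^sup>2) \<le> real l + 2" "8 * pi \<le> real l" "2 * a \<le> real l * (R * Rz)"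
  shows "\<exists>\<omega>\<in>{0..p}. eval_fps (mode_rad l a Q Rz \<omega>) (Y \<omega> / (1 + Y \<omega>)) = 0"
proof -
  have p: "p > 0" "p * (R * Rz) = 2" using pos by (simp_all add: p_def)
  have small: "4 * (\<omega>\<^sup>2 * a\<^sup>2) \<le> real l + 2" if "\<omega> \<in> {0..p}" for \<omega>
  proof -
    have "\<omega>\<^sup>2 * a\<^sup>2 \<le> p\<^sup>2 * a\<^sup>2" using that by (intro mult_right_mono power_mono) auto
    then show ?thesis using l(2) by linarith
  qed
  have E: "(real l)\<^sup>2 \<le> mode_E l a \<omega>" if "\<omega> \<in> {0..p}" for \<omega>
    using mode_E_bounds(1)[OF small[OF that]] l(1) by (simp add: power2_eq_square algebra_simps)
  have l0: "(real l)\<^sup>2 > 0" using l(1) by simp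
  have Y: "Y \<omega> > 0" if "\<omega> \<in> {0..p}" for \<omega>
  proof -
    have "mode_E l a \<omega> > 0" using E[OF that] l0 by linarith
    then show ?thesis using pos by (simp add: Y_def)
  qed
  have contE: "continuous_on {0..p} (mode_E l a)"
    unfolding mode_E_def
    by (intro continuous_intros continuous_on_compose2[OF continuous_on_ang_shift[of l]])
      (use small in auto)
  \<comment> \<open>The point where r^2 is half its boundary value. At frequency p, the term
    \<omega>^2 r^2 is still at least 2 \<mu>^2 there.\<close>
  define x1 where "x1 = (Y p / 2) / (1 + Y p / 2)"
  \<comment> \<open>On the outer shell y = r^2 / a^2 is at least Y / 2, and the potential is at
    least y (1 + y) \<mu>^2 / 4 \<ge> Y^2 \<mu>^2 / 16.\<close>
  define K where "K = Y p / 4 * sqrt (mode_E l a p)"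
  have pp: "p \<in> {0..p}" using p by simp
  note Yp = Y[OF pp]
  have Ep: "mode_E l a p > 0" using E[OF pp] l0 by linarith
  have E2: "2 * a\<^sup>2 / (R\<^sup>2 * Rz\<^sup>2) \<le> mode_E l a p"
  proof -
    have "(2 * a)\<^sup>2 \<le> (real l * (R * Rz))\<^sup>2" using l(4) pos by (intro power_mono) auto
    then have "4 * a\<^sup>2 / (R\<^sup>2 * Rz\<^sup>2) \<le> (real l)\<^sup>2"
      using pos by (simp add: power_mult_distrib field_simps)
    moreover have "2 * a\<^sup>2 / (R\<^sup>2 * Rz\<^sup>2) \<le> 4 * a\<^sup>2 / (R\<^sup>2 * Rz\<^sup>2)"
      by (intro divide_right_mono) auto
    ultimately show ?thesis using E[OF pp] by linarith
  qed
  have Y2: "Y p \<ge> 2" using E2 pos unfolding Y_def by (simp add: field_simps)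
  have "\<exists>\<omega>\<in>{0..p}. eval_fps (rad_fps (\<omega>\<^sup>2 * a\<^sup>2) (\<omega>\<^sup>2 * Q - mode_E l a \<omega>) ((\<omega> * Rz + real l)\<^sup>2)) (Y \<omega> / (1 + Y \<omega>)) = 0"
  proof (rule rad_shooting[where K = K and ?x1.0 = x1])
    show "p \<ge> 0" using p by simp
    show "continuous_on {0..p} (\<lambda>\<omega>. \<omega>\<^sup>2 * a\<^sup>2)" "continuous_on {0..p} (\<lambda>\<omega>. (\<omega> * Rz + real l)\<^sup>2)"
      by (intro continuous_intros)+
    show "continuous_on {0..p} (\<lambda>\<omega>. \<omega>\<^sup>2 * Q - mode_E l a \<omega>)"
      by (intro continuous_intros contE)
    have "continuous_on {0..p} Y"
      unfolding Y_def using pos by (intro continuous_intros contE) auto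
    then show "continuous_on {0..p} (\<lambda>\<omega>. Y \<omega> / (1 + Y \<omega>))"
    proof (intro continuous_intros)
      show "\<forall>\<omega>\<in>{0..p}. 1 + Y \<omega> \<noteq> 0"
      proof
        fix \<omega> assume "\<omega> \<in> {0..p}"
        from Y[OF this] show "1 + Y \<omega> \<noteq> 0" by linarith
      qed
    qed
    show "0 < Y \<omega> / (1 + Y \<omega>) \<and> Y \<omega> / (1 + Y \<omega>) < 1" if "\<omega> \<in> {0..p}" for \<omega>
      using Y[OF that] by simp
    \<comment> \<open>At zero frequency the shift vanishes, and the sign condition becomes l^2 \<le>
      l (l + 2) (j + 1).\<close>
    show "0\<^sup>2 * a\<^sup>2 * (real j * (real j + 1) / 2) + (0\<^sup>2 * Q - mode_E l a 0) * (real j + 1) + (0 * Rz + real l)\<^sup>2 \<le> 0" for j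
    proof -
      have "(real l)\<^sup>2 \<le> real l * (real l + 2) * 1" by (simp add: power2_eq_square algebra_simps)
      also have "\<dots> \<le> real l * (real l + 2) * (real j + 1)" by (intro mult_left_mono) auto
      finally show ?thesis by (simp add: mode_E_def ang_shift_def)
    qed
    show "K > 0" using Yp Ep by (simp add: K_def)
    show "0 < x1" using Yp by (simp add: x1_def)
    show "x1 \<le> Y p / (1 + Y p)" using Yp by (simp add: x1_def field_simps)
    show "K * ln (Y p / (1 + Y p) / x1) \<ge> pi"
    proof -
      have q: "Y p / (1 + Y p) / x1 = (2 + Y p) / (1 + Y p)"
      proof -
        have "x1 = Y p / (2 + Y p)" using Yp by (simp add: x1_def field_simps)
        then show ?thesis using Yp by simp
      qed
      \<comment> \<open>The logarithmic width of the shell is at least 1 / (2 + Y) \<ge> 1 / (2 Y),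
        using Y \<ge> 2. Times K this is \<mu> / 8 \<ge> l / 8 \<ge> pi.\<close>
      have "ln ((1 + Y p) / (2 + Y p)) \<le> (1 + Y p) / (2 + Y p) - 1"
        using Yp by (intro ln_le_minus_one) auto
      then have "1 / (2 + Y p) \<le> ln ((2 + Y p) / (1 + Y p))"
        using Yp by (simp add: ln_div field_simps)
      moreover have "1 / (2 * Y p) \<le> 1 / (2 + Y p)" using Y2 by (intro divide_left_mono) auto
      ultimately have "K * (1 / (2 * Y p)) \<le> K * ln ((2 + Y p) / (1 + Y p))"
        using Yp Ep by (intro mult_left_mono) (auto simp: K_def)
      moreover have "K * (1 / (2 * Y p)) = sqrt (mode_E l a p) / 8"
        using Yp by (simp add: K_def)
      moreover have "real l \<le> sqrt (mode_E l a p)" using E[OF pp] by (rule real_le_rsqrt)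
      ultimately show ?thesis unfolding q using l(3) by linarith
    qed
    fix x assume x: "x \<in> {x1..Y p / (1 + Y p)}"
    \<comment> \<open>Back to y = r^2 / a^2, in which x times the potential is a polynomial.\<close>
    define y where "y = x / (1 - x)"
    have x01: "0 < x" "x < 1"
    proof -
      have "0 < x1" "Y p / (1 + Y p) < 1" using Yp by (simp_all add: x1_def)
      then show "0 < x" "x < 1" using x by auto
    qed
    have xy: "x = y / (1 + y)" "1 - x = 1 / (1 + y)" "y > 0" using x01 by (simp_all add: y_def field_simps)
    have y2: "Y p / 2 \<le> y" using x x01 Yp by (simp add: x1_def y_def field_simps)
    have Ay: "2 * mode_E l a p \<le> p\<^sup>2 * a\<^sup>2 * y"
    proof -
      have "p\<^sup>2 * a\<^sup>2 * (Y p / 2) \<le> p\<^sup>2 * a\<^sup>2 * y" using y2 by (intro mult_left_mono) auto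
      moreover have "p\<^sup>2 * a\<^sup>2 * (Y p / 2) = (p * (R * Rz))\<^sup>2 * mode_E l a p / 2"
        using pos by (simp add: Y_def power_mult_distrib)
      ultimately show ?thesis unfolding p(2) by (simp add: mult_ac)
    qed
    have "K\<^sup>2 = (Y p / 2) * (Y p / 2) * mode_E l a p / 4"
      using Ep by (simp add: K_def power_mult_distrib power2_eq_square)
    also have "\<dots> \<le> y * (1 + y) * mode_E l a p / 4"
      using y2 Yp Ep by (intro divide_right_mono mult_right_mono mult_mono) auto
    also have "\<dots> \<le> y * (1 + y) * (p\<^sup>2 * a\<^sup>2 * y + (p\<^sup>2 * Q - mode_E l a p)) / 4"
    proof -
      have "0 \<le> p\<^sup>2 * Q" using pos by simp
      then have "mode_E l a p \<le> p\<^sup>2 * a\<^sup>2 * y + (p\<^sup>2 * Q - mode_E l a p)" using Ay by linarith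
      then show ?thesis using xy(3) by (intro divide_right_mono mult_left_mono) auto
    qed
    also have "\<dots> \<le> y * (1 + y) * (p\<^sup>2 * a\<^sup>2 * y + (p\<^sup>2 * Q - mode_E l a p)) / 4 + y * (p * Rz + real l)\<^sup>2 / 4"
      using xy(3) by simp
    also have "\<dots> = x * (p\<^sup>2 * a\<^sup>2 * x / (1 - x) ^ 3 + (p\<^sup>2 * Q - mode_E l a p) / (1 - x)\<^sup>2 + (p * Rz + real l)\<^sup>2 / (1 - x)) / 4"
    proof -
      have gen: "y * (1 + y) * (A * y + B) / 4 + y * C / 4 = x * (A * x / (1 - x) ^ 3 + B / (1 - x)\<^sup>2 + C / (1 - x)) / 4" for A B C
      proof -
        have "1 + y \<noteq> 0" using xy(3) by simp
        moreover have "x = y / (1 + y)" by (rule xy)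
        ultimately show ?thesis
          unfolding xy(2) by (simp add: power_divide power3_eq_cube power2_eq_square) (simp add: field_simps)
      qed
      show ?thesis by (rule gen)
    qed
    finally show "K\<^sup>2 \<le> x * (p\<^sup>2 * a\<^sup>2 * x / (1 - x) ^ 3 + (p\<^sup>2 * Q - mode_E l a p) / (1 - x)\<^sup>2 + (p * Rz + real l)\<^sup>2 / (1 - x)) / 4" .
  qed
  then show ?thesis by (simp add: mode_rad_def)
qed

section \<open>The radial factor and regularity of the mode\<close>

definition mode_ur :: "nat \<Rightarrow> real \<Rightarrow> real \<Rightarrow> real \<Rightarrow> real \<Rightarrow> real \<Rightarrow> real" where
  "mode_ur l a Q Rz \<omega> r = eval_fps (mode_rad l a Q Rz \<omega>) (r\<^sup>2 / (r\<^sup>2 + a\<^sup>2))"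

lemma compactified_radius:
  fixes a r :: real
  assumes "a > 0"
  shows "\<bar>r\<^sup>2 / (r\<^sup>2 + a\<^sup>2)\<bar> < 1" "1 - r\<^sup>2 / (r\<^sup>2 + a\<^sup>2) = a\<^sup>2 / (r\<^sup>2 + a\<^sup>2)" "r\<^sup>2 + a\<^sup>2 > 0"
proof -
  show "r\<^sup>2 + a\<^sup>2 > 0" using assms by (simp add: add_nonneg_pos)
  then show "1 - r\<^sup>2 / (r\<^sup>2 + a\<^sup>2) = a\<^sup>2 / (r\<^sup>2 + a\<^sup>2)" "\<bar>r\<^sup>2 / (r\<^sup>2 + a\<^sup>2)\<bar> < 1"
    using assms by (simp_all add: field_simps)
qed

lemma mode_ur_ode:
  fixes a r Q Rz \<omega> :: real and l :: nat
  assumes a: "a > 0"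
  defines "ur' \<equiv> \<lambda>r. eval_fps (fps_deriv (mode_rad l a Q Rz \<omega>)) (r\<^sup>2 / (r\<^sup>2 + a\<^sup>2)) * (2 * r * a\<^sup>2 / (r\<^sup>2 + a\<^sup>2)\<^sup>2)"
  shows "(mode_ur l a Q Rz \<omega> has_real_derivative ur' r) (at r)"
    and "((\<lambda>r. r * (r\<^sup>2 + a\<^sup>2) * ur' r) has_real_derivative
       - r * (\<omega>\<^sup>2 * (r\<^sup>2 + Q) + a\<^sup>2 * (\<omega> * Rz + real l)\<^sup>2 / (r\<^sup>2 + a\<^sup>2) - mode_E l a \<omega>) * mode_ur l a Q Rz \<omega> r) (at r)"
proof -
  let ?z = "\<lambda>r. r\<^sup>2 / (r\<^sup>2 + a\<^sup>2)" and ?P = "mode_rad l a Q Rz \<omega>"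
  note z = compactified_radius[OF a]
  have dz: "(?z has_real_derivative 2 * r * a\<^sup>2 / (r\<^sup>2 + a\<^sup>2)\<^sup>2) (at r)" for r
    using z(3)[of r] by (auto intro!: derivative_eq_intros simp: field_simps power2_eq_square)
  show "(mode_ur l a Q Rz \<omega> has_real_derivative ur' r) (at r)"
    unfolding mode_ur_def[abs_def] ur'_def mode_rad_def
    by (rule DERIV_chain2[where g = ?z, OF rad_deriv[OF z(1)] dz])
  have eq: "r * (r\<^sup>2 + a\<^sup>2) * ur' r = 2 * a\<^sup>2 * (?z r * eval_fps (fps_deriv ?P) (?z r))" for r
    using z(3)[of r] by (simp add: ur'_def power2_eq_square)
  have "((\<lambda>r. 2 * a\<^sup>2 * (?z r * eval_fps (fps_deriv ?P) (?z r))) has_real_derivative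
     2 * a\<^sup>2 * ((- (\<omega>\<^sup>2 * a\<^sup>2 * ?z r / (1 - ?z r) ^ 3 + (\<omega>\<^sup>2 * Q - mode_E l a \<omega>) / (1 - ?z r)\<^sup>2 + (\<omega> * Rz + real l)\<^sup>2 / (1 - ?z r)) / 4
        * eval_fps ?P (?z r)) * (2 * r * a\<^sup>2 / (r\<^sup>2 + a\<^sup>2)\<^sup>2))) (at r)"
    unfolding mode_rad_def
    by (rule DERIV_cmult[OF DERIV_chain2[where g = ?z, OF rad_ode[OF z(1)] dz]])
  also have "2 * a\<^sup>2 * ((- (\<omega>\<^sup>2 * a\<^sup>2 * ?z r / (1 - ?z r) ^ 3 + (\<omega>\<^sup>2 * Q - mode_E l a \<omega>) / (1 - ?z r)\<^sup>2 + (\<omega> * Rz + real l)\<^sup>2 / (1 - ?z r)) / 4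
        * eval_fps ?P (?z r)) * (2 * r * a\<^sup>2 / (r\<^sup>2 + a\<^sup>2)\<^sup>2))
     = - r * (\<omega>\<^sup>2 * (r\<^sup>2 + Q) + a\<^sup>2 * (\<omega> * Rz + real l)\<^sup>2 / (r\<^sup>2 + a\<^sup>2) - mode_E l a \<omega>) * mode_ur l a Q Rz \<omega> r"
  proof -
    have gen: "2 * A * ((- (w * A * (s / D) / (A / D) ^ 3 + (w * Q - E) / (A / D)\<^sup>2 + L / (A / D)) / 4 * e) * (2 * r * A / D\<^sup>2))
      = - r * (w * (s + Q) + A * L / D - E) * e" if "A > 0" "D > 0" for A D w s E L e :: real
      using that by (simp add: field_simps power2_eq_square power3_eq_cube)
    show ?thesis
      unfolding z(2) mode_ur_def by (rule gen) (use a z(3) in auto)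
  qed
  finally show "((\<lambda>r. r * (r\<^sup>2 + a\<^sup>2) * ur' r) has_real_derivative
       - r * (\<omega>\<^sup>2 * (r\<^sup>2 + Q) + a\<^sup>2 * (\<omega> * Rz + real l)\<^sup>2 / (r\<^sup>2 + a\<^sup>2) - mode_E l a \<omega>) * mode_ur l a Q Rz \<omega> r) (at r)"
    unfolding eq .
qed

lemma mode_regular:
  assumes a: "a > 0" and c: "0 \<le> c" "4 * c \<le> real l + 2"
  shows "ms_regular Rz \<rho> (mode_fun \<omega> 0 0 (- int l) (mode_ur l a Q Rz' \<omega>') (ang_fun l c))"
  unfolding ms_regular_def
proof (intro exI conjI ballI)
  \<comment> \<open>Since r is the modulus of the last coordinate, x = r^2 / (r^2 + a^2) is a smooth
    function of it with values in [0, 1), inside the disc of convergence. Hence the extension is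
    smooth on the whole ambient space, across r = 0 as well.\<close>
  let ?U = "\<lambda>(t, z1, z2, z3). cis (- \<omega> * t) * cnj z1 ^ l
     * complex_of_real (eval_fps (mode_rad l a Q Rz' \<omega>') ((cmod z3)\<^sup>2 * inverse ((cmod z3)\<^sup>2 + a\<^sup>2)))
     * complex_of_real (eval_fps (ang_fps l c) ((cmod z2)\<^sup>2))"
  have bl: "bounded_linear (\<lambda>z::real \<times> complex \<times> complex \<times> complex. - \<omega> * fst z)"
    "bounded_linear (\<lambda>z::real \<times> complex \<times> complex \<times> complex. cnj (fst (snd z)))"
    "bounded_linear (\<lambda>z::real \<times> complex \<times> complex \<times> complex. fst (snd (snd z)))"
    "bounded_linear (\<lambda>z::real \<times> complex \<times> complex \<times> complex. snd (snd (snd z)))"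
    by (intro bounded_linear_const_mult bounded_linear_compose[OF bounded_linear_cnj]
        bounded_linear_compose[OF bounded_linear_fst] bounded_linear_compose[OF bounded_linear_snd]
        bounded_linear_fst bounded_linear_snd)+
  have z: "\<bar>s\<^sup>2 * inverse (s\<^sup>2 + a\<^sup>2)\<bar> < 1" for s :: real
    using compactified_radius(1)[OF a, of s] by (simp add: divide_inverse)
  have rad: "ereal \<bar>s\<^sup>2 * inverse (s\<^sup>2 + a\<^sup>2)\<bar> < fps_conv_radius (mode_rad l a Q Rz' \<omega>')" for s :: real
    unfolding mode_rad_def by (rule less_le_trans[OF _ rad_conv_radius(1)]) (use z[of s] in simp)
  show "smooth_on UNIV ?U"
    unfolding case_prod_beta
    by (intro smooth_on_mult smooth_on_cis smooth_on_power smooth_on_of_real smooth_on_eval_fps smooth_on_inverse_real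
        smooth_on_cmod_power2 smooth_on_add smooth_on_const smooth_on_bounded_linear bl)
      (use a rad in \<open>auto simp: ang_fps_conv_radius[OF c] add_nonneg_pos\<close>)
  fix x :: "real ^ coord"
  have "cis (- (\<omega> * x $ Tc) - real l * x $ Phc) = cis (- (\<omega> * x $ Tc)) * cis (- (real l * x $ Phc))"
    by (simp add: cis_mult)
  then show "mode_fun \<omega> 0 0 (- int l) (mode_ur l a Q Rz' \<omega>') (ang_fun l c) x = ?U (ms_point Rz x)"
    by (simp add: ms_point_def mode_fun_def mode_ur_def ang_fun_def power_mult_distrib norm_mult cis_cnj
        Complex.DeMoivre divide_inverse mult_ac)
qed auto

lemma mode_exists:
  fixes Q1 Q2 Rz R :: real
  defines "a \<equiv> ms_a Q1 Q2 Rz" and "p \<equiv> 2 / (R * Rz)"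
  assumes Q: "Q1 > 0" "Q2 > 0" "Rz > 0" "R > 0"
    and l: "l \<ge> 2" "4 * (p\<^sup>2 * a\<^sup>2) \<le> real l + 2" "8 * pi \<le> real l" "2 * a \<le> real l * (R * Rz)"
  shows "\<exists>\<omega> \<mu> ur u\<theta>. \<bar>\<omega>\<bar> \<le> p \<and> \<mu> > 0 \<and> \<bar>real l - (\<mu> - 1)\<bar> \<le> 2 / \<mu> \<and>
     mode_solution Q1 Q2 Rz (R * Rz * \<mu>) \<omega> 0 0 (- int l) ur u\<theta> \<and>
     labelled_eigenvalue Q1 Q2 Rz \<omega> 0 (- int l) l (\<mu>\<^sup>2) \<and>
     angular_eigenfunction Q1 Q2 Rz \<omega> 0 (- int l) (\<mu>\<^sup>2) u\<theta>"
proof -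
  have a: "a > 0" using Q by (simp add: a_def ms_a_def)
  have sq: "sqrt (Q1 * Q2) = a * Rz" using Q by (simp add: a_def ms_a_def)
  define Q where "Q = Q1 + Q2"
  have "Q > 0" using Q by (simp add: Q_def)
  obtain \<omega> where \<omega>: "\<omega> \<in> {0..p}" and dir: "eval_fps (mode_rad l a Q Rz \<omega>)
      (R\<^sup>2 * Rz\<^sup>2 * mode_E l a \<omega> / a\<^sup>2 / (1 + R\<^sup>2 * Rz\<^sup>2 * mode_E l a \<omega> / a\<^sup>2)) = 0"
    using dirichlet_frequency[of a R Rz Q l] a Q \<open>Q > 0\<close> l unfolding p_def by auto
  define c where "c = \<omega>\<^sup>2 * a\<^sup>2"
  have c: "0 \<le> c" "4 * c \<le> real l + 2"
  proof -
    have "\<omega>\<^sup>2 * a\<^sup>2 \<le> p\<^sup>2 * a\<^sup>2" using \<omega> by (intro mult_right_mono power_mono) auto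
    then show "4 * c \<le> real l + 2" using l(2) unfolding c_def by linarith
    show "0 \<le> c" by (simp add: c_def)
  qed
  define E where "E = mode_E l a \<omega>"
  have Eb: "real l * (real l + 2) - 1 \<le> E" "E \<le> real l * (real l + 2)"
    using mode_E_bounds c(2) unfolding E_def c_def by auto
  have "real l * real l \<ge> 1 * 1" using l(1) by (intro mult_mono) auto
  then have Epos: "E > 0" using Eb(1) l(1) by (simp add: algebra_simps)
  define \<mu> where "\<mu> = sqrt E"
  have \<mu>: "\<mu> > 0" "\<mu>\<^sup>2 = E" using Epos by (simp_all add: \<mu>_def)
  define ur u\<theta> where "ur = mode_ur l a Q Rz \<omega>" and "u\<theta> = ang_fun l c"
  define \<rho> where "\<rho> = R * Rz * \<mu>"
  have \<rho>: "\<rho> > 0" using Q \<mu> by (simp add: \<rho>_def)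
  have eig: "angular_eigenfunction Q1 Q2 Rz \<omega> 0 (- int l) (\<mu>\<^sup>2) u\<theta>"
    unfolding \<mu>(2) E_def mode_E_def u\<theta>_def c_def[symmetric]
    by (rule ang_fun_eigenfunction) (use Q c l in \<open>auto simp: c_def a_def\<close>)
  have low: "\<mu>\<^sup>2 \<le> E'" if "E' \<in> angular_eigenvalues Q1 Q2 Rz \<omega> 0 (- int l)" for E'
    unfolding \<mu>(2) E_def mode_E_def c_def[symmetric]
    by (rule ang_fun_lowest[OF _ _ _ _ that]) (use Q c l in \<open>auto simp: c_def a_def\<close>)
  \<comment> \<open>With no eigenvalue below, the label is |m_\<phi>| = l.\<close>
  have none: "{E' \<in> angular_eigenvalues Q1 Q2 Rz \<omega> 0 (- int l). E' < \<mu>\<^sup>2} = {}"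
    using low by force
  have lab: "labelled_eigenvalue Q1 Q2 Rz \<omega> 0 (- int l) l (\<mu>\<^sup>2)"
    unfolding labelled_eigenvalue_def none using eig by (auto simp: angular_eigenvalues_def)
  have asym: "\<bar>real l - (\<mu> - 1)\<bar> \<le> 2 / \<mu>"
  proof -
    \<comment> \<open>The bounds on the shift place (l + 1)^2 - \<mu>^2 in [1, 2]; factoring the
      difference of squares gives the rate 2 / \<mu>.\<close>
    define d where "d = real l + 1 - \<mu>"
    have "d * (real l + 1 + \<mu>) = (real l + 1)\<^sup>2 - \<mu>\<^sup>2"
      by (simp add: d_def algebra_simps power2_eq_square)
    then have dd: "1 \<le> d * (real l + 1 + \<mu>)" "d * (real l + 1 + \<mu>) \<le> 2"
      using Eb unfolding \<mu>(2) by (simp_all add: algebra_simps power2_eq_square)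
    have "d > 0"
    proof (rule ccontr)
      assume "\<not> d > 0"
      then have "d * (real l + 1 + \<mu>) \<le> 0" using \<mu>(1) by (intro mult_nonpos_nonneg) auto
      then show False using dd by linarith
    qed
    then have "d * \<mu> \<le> d * (real l + 1 + \<mu>)" by (intro mult_left_mono) auto
    then have "d \<le> 2 / \<mu>" using dd \<mu>(1) by (simp add: field_simps)
    then show ?thesis using \<open>d > 0\<close> by (simp add: d_def)
  qed
  have box0: "box (ms_metric Q1 Q2 Rz) (mode_fun \<omega> 0 0 (- int l) ur u\<theta>) x = 0" if x: "x \<in> ms_interior \<rho>" for x
  proof (rule box_mode_fun[OF Q(1-3) _ _ _ _ x, where E = E])
    fix r :: real
    note ode = mode_ur_ode[OF a, where l = l and Q = Q and Rz = Rz and \<omega> = \<omega> and r = r]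
    show "(ur has_real_derivative (\<lambda>r. eval_fps (fps_deriv (mode_rad l a Q Rz \<omega>)) (r\<^sup>2 / (r\<^sup>2 + a\<^sup>2)) * (2 * r * a\<^sup>2 / (r\<^sup>2 + a\<^sup>2)\<^sup>2)) r) (at r)"
      unfolding ur_def by (rule ode(1))
    have "(\<omega> * sqrt (Q1 * Q2) - a * of_int (- int l))\<^sup>2 = a\<^sup>2 * (\<omega> * Rz + real l)\<^sup>2"
      unfolding sq by (simp add: power2_eq_square algebra_simps)
    then show "((\<lambda>r. r * (r\<^sup>2 + (ms_a Q1 Q2 Rz)\<^sup>2) * (eval_fps (fps_deriv (mode_rad l a Q Rz \<omega>)) (r\<^sup>2 / (r\<^sup>2 + a\<^sup>2)) * (2 * r * a\<^sup>2 / (r\<^sup>2 + a\<^sup>2)\<^sup>2))) has_real_derivative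
       - r * (\<omega>\<^sup>2 * (r\<^sup>2 + Q1 + Q2) + (\<omega> * sqrt (Q1 * Q2) - ms_a Q1 Q2 Rz * of_int (- int l))\<^sup>2 / (r\<^sup>2 + (ms_a Q1 Q2 Rz)\<^sup>2) - E) * ur r) (at r)"
      using ode(2) unfolding a_def[symmetric] ur_def E_def Q_def by (simp only: add.assoc)
  next
    fix t :: real assume t: "0 < t" "t < pi / 2"
    show "(u\<theta> has_real_derivative ang_fun' l c t) (at t)"
      unfolding u\<theta>_def by (rule ang_fun_derivs[OF c])
    have "sin t \<noteq> 0" using t sin_gt_zero[of t] by auto
    from ang_fun_derivs(3)[OF c l(1) this]
    show "((\<lambda>t. sin (2 * t) * ang_fun' l c t) has_real_derivative
       sin (2 * t) * ((of_int (- int l))\<^sup>2 / (sin t)\<^sup>2 - \<omega>\<^sup>2 * (ms_a Q1 Q2 Rz)\<^sup>2 * (cos t)\<^sup>2 - E) * u\<theta> t) (at t)"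
      unfolding u\<theta>_def E_def mode_E_def a_def[symmetric] c_def[symmetric] by simp
  qed
  have dir0: "mode_fun \<omega> 0 0 (- int l) ur u\<theta> x = 0" if "x $ Rc = \<rho>" for x
  proof -
    \<comment> \<open>Identifies the zero found by shooting with the boundary radius for the
      eigenvalue at this same \<omega>.\<close>
    have "\<rho>\<^sup>2 / (\<rho>\<^sup>2 + a\<^sup>2) = R\<^sup>2 * Rz\<^sup>2 * E / a\<^sup>2 / (1 + R\<^sup>2 * Rz\<^sup>2 * E / a\<^sup>2)"
      using a by (simp add: \<rho>_def power_mult_distrib \<mu>(2) field_simps)
    then have "ur \<rho> = 0" using dir by (simp add: ur_def mode_ur_def E_def)
    then show ?thesis by (simp add: mode_fun_def that)
  qed
  have nz: "\<exists>x\<in>ms_region \<rho>. mode_fun \<omega> 0 0 (- int l) ur u\<theta> x \<noteq> 0"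
  proof
    let ?x = "(\<chi> i. if i = Thc then pi / 4 else 0) :: real ^ coord"
    show "?x \<in> ms_region \<rho>" using \<rho> by (simp add: ms_region_def)
    have "u\<theta> (pi / 4) > 0" unfolding u\<theta>_def by (rule ang_fun_pos[OF c]) auto
    moreover have "ur 0 = 1" by (simp add: ur_def mode_ur_def mode_rad_def rad_at_0)
    ultimately show "mode_fun \<omega> 0 0 (- int l) ur u\<theta> ?x \<noteq> 0" by (simp add: mode_fun_def)
  qed
  have sol: "mode_solution Q1 Q2 Rz (R * Rz * \<mu>) \<omega> 0 0 (- int l) ur u\<theta>"
    unfolding mode_solution_def Let_def \<rho>_def[symmetric]
    using mode_regular[OF a c, of Rz \<rho> \<omega> Q Rz \<omega>] nz box0 dir0 by (auto simp: ur_def u\<theta>_def)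
  have "\<bar>\<omega>\<bar> \<le> p" using \<omega> by simp
  then show ?thesis using \<mu>(1) asym sol lab eig by blast
qed

theorem theorem6p1:
  fixes Q1 Q2 Rz :: real
  assumes "Q1 > 0" and "Q2 > 0" and "Rz > 0"
  shows "\<exists>R0>0. \<forall>R\<ge>R0. \<exists>\<omega>0. \<forall>\<omega>max\<ge>\<omega>0.
    \<exists>(\<omega> :: nat \<Rightarrow> real) (lam :: nat \<Rightarrow> real) (m\<psi> :: nat \<Rightarrow> int) (m\<phi> :: nat \<Rightarrow> int)
      (\<mu> :: nat \<Rightarrow> real) (ur :: nat \<Rightarrow> real \<Rightarrow> real) (u\<theta> :: nat \<Rightarrow> real \<Rightarrow> real).
      (\<forall>\<^sub>F l in sequentially.
         m\<psi> l = 0 \<and> m\<phi> l = - int l \<and> \<mu> l > 0 \<and>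
         mode_solution Q1 Q2 Rz (R * Rz * \<mu> l) (\<omega> l) (lam l) (m\<psi> l) (m\<phi> l) (ur l) (u\<theta> l) \<and>
         labelled_eigenvalue Q1 Q2 Rz (\<omega> l) (lam l) (m\<phi> l) l ((\<mu> l)\<^sup>2) \<and>
         angular_eigenfunction Q1 Q2 Rz (\<omega> l) (lam l) (m\<phi> l) ((\<mu> l)\<^sup>2) (u\<theta> l) \<and>
         \<bar>\<omega> l\<bar> \<le> \<omega>max) \<and>
      (\<lambda>l. real l - (\<mu> l - 1)) \<in> O(\<lambda>l. 1 / \<mu> l)"
\<comment> \<open>The construction uses R only through R > 0, which the threshold 1
  guarantees.\<close>
proof (rule exI[of _ 1], intro conjI allI impI)
  fix R :: real assume "R \<ge> 1"
  then have R: "R > 0" by simp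
  define a where "a = ms_a Q1 Q2 Rz"
  define p where "p = 2 / (R * Rz)"
  show "\<exists>\<omega>0. \<forall>\<omega>max\<ge>\<omega>0.
    \<exists>(\<omega> :: nat \<Rightarrow> real) (lam :: nat \<Rightarrow> real) (m\<psi> :: nat \<Rightarrow> int) (m\<phi> :: nat \<Rightarrow> int)
      (\<mu> :: nat \<Rightarrow> real) (ur :: nat \<Rightarrow> real \<Rightarrow> real) (u\<theta> :: nat \<Rightarrow> real \<Rightarrow> real).
      (\<forall>\<^sub>F l in sequentially.
         m\<psi> l = 0 \<and> m\<phi> l = - int l \<and> \<mu> l > 0 \<and>
         mode_solution Q1 Q2 Rz (R * Rz * \<mu> l) (\<omega> l) (lam l) (m\<psi> l) (m\<phi> l) (ur l) (u\<theta> l) \<and>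
         labelled_eigenvalue Q1 Q2 Rz (\<omega> l) (lam l) (m\<phi> l) l ((\<mu> l)\<^sup>2) \<and>
         angular_eigenfunction Q1 Q2 Rz (\<omega> l) (lam l) (m\<phi> l) ((\<mu> l)\<^sup>2) (u\<theta> l) \<and>
         \<bar>\<omega> l\<bar> \<le> \<omega>max) \<and>
      (\<lambda>l. real l - (\<mu> l - 1)) \<in> O(\<lambda>l. 1 / \<mu> l)"
  \<comment> \<open>All frequencies found lie in [0, p], and p does not depend on l.\<close>
  proof (rule exI[of _ p], intro allI impI)
    fix \<omega>max assume \<omega>max: "p \<le> \<omega>max"
    \<comment> \<open>The four lower bounds on l required by \<open>mode_exists\<close> are
      nonnegative, so their sum dominates each of them.\<close>
    obtain N :: nat where N: "2 + 4 * (p\<^sup>2 * a\<^sup>2) + 8 * pi + 2 * a / (R * Rz) \<le> real N"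
      using real_arch_simple by blast
    have ap: "a / (R * Rz) \<ge> 0" using assms R by (simp add: a_def ms_a_def)
    define Pr where "Pr l \<omega> \<mu> ur u\<theta> \<longleftrightarrow> \<bar>\<omega>\<bar> \<le> p \<and> \<mu> > 0 \<and> \<bar>real l - (\<mu> - 1)\<bar> \<le> 2 / \<mu> \<and>
     mode_solution Q1 Q2 Rz (R * Rz * \<mu>) \<omega> 0 0 (- int l) ur u\<theta> \<and>
     labelled_eigenvalue Q1 Q2 Rz \<omega> 0 (- int l) l (\<mu>\<^sup>2) \<and>
     angular_eigenfunction Q1 Q2 Rz \<omega> 0 (- int l) (\<mu>\<^sup>2) u\<theta>" for l \<omega> \<mu> ur u\<theta>
    have ex: "\<exists>\<omega> \<mu> ur u\<theta>. Pr l \<omega> \<mu> ur u\<theta>" if "l \<ge> N" for l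
      unfolding Pr_def p_def
    proof (rule mode_exists[OF assms R])
      have lN: "2 + 4 * (p\<^sup>2 * a\<^sup>2) + 8 * pi + 2 * (a / (R * Rz)) \<le> real l" using N that by simp
      have nn: "0 \<le> 4 * (p\<^sup>2 * a\<^sup>2)" "0 \<le> 8 * pi" by simp_all
      show "4 * ((2 / (R * Rz))\<^sup>2 * (ms_a Q1 Q2 Rz)\<^sup>2) \<le> real l + 2"
        using lN nn ap unfolding p_def[symmetric] a_def[symmetric] by linarith
      show "8 * pi \<le> real l" using lN nn ap by linarith
      have "2 \<le> real l" using lN nn ap by linarith
      then show "2 \<le> l" by simp
      have "2 * (a / (R * Rz)) \<le> real l" using lN nn by linarith
      then show "2 * ms_a Q1 Q2 Rz \<le> real l * (R * Rz)"
        using assms R unfolding a_def[symmetric] by (simp add: field_simps)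
    qed
    define \<omega> where "\<omega> l = (SOME \<omega>. \<exists>\<mu> ur u\<theta>. Pr l \<omega> \<mu> ur u\<theta>)" for l
    define \<mu> where "\<mu> l = (SOME \<mu>. \<exists>ur u\<theta>. Pr l (\<omega> l) \<mu> ur u\<theta>)" for l
    define ur where "ur l = (SOME ur. \<exists>u\<theta>. Pr l (\<omega> l) (\<mu> l) ur u\<theta>)" for l
    define u\<theta> where "u\<theta> l = (SOME u\<theta>. Pr l (\<omega> l) (\<mu> l) (ur l) u\<theta>)" for l
    have Pr: "Pr l (\<omega> l) (\<mu> l) (ur l) (u\<theta> l)" if "l \<ge> N" for l
    proof -
      have "\<exists>\<mu> ur u\<theta>. Pr l (\<omega> l) \<mu> ur u\<theta>" unfolding \<omega>_def by (rule someI_ex[OF ex[OF that]])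
      then have "\<exists>ur u\<theta>. Pr l (\<omega> l) (\<mu> l) ur u\<theta>" unfolding \<mu>_def by (rule someI_ex)
      then have "\<exists>u\<theta>. Pr l (\<omega> l) (\<mu> l) (ur l) u\<theta>" unfolding ur_def by (rule someI_ex)
      then show ?thesis unfolding u\<theta>_def by (rule someI_ex)
    qed
    show "\<exists>(\<omega> :: nat \<Rightarrow> real) (lam :: nat \<Rightarrow> real) (m\<psi> :: nat \<Rightarrow> int) (m\<phi> :: nat \<Rightarrow> int)
      (\<mu> :: nat \<Rightarrow> real) (ur :: nat \<Rightarrow> real \<Rightarrow> real) (u\<theta> :: nat \<Rightarrow> real \<Rightarrow> real).
      (\<forall>\<^sub>F l in sequentially.
         m\<psi> l = 0 \<and> m\<phi> l = - int l \<and> \<mu> l > 0 \<and>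
         mode_solution Q1 Q2 Rz (R * Rz * \<mu> l) (\<omega> l) (lam l) (m\<psi> l) (m\<phi> l) (ur l) (u\<theta> l) \<and>
         labelled_eigenvalue Q1 Q2 Rz (\<omega> l) (lam l) (m\<phi> l) l ((\<mu> l)\<^sup>2) \<and>
         angular_eigenfunction Q1 Q2 Rz (\<omega> l) (lam l) (m\<phi> l) ((\<mu> l)\<^sup>2) (u\<theta> l) \<and>
         \<bar>\<omega> l\<bar> \<le> \<omega>max) \<and>
      (\<lambda>l. real l - (\<mu> l - 1)) \<in> O(\<lambda>l. 1 / \<mu> l)"
    proof (rule exI[of _ \<omega>], rule exI[of _ "\<lambda>_. 0"], rule exI[of _ "\<lambda>_. 0"], rule exI[of _ "\<lambda>l. - int l"],
        rule exI[of _ \<mu>], rule exI[of _ ur], rule exI[of _ u\<theta>], rule conjI)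
      show "\<forall>\<^sub>F l in sequentially. (0::int) = 0 \<and> - int l = - int l \<and> \<mu> l > 0 \<and>
         mode_solution Q1 Q2 Rz (R * Rz * \<mu> l) (\<omega> l) 0 0 (- int l) (ur l) (u\<theta> l) \<and>
         labelled_eigenvalue Q1 Q2 Rz (\<omega> l) 0 (- int l) l ((\<mu> l)\<^sup>2) \<and>
         angular_eigenfunction Q1 Q2 Rz (\<omega> l) 0 (- int l) ((\<mu> l)\<^sup>2) (u\<theta> l) \<and>
         \<bar>\<omega> l\<bar> \<le> \<omega>max"
        using eventually_ge_at_top[of N]
        by eventually_elim (use Pr \<omega>max in \<open>fastforce simp: Pr_def\<close>)
      show "(\<lambda>l. real l - (\<mu> l - 1)) \<in> O(\<lambda>l. 1 / \<mu> l)"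
      proof (rule bigoI[of _ 2])
        have "norm (real l - (\<mu> l - 1)) \<le> 2 * norm (1 / \<mu> l)" if "l \<ge> N" for l
          using Pr[OF that] by (simp add: Pr_def)
        then show "\<forall>\<^sub>F l in sequentially. norm (real l - (\<mu> l - 1)) \<le> 2 * norm (1 / \<mu> l)"
          by (rule eventually_sequentiallyI)
      qed
    qed
  qed
qed simp

end
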